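(* Let $\{F_n\}_{n\ge 0}$ be the Fibonacci sequence, defined by $F_0=0$, $F_1=1$ and $F_{n+2}=F_{n+1}+F_n$ for all $n\ge 0$. The only integers $c$ having at least two representations of the form $c=F_n-3^m$ with integers $n\ge 2$ and $m\ge 0$ are $c\in\{-26,-6,-1,0,2,4,7,12\}$. Furthermore, all the representations of these integers as $F_n-3^m$ with integers $n\ge 2$ and $m\ge 0$ are exactly: $-26=F_{10}-3^4=F_2-3^3$; $-6=F_8-3^3=F_4-3^2$; $-1=F_6-3^2=F_3-3^1$; $0=F_4-3^1=F_2-3^0$; $2=F_5-3^1=F_4-3^0$; $4=F_7-3^2=F_5-3^0$; $7=F_9-3^3=F_6-3^0$; $12=F_8-3^2=F_7-3^0$.
   Context: A representation of $c$ is a pair $(n,m)$ of integers with $n\ge 2$, $m\ge 0$ and $F_n-3^m=c$; two representations are distinct if the pairs $(n,m)$ differ. (The restriction $n\ge 2$ avoids counting $F_1=F_2=1$ as giving different representations.) *)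

theory Defs
  imports "HOL-Number_Theory.Fib"
begin

definition reps :: "int \<Rightarrow> (nat \<times> nat) set" where
  "reps c = {(n, m). n \<ge> 2 \<and> int (fib n) - 3 ^ m = c}"

end

(* Two representations of c give F_n - F_l = 3^m - 3^i. With d = n - l, k = m - i, D = phi^(-d) and
   E = 3^(-k) this says that n ln phi - m ln 3 - ln (sqrt 5) + ln (1 - D) - ln (1 - E) is of size 3^(-m);
   dropping the factors with D or E costs only O(D), O(E).

   Lower bound. A linear form n ln phi - m ln 3 - ln gamma in three logarithms becomes one in two
   logarithms, b ln alpha - ln beta, if alpha = phi^p / 3^q for a Dirichlet approximation p / q of
   ln 3 / ln phi with free parameter Q >= q and beta absorbs gamma and the remainders of n and m
   modulo p and q. Laurent's interpolation determinant with rows binomial(x, k) z^l in the points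
   (i + b j, alpha^i beta^j) then applies: it is small by a Schwarz lemma, nonzero by a zero
   estimate, and, being in Z[phi] up to a denominator, not too small by Liouville's inequality. Applied to the
   forms with no, one and both of D, E, it gives m < 10^120.

   Reduction. If P / Q is a convergent of ln phi / ln 3, then Q w / ln 3, with
   w = ln (sqrt 5) - ln (1 - D) + ln (1 - E), is close to an integer, which rigorous fixed-point
   values of the logarithms exclude unless D, E and finally 3^(-m) are large. The reduction for
   m < 10^120 uses only ln (sqrt 5); it bounds min (d ln phi) (k ln 3), and with this bound the
   linear forms give m < 10^51. Reducing this by tables over d and over k, and taking the linear forms
   once more, gives m < 10^18; two reductions over pairs (d, k) leave m < 60 and then m <= 21. *)

theory Submission
  imports Defs "HOL-Analysis.Harmonic_Numbers" "HOL-Analysis.Complex_Transcendental"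
    "HOL-Analysis.Kronecker_Approximation_Theorem" "Jordan_Normal_Form.Determinant"
begin

section \<open>Interpolation determinants\<close>

text \<open>The obstacle is the third logarithm: the lower bound must have an exponent that grows
  more slowly than m ln 3. Since \<alpha> differs from 1 by at most about 1/Q, the exponential rows
  vary slowly, while the heights are about Q for \<alpha> and h + Q + m/Q for \<beta>, h being the
  height of gamma. The form is then at least exp (- c (ln Q)^2 (Q h + Q^2 + m/Q)), and Q is free. Up
  to logarithms, bounded h and Q = m^(1/3) give the exponent m^(2/3); this is the height in the next
  form, where Q = m^(1/6) gives m^(5/6); then Q = m^(1/12) gives m^(11/12). The last exponent is
  only slightly below m, so the logarithms push the first bound up to 10^120. A reduction that
  bounds the smaller height, or both, shortens this chain; hence 10^51 and 10^18. All numerical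
  certificates are evaluated by \<open>code_simp\<close>, that is by rewriting, so they are arranged
  as integer operations on binary numerals.\<close>

definition fdet :: "nat \<Rightarrow> (nat \<Rightarrow> nat \<Rightarrow> 'a::comm_ring_1) \<Rightarrow> 'a" where
  "fdet n f = det (mat n n (\<lambda>(i, j). f i j))"

lemma fdet_leibniz:
  "fdet n f = (\<Sum>p | p permutes {..<n}. signof p * (\<Prod>i<n. f i (p i)))"
proof -
  have "fdet n f = (\<Sum>p | p permutes {0..<n}. signof p *
      (\<Prod>i = 0..<n. mat n n (\<lambda>(i, j). f i j) $$ (i, p i)))"
    unfolding fdet_def by (rule det_def') simp
  also have "\<dots> = (\<Sum>p | p permutes {0..<n}. signof p * (\<Prod>i = 0..<n. f i (p i)))"
  proof (intro sum.cong refl arg_cong2[where f = "(*)"] prod.cong)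
    fix p i assume "p \<in> {p. p permutes {0..<n}}" "i \<in> {0..<n}"
    then have "p i < n" "i < n" using permutes_in_image[of p "{0..<n}" i] by auto
    then show "mat n n (\<lambda>(i, j). f i j) $$ (i, p i) = f i (p i)" by simp
  qed
  finally show ?thesis by (simp add: lessThan_atLeast0)
qed

lemma fdet_cong:
  assumes "\<And>i j. i < n \<Longrightarrow> j < n \<Longrightarrow> f i j = g i j"
  shows "fdet n f = fdet n g"
  unfolding fdet_def using assms by (intro arg_cong[where f = det] eq_matI) auto

lemma fdet_scale:
  "fdet n (\<lambda>i j. r i * c j * f i j) = (\<Prod>i<n. r i) * (\<Prod>j<n. c j) * fdet n f"
proof -
  have "signof p * (\<Prod>i<n. r i * c (p i) * f i (p i)) =
      (\<Prod>i<n. r i) * (\<Prod>j<n. c j) * (signof p * (\<Prod>i<n. f i (p i)))" if "p permutes {..<n}" for p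
  proof -
    have "(\<Prod>i<n. c (p i)) = (\<Prod>j<n. c j)"
      using prod.permute[OF that, of c] by (simp add: o_def)
    then show ?thesis by (simp add: prod.distrib mult_ac)
  qed
  then show ?thesis unfolding fdet_leibniz sum_distrib_left by (intro sum.cong) auto
qed

lemma hom_fdet:
  assumes "comm_ring_hom h"
  shows "h (fdet n f) = fdet n (\<lambda>i j. h (f i j))"
proof -
  interpret comm_ring_hom h by fact
  have "map_mat h (mat n n (\<lambda>(i, j). f i j)) = mat n n (\<lambda>(i, j). h (f i j))"
    by (intro eq_matI) auto
  then show ?thesis unfolding fdet_def using hom_det by metis
qed

lemma fdet_eq_rows:
  assumes "i < n" "i' < n" "i \<noteq> i'" "\<And>j. j < n \<Longrightarrow> f i j = f i' j"
  shows "fdet n f = 0"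
  unfolding fdet_def
  by (rule det_identical_rows[of _ n i i']) (use assms in \<open>auto intro!: eq_vecI\<close>)

lemma abs_fdet_le:
  fixes f :: "nat \<Rightarrow> nat \<Rightarrow> real"
  assumes "\<And>i j. i < n \<Longrightarrow> j < n \<Longrightarrow> \<bar>f i j\<bar> \<le> r i * c j"
  shows "\<bar>fdet n f\<bar> \<le> fact n * (\<Prod>i<n. r i) * (\<Prod>j<n. c j)"
proof -
  have "\<bar>signof p * (\<Prod>i<n. f i (p i))\<bar> \<le> (\<Prod>i<n. r i) * (\<Prod>j<n. c j)" if "p permutes {..<n}" for p
  proof -
    have "\<bar>signof p * (\<Prod>i<n. f i (p i))\<bar> = (\<Prod>i<n. \<bar>f i (p i)\<bar>)"
      by (simp add: abs_mult abs_prod sign_def)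
    also have "\<dots> \<le> (\<Prod>i<n. r i * c (p i))"
      using permutes_in_image[OF that] assms by (intro prod_mono) auto
    also have "\<dots> = (\<Prod>i<n. r i) * (\<Prod>j<n. c j)"
      using prod.permute[OF that, of c] by (simp add: o_def prod.distrib)
    finally show ?thesis .
  qed
  then have "\<bar>fdet n f\<bar> \<le> (\<Sum>p | p permutes {..<n}. (\<Prod>i<n. r i) * (\<Prod>j<n. c j))"
    unfolding fdet_leibniz by (intro order.trans[OF sum_abs] sum_mono) auto
  then show ?thesis by (simp add: card_permutations[of "{..<n}" n])
qed

lemma fdet_expand:
  assumes "finite T"
  shows "fdet n (\<lambda>i j. \<Sum>t\<in>T. v i t j) = (\<Sum>\<tau>\<in>{..<n} \<rightarrow>\<^sub>E T. fdet n (\<lambda>i j. v i (\<tau> i) j))"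
proof -
  have "fdet n (\<lambda>i j. \<Sum>t\<in>T. v i t j) =
     (\<Sum>p | p permutes {..<n}. \<Sum>\<tau>\<in>{..<n} \<rightarrow>\<^sub>E T. signof p * (\<Prod>i<n. v i (\<tau> i) (p i)))"
    unfolding fdet_leibniz using assms by (simp add: prod_sum_PiE sum_distrib_left)
  also have "\<dots> = (\<Sum>\<tau>\<in>{..<n} \<rightarrow>\<^sub>E T. fdet n (\<lambda>i j. v i (\<tau> i) j))"
    unfolding fdet_leibniz by (rule sum.swap)
  finally show ?thesis .
qed

section \<open>Schwarz lemma for interpolation determinants\<close>

lemma sum_distinct_ge:
  fixes A :: "nat set"
  assumes "finite A"
  shows "(\<Sum>i<card A. i) \<le> \<Sum>A"
  using assms
proof (induction "card A" arbitrary: A)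
  case (Suc n)
  then have ne: "A \<noteq> {}" by auto
  define x where "x = Max A"
  have x: "x \<in> A" using Suc ne by (simp add: x_def)
  have "A \<subseteq> {..x}" using Suc by (auto simp: x_def)
  then have "card A \<le> x + 1" using card_mono[of "{..x}" A] by simp
  then have nx: "n \<le> x" using Suc by simp
  have c: "card (A - {x}) = n" using x Suc by simp
  have "(\<Sum>i<n. i) \<le> \<Sum>(A - {x})"
    using Suc.hyps(1)[of "A - {x}"] Suc.prems c by simp
  moreover have "\<Sum>A = x + \<Sum>(A - {x})" using Suc x by (simp add: sum.remove)
  moreover have "(\<Sum>i<card A. i) = (\<Sum>i<n. i) + n"
    unfolding Suc.hyps(2)[symmetric] by simp
  ultimately show ?case using nx by linarith
qed simp

text \<open>Weight \<open>n\<close> marks an error entry and may repeat, the other weights are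
  distinct. The distinct ones sum to at least 0 + ... + (card J - 1), and every further weight
  \<open>n\<close> exceeds the index it replaces.\<close>

lemma sum_weights_ge:
  fixes w :: "nat \<Rightarrow> nat"
  assumes "inj_on w {i. i < n \<and> w i \<noteq> n}"
  shows "(\<Sum>i<n. i) \<le> (\<Sum>i<n. w i)"
proof -
  define J where "J = {i. i < n \<and> w i \<noteq> n}"
  have fJ: "finite J" "J \<subseteq> {..<n}" by (auto simp: J_def)
  have cJ: "card J \<le> n" using card_mono[of "{..<n}" J] fJ by simp
  have "(\<Sum>i<n. w i) = (\<Sum>i\<in>J. w i) + (\<Sum>i\<in>{..<n} - J. w i)"
    using sum.subset_diff[OF fJ(2), of w] by simp
  also have "(\<Sum>i\<in>{..<n} - J. w i) = (\<Sum>i\<in>{..<n} - J. n)"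
    by (intro sum.cong) (auto simp: J_def)
  also have "\<dots> = (n - card J) * n" using fJ by (simp add: card_Diff_subset)
  also have "(\<Sum>i\<in>J. w i) = \<Sum>(w ` J)" using assms by (simp add: sum.reindex J_def)
  finally have 1: "(\<Sum>i<n. w i) = \<Sum>(w ` J) + (n - card J) * n" .
  have "card (w ` J) = card J" using assms by (simp add: card_image J_def)
  then have 2: "(\<Sum>i<card J. i) \<le> \<Sum>(w ` J)" using sum_distinct_ge[of "w ` J"] fJ by simp
  have "(\<Sum>i<n. i) = (\<Sum>i<card J. i) + (\<Sum>i\<in>{card J..<n}. i)"
    using cJ by (metis atLeast0LessThan sum.atLeastLessThan_concat le0)
  also have "(\<Sum>i\<in>{card J..<n}. i) \<le> (\<Sum>i\<in>{card J..<n}. n)" by (intro sum_mono) auto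
  also have "(\<Sum>i\<in>{card J..<n}. n) = (n - card J) * n" by simp
  finally show ?thesis using 1 2 by linarith
qed

text \<open>For \<open>t\<close> \<ge> 0 a submultiplicative norm. It stands in for the maximum on
  the disc of radius \<open>t\<close> in the analytic Schwarz lemma, so that no complex analysis
  enters.\<close>

definition pmaj :: "real poly \<Rightarrow> real \<Rightarrow> real" where
  "pmaj p = poly (map_poly abs p)"

lemma pmaj_0 [simp]: "pmaj 0 t = 0"
  by (simp add: pmaj_def)

lemma pmaj_pCons [simp]: "pmaj (pCons a p) t = \<bar>a\<bar> + t * pmaj p t"
  by (simp add: pmaj_def map_poly_pCons)

lemma pmaj_altdef: "pmaj p t = (\<Sum>i\<le>degree p. \<bar>coeff p i\<bar> * t ^ i)"
proof -
  have "degree (map_poly abs p) = degree p" by (cases "p = 0") (auto intro!: map_poly_degree_eq)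
  then show ?thesis by (simp add: pmaj_def poly_altdef coeff_map_poly)
qed

lemma poly_altdef_le: "degree p \<le> D \<Longrightarrow> poly p x = (\<Sum>i\<le>D. coeff p i * x ^ i)"
  for p :: "real poly"
  unfolding poly_altdef by (intro sum.mono_neutral_left) (auto simp: coeff_eq_0)

lemma pmaj_nonneg: "t \<ge> 0 \<Longrightarrow> pmaj p t \<ge> 0"
  by (induction p) auto

lemma pmaj_add: "t \<ge> 0 \<Longrightarrow> pmaj (p + q) t \<le> pmaj p t + pmaj q t"
proof (induction p q rule: poly_induct2)
  case (pCons a p b q)
  then have "t * pmaj (p + q) t \<le> t * (pmaj p t + pmaj q t)" by (intro mult_left_mono) auto
  then show ?case by (simp add: distrib_left)
qed simp

lemma pmaj_smult [simp]: "pmaj (smult c p) t = \<bar>c\<bar> * pmaj p t"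
  by (induction p) (auto simp: abs_mult algebra_simps)

lemma pmaj_mult: "t \<ge> 0 \<Longrightarrow> pmaj (p * q) t \<le> pmaj p t * pmaj q t"
proof (induction p)
  case (pCons a p)
  have "pmaj (pCons a p * q) t \<le> pmaj (smult a q) t + pmaj (pCons 0 (p * q)) t"
    using pmaj_add[of t "smult a q" "pCons 0 (p * q)"] pCons.prems by simp
  also have "\<dots> \<le> \<bar>a\<bar> * pmaj q t + t * (pmaj p t * pmaj q t)"
    using pCons by (simp add: mult_left_mono)
  finally show ?case by (simp add: algebra_simps)
qed simp

lemma pmaj_sum: "t \<ge> 0 \<Longrightarrow> pmaj (sum f A) t \<le> (\<Sum>a\<in>A. pmaj (f a) t)"
proof (induction A rule: infinite_finite_induct)
  case (insert x F)
  then show ?case using pmaj_add[of t "f x" "sum f F"] by simp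
qed simp_all

lemma pmaj_prod:
  assumes "t \<ge> 0"
  shows "pmaj (prod f A) t \<le> (\<Prod>a\<in>A. pmaj (f a) t)"
proof (induction A rule: infinite_finite_induct)
  case (insert x F)
  then have "pmaj (f x) t * pmaj (prod f F) t \<le> pmaj (f x) t * (\<Prod>a\<in>F. pmaj (f a) t)"
    using assms by (intro mult_left_mono pmaj_nonneg)
  then show ?case using insert pmaj_mult[OF assms, of "f x" "prod f F"] by simp
qed (simp_all add: one_pCons)

text \<open>This is the Schwarz lemma of the interpolation determinant method in algebraic form: after
  expanding the rows in monomials only tuples of distinct degrees survive, so at least
  \<open>n (n - 1) / 2\<close> powers of the dilation factor are gained. An error term counts as degree \<open>n\<close>.\<close>

lemma interpolation_det_upper:
  fixes p :: "nat \<Rightarrow> real poly" and E :: "nat \<Rightarrow> nat \<Rightarrow> real"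
  assumes Y: "Y \<ge> 0" and rho: "\<rho> \<ge> 1"
    and y: "\<And>j. j < n \<Longrightarrow> \<bar>y j\<bar> \<le> Y"
    and p: "\<And>i. i < n \<Longrightarrow> pmaj (p i) (\<rho> * Y) \<le> G i"
    and E: "\<And>i j. i < n \<Longrightarrow> j < n \<Longrightarrow> \<bar>E i j\<bar> \<le> G i / \<rho> ^ n"
  shows "\<bar>fdet n (\<lambda>i j. poly (p i) (y j) + E i j)\<bar>
      \<le> fact n * (\<Prod>i<n. 2 * G i) / \<rho> ^ (\<Sum>i<n. i)"
proof -
  have rho0: "\<rho> > 0" using rho by simp
  define D where "D = (MAX i\<in>{..<n}. degree (p i))"
  have D: "degree (p i) \<le> D" if "i < n" for i using that by (auto simp: D_def)
  \<comment> \<open>Index \<open>Suc D\<close> of the expansion is the error term; \<open>w\<close>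
    gives it degree \<open>n\<close>, matching the factor \<open>1 / \<rho> ^ n\<close> it already
    carries.\<close>
  define T where "T = {..Suc D}"
  have finT: "finite T" by (simp add: T_def)
  define v where "v i t j = (if t = Suc D then E i j else coeff (p i) t * y j ^ t)" for i t j
  define w where "w t = (if t = Suc D then n else t)" for t
  define g where "g i t = (if t = Suc D then G i else \<bar>coeff (p i) t\<bar> * (\<rho> * Y) ^ t)" for i t
  have eq: "fdet n (\<lambda>i j. poly (p i) (y j) + E i j) = fdet n (\<lambda>i j. \<Sum>t\<in>T. v i t j)"
  proof (rule fdet_cong)
    fix i j assume i: "i < n"
    have "(\<Sum>t\<in>T. v i t j) = (\<Sum>t\<le>D. coeff (p i) t * y j ^ t) + E i j"
      by (simp add: T_def v_def)
    then show "poly (p i) (y j) + E i j = (\<Sum>t\<in>T. v i t j)"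
      using D[OF i] by (simp add: poly_altdef_le[of _ D])
  qed
  have G0: "G i \<ge> 0" if "i < n" for i
    using order.trans[OF pmaj_nonneg p[OF that]] Y rho by simp
  have g0: "g i t \<ge> 0" if "i < n" for i t using G0[OF that] Y rho by (simp add: g_def)
  have bound: "\<bar>fdet n (\<lambda>i j. v i (\<tau> i) j)\<bar> \<le> fact n * (\<Prod>i<n. g i (\<tau> i)) / \<rho> ^ (\<Sum>i<n. i)"
    if \<tau>: "\<tau> \<in> {..<n} \<rightarrow>\<^sub>E T" for \<tau>
  proof (cases "inj_on \<tau> {i. i < n \<and> \<tau> i \<noteq> Suc D}")
    case False
    then obtain i i' where i: "i < n" "i' < n" "i \<noteq> i'" "\<tau> i = \<tau> i'" "\<tau> i \<noteq> Suc D"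
      by (auto simp: inj_on_def)
    \<comment> \<open>Two rows that picked the same monomial are proportional: with their
      coefficients pulled out they coincide, and the determinant vanishes.\<close>
    define r where "r k = (if k = i then coeff (p i) (\<tau> i) else if k = i' then coeff (p i') (\<tau> i) else 1)" for k
    define f where "f k j = (if k = i \<or> k = i' then y j ^ \<tau> i else v k (\<tau> k) j)" for k j
    have "fdet n (\<lambda>i j. v i (\<tau> i) j) = fdet n (\<lambda>k j. r k * 1 * f k j)"
      using i by (intro fdet_cong) (auto simp: r_def f_def v_def)
    also have "\<dots> = 0" unfolding fdet_scale
      using fdet_eq_rows[of i n i' f] i by (simp add: f_def[abs_def])
    finally have "fdet n (\<lambda>i j. v i (\<tau> i) j) = 0" .
    moreover have "(\<Prod>i<n. g i (\<tau> i)) \<ge> 0" using g0 by (intro prod_nonneg) auto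
    ultimately show ?thesis using rho0 by simp
  next
    case True
    have "inj_on (\<lambda>i. w (\<tau> i)) {i. i < n \<and> w (\<tau> i) \<noteq> n}"
    proof (rule inj_onI)
      fix i i' assume i: "i \<in> {i. i < n \<and> w (\<tau> i) \<noteq> n}" "i' \<in> {i. i < n \<and> w (\<tau> i) \<noteq> n}"
        and eq: "w (\<tau> i) = w (\<tau> i')"
      then have ne: "\<tau> i \<noteq> Suc D" "\<tau> i' \<noteq> Suc D" by (auto simp: w_def)
      then have "\<tau> i = \<tau> i'" using eq by (simp add: w_def)
      then show "i = i'" using True i ne by (auto dest: inj_onD)
    qed
    then have wge: "(\<Sum>i<n. i) \<le> (\<Sum>i<n. w (\<tau> i))" by (rule sum_weights_ge)
    have "\<bar>fdet n (\<lambda>i j. v i (\<tau> i) j)\<bar> \<le> fact n * (\<Prod>i<n. g i (\<tau> i) / \<rho> ^ w (\<tau> i)) * (\<Prod>j<n. 1)"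
    proof (rule abs_fdet_le)
      fix i j assume ij: "i < n" "j < n"
      have "\<bar>coeff (p i) t\<bar> * \<bar>y j\<bar> ^ t \<le> \<bar>coeff (p i) t\<bar> * Y ^ t" for t
        using y[OF ij(2)] by (intro mult_left_mono power_mono) auto
      then show "\<bar>v i (\<tau> i) j\<bar> \<le> g i (\<tau> i) / \<rho> ^ w (\<tau> i) * 1"
        using E[OF ij] rho0 by (auto simp: v_def g_def w_def abs_mult power_abs power_mult_distrib)
    qed
    also have "\<dots> = fact n * (\<Prod>i<n. g i (\<tau> i)) / \<rho> ^ (\<Sum>i<n. w (\<tau> i))"
      by (simp add: prod_dividef power_sum)
    also have "\<dots> \<le> fact n * (\<Prod>i<n. g i (\<tau> i)) / \<rho> ^ (\<Sum>i<n. i)"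
    proof (intro divide_left_mono power_increasing)
      show "0 \<le> fact n * (\<Prod>i<n. g i (\<tau> i))" using g0 by (intro mult_nonneg_nonneg prod_nonneg) auto
    qed (use wge rho in auto)
    finally show ?thesis .
  qed
  have "\<bar>fdet n (\<lambda>i j. poly (p i) (y j) + E i j)\<bar> \<le>
      (\<Sum>\<tau>\<in>{..<n} \<rightarrow>\<^sub>E T. fact n * (\<Prod>i<n. g i (\<tau> i)) / \<rho> ^ (\<Sum>i<n. i))"
    unfolding eq fdet_expand[OF finT] by (rule order.trans[OF sum_abs sum_mono]) (rule bound)
  also have "\<dots> = fact n * (\<Sum>\<tau>\<in>{..<n} \<rightarrow>\<^sub>E T. \<Prod>i<n. g i (\<tau> i)) / \<rho> ^ (\<Sum>i<n. i)"
    by (simp add: sum_distrib_left sum_divide_distrib)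
  \<comment> \<open>The sum over all choices factors into row sums, each at most
    \<open>2 * G i\<close>: one \<open>G i\<close> for the polynomial and one for the error.\<close>
  also have "(\<Sum>\<tau>\<in>{..<n} \<rightarrow>\<^sub>E T. \<Prod>i<n. g i (\<tau> i)) = (\<Prod>i<n. \<Sum>t\<in>T. g i t)"
    by (subst prod_sum_PiE) (auto simp: finT)
  also have "fact n * (\<Prod>i<n. \<Sum>t\<in>T. g i t) / \<rho> ^ (\<Sum>i<n. i) \<le> fact n * (\<Prod>i<n. 2 * G i) / \<rho> ^ (\<Sum>i<n. i)"
  proof -
    have "(\<Sum>t\<in>T. g i t) \<le> 2 * G i" if "i < n" for i
    proof -
      have "(\<Sum>t\<in>T. g i t) = (\<Sum>t\<le>D. \<bar>coeff (p i) t\<bar> * (\<rho> * Y) ^ t) + G i"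
        by (simp add: T_def g_def)
      also have "(\<Sum>t\<le>D. \<bar>coeff (p i) t\<bar> * (\<rho> * Y) ^ t) = pmaj (p i) (\<rho> * Y)"
        unfolding pmaj_altdef using D[OF that]
        by (intro sum.mono_neutral_right) (auto simp: coeff_eq_0)
      finally show ?thesis using p[OF that] by simp
    qed
    then have "(\<Prod>i<n. \<Sum>t\<in>T. g i t) \<le> (\<Prod>i<n. 2 * G i)"
      using g0 by (intro prod_mono) (auto intro!: sum_nonneg)
    then show ?thesis using rho0 by (intro divide_right_mono mult_left_mono) auto
  qed
  finally show ?thesis .
qed

section \<open>Nonvanishing determinants and the zero estimate\<close>

lemma fdet_transpose: "fdet n (\<lambda>i j. f j i) = fdet n f"
proof -
  have "transpose_mat (Matrix.mat n n (\<lambda>(i, j). f i j)) = Matrix.mat n n (\<lambda>(i, j). f j i)"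
    by (intro eq_matI) auto
  then show ?thesis unfolding fdet_def
    by (metis det_transpose mat_carrier)
qed

lemma fdet_kernel:
  fixes f :: "nat \<Rightarrow> nat \<Rightarrow> 'a::idom"
  assumes "fdet n f \<noteq> 0" "\<And>i. i < n \<Longrightarrow> (\<Sum>j<n. f i j * v j) = 0" "j < n"
  shows "v j = 0"
proof (rule ccontr)
  assume "v j \<noteq> 0"
  let ?A = "Matrix.mat n n (\<lambda>(i, j). f i j)" and ?v = "Matrix.vec n v"
  have "?v \<noteq> 0\<^sub>v n" using \<open>v j \<noteq> 0\<close> \<open>j < n\<close> by (metis index_vec index_zero_vec(1))
  moreover have "?A *\<^sub>v ?v = 0\<^sub>v n"
  proof (rule eq_vecI)
    fix i assume "i < dim_vec (0\<^sub>v n :: 'a Matrix.vec)"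
    then have i: "i < n" by simp
    have "(?A *\<^sub>v ?v) $ i = (\<Sum>j\<in>{0..<n}. f i j * v j)"
      using i by (simp add: scalar_prod_def)
    then show "(?A *\<^sub>v ?v) $ i = 0\<^sub>v n $ i" using assms(2)[OF i] i by (simp add: lessThan_atLeast0)
  qed simp
  moreover have "?v \<in> carrier_vec n" by simp
  ultimately have "\<exists>v. v \<in> carrier_vec n \<and> v \<noteq> 0\<^sub>v n \<and> ?A *\<^sub>v v = 0\<^sub>v n" by blast
  then have "det ?A = 0" by (subst det_0_iff_vec_prod_zero[of _ n]) (simp, blast)
  then show False using assms(1) by (simp add: fdet_def)
qed

text \<open>A kernel vector would be the coefficient vector of a nonzero polynomial of degree below
  \<open>n\<close> with the \<open>n\<close> roots \<open>x i\<close>.\<close>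

lemma fdet_vandermonde:
  fixes x :: "nat \<Rightarrow> 'a::{idom, ring_char_0}"
  assumes "inj_on x {..<n}"
  shows "fdet n (\<lambda>i j. x j ^ i) \<noteq> 0"
proof
  assume "fdet n (\<lambda>i j. x j ^ i) = 0"
  then have "fdet n (\<lambda>i j. x i ^ j) = 0" using fdet_transpose[of n "\<lambda>i j. x i ^ j"] by simp
  then obtain v where v: "v \<in> carrier_vec n" "v \<noteq> 0\<^sub>v n"
      "Matrix.mat n n (\<lambda>(i, j). x i ^ j) *\<^sub>v v = 0\<^sub>v n"
    unfolding fdet_def by (subst (asm) det_0_iff_vec_prod_zero[of _ n]) auto
  define q where "q = (\<Sum>j<n. monom (v $ j) j)"
  have q: "coeff q j = (if j < n then v $ j else 0)" for j by (simp add: q_def coeff_sum)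
  have "poly q (x i) = 0" if "i < n" for i
  proof -
    have "poly q (x i) = (\<Sum>j\<in>{0..<n}. x i ^ j * v $ j)"
      by (simp add: q_def poly_sum poly_monom lessThan_atLeast0 mult.commute)
    also have "\<dots> = (Matrix.mat n n (\<lambda>(i, j). x i ^ j) *\<^sub>v v) $ i"
      using that v(1) by (simp add: scalar_prod_def)
    finally show ?thesis using v(3) that by simp
  qed
  then have sub: "x ` {..<n} \<subseteq> {t. poly q t = 0}" by auto
  obtain j where j: "j < n" "v $ j \<noteq> 0" using v by (metis carrier_vecD eq_vecI index_zero_vec)
  then have q0: "q \<noteq> 0" using q[of j] by auto
  have "n = card (x ` {..<n})" using assms by (simp add: card_image)
  also have "\<dots> \<le> card {t. poly q t = 0}" using q0 sub by (intro card_mono poly_roots_finite)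
  also have "\<dots> \<le> degree q" using q0 by (rule card_poly_roots_bound)
  finally have "coeff q (degree q) = 0" using q by simp
  then show False using q0 by simp
qed

text \<open>Linear independence on \<open>P\<close> yields evaluation points one at a time: expanded
  along a new column at \<open>x\<close>, the larger determinant is a combination of the
  \<open>f i x\<close> whose last coefficient is the nonzero minor already found.\<close>

lemma exists_fdet_ne_0:
  fixes f :: "nat \<Rightarrow> 'p \<Rightarrow> 'a::field"
  assumes "\<And>c. (\<forall>x\<in>P. (\<Sum>i<n. c i * f i x) = 0) \<Longrightarrow> \<forall>i<n. c i = 0"
  shows "\<exists>g. (\<forall>j<n. g j \<in> P) \<and> fdet n (\<lambda>i j. f i (g j)) \<noteq> 0"
  using assms
proof (induction n)
  case 0
  then show ?case by (simp add: fdet_def)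
next
  case (Suc n)
  have "\<forall>i<n. c i = 0" if c: "\<forall>x\<in>P. (\<Sum>i<n. c i * f i x) = 0" for c
  proof -
    have "\<forall>i<Suc n. (c(n := 0)) i = 0"
      using c by (intro Suc.prems) simp
    then show ?thesis by (metis fun_upd_other less_SucI less_irrefl)
  qed
  then obtain g where g: "\<forall>j<n. g j \<in> P" "fdet n (\<lambda>i j. f i (g j)) \<noteq> 0" using Suc.IH by metis
  define h where "h x j = (if j < n then g j else x)" for x j
  define c where "c i = (-1) ^ (i + n) * fdet n (\<lambda>i' j. f (if i' < i then i' else Suc i') (g j))" for i
  have exp: "fdet (Suc n) (\<lambda>i j. f i (h x j)) = (\<Sum>i<Suc n. c i * f i x)" for x
  proof -
    let ?A = "Matrix.mat (Suc n) (Suc n) (\<lambda>(i, j). f i (h x j))"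
    have "det ?A = (\<Sum>i<Suc n. ?A $$ (i, n) * cofactor ?A i n)"
      by (rule laplace_expansion_column) auto
    also have "\<dots> = (\<Sum>i<Suc n. c i * f i x)"
    proof (rule sum.cong)
      fix i assume "i \<in> {..<Suc n}"
      then have i: "i < Suc n" by simp
      have "mat_delete ?A i n = Matrix.mat n n (\<lambda>(i', j). f (if i' < i then i' else Suc i') (g j))"
        using i unfolding mat_delete_def by (intro eq_matI) (auto simp: h_def)
      then show "?A $$ (i, n) * cofactor ?A i n = c i * f i x"
        using i by (simp add: cofactor_def c_def fdet_def h_def)
    qed simp
    finally show ?thesis by (simp add: fdet_def)
  qed
  have "c n = fdet n (\<lambda>i' j. f i' (g j))"
    unfolding c_def by (simp add: fdet_cong[of n "\<lambda>i' j. f (if i' < n then i' else Suc i') (g j)" "\<lambda>i' j. f i' (g j)"])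
  then have "\<not> (\<forall>i<Suc n. c i = 0)" using g(2) by auto
  then obtain x where x: "x \<in> P" "(\<Sum>i<Suc n. c i * f i x) \<noteq> 0" using Suc.prems by blast
  show ?case
  proof (intro exI conjI allI impI)
    show "h x j \<in> P" for j using g(1) x(1) by (simp add: h_def)
    show "fdet (Suc n) (\<lambda>i j. f i (h x j)) \<noteq> 0" using exp x(2) by simp
  qed
qed

lemma coeff_mult_top:
  fixes p q :: "'a::comm_semiring_1 poly"
  assumes "degree p \<le> a" "degree q \<le> b"
  shows "coeff (p * q) (a + b) = coeff p a * coeff q b"
proof -
  have "coeff (p * q) (a + b) = (\<Sum>i\<le>a + b. coeff p i * coeff q (a + b - i))" by (rule coeff_mult)
  also have "\<dots> = (\<Sum>i\<in>{a}. coeff p i * coeff q (a + b - i))"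
  proof (intro sum.mono_neutral_right ballI)
    fix i assume "i \<in> {..a + b} - {a}"
    then have "degree p < i \<or> degree q < a + b - i" using assms by auto
    then show "coeff p i * coeff q (a + b - i) = 0" by (auto simp: coeff_eq_0)
  qed auto
  finally show ?thesis by simp
qed

lemma coeff_prod_top:
  fixes q :: "'b \<Rightarrow> 'a::comm_semiring_1 poly"
  assumes "finite A" "\<And>i. i \<in> A \<Longrightarrow> degree (q i) \<le> m i"
  shows "coeff (\<Prod>i\<in>A. q i) (\<Sum>i\<in>A. m i) = (\<Prod>i\<in>A. coeff (q i) (m i))"
    and "degree (\<Prod>i\<in>A. q i) \<le> (\<Sum>i\<in>A. m i)"
proof -
  have "coeff (\<Prod>i\<in>A. q i) (\<Sum>i\<in>A. m i) = (\<Prod>i\<in>A. coeff (q i) (m i)) \<and>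
      degree (\<Prod>i\<in>A. q i) \<le> (\<Sum>i\<in>A. m i)"
    using assms
  proof (induction A rule: finite_induct)
    case (insert x F)
    then have IH: "coeff (\<Prod>i\<in>F. q i) (\<Sum>i\<in>F. m i) = (\<Prod>i\<in>F. coeff (q i) (m i))"
      "degree (\<Prod>i\<in>F. q i) \<le> (\<Sum>i\<in>F. m i)" by auto
    have "degree (q x * (\<Prod>i\<in>F. q i)) \<le> m x + (\<Sum>i\<in>F. m i)"
      using IH(2) insert.prems[of x] degree_mult_le[of "q x" "\<Prod>i\<in>F. q i"] by simp
    then show ?case using insert IH coeff_mult_top[of "q x" "m x" "\<Prod>i\<in>F. q i" "\<Sum>i\<in>F. m i"] by simp
  qed simp
  then show "coeff (\<Prod>i\<in>A. q i) (\<Sum>i\<in>A. m i) = (\<Prod>i\<in>A. coeff (q i) (m i))"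
    and "degree (\<Prod>i\<in>A. q i) \<le> (\<Sum>i\<in>A. m i)" by auto
qed

text \<open>Every Leibniz term takes one entry from each column, so taking top coefficients with
  respect to the column degrees \<open>m j\<close> commutes with the determinant.\<close>

lemma fdet_poly_top:
  fixes M :: "nat \<Rightarrow> nat \<Rightarrow> 'a::comm_ring_1 poly"
  assumes "\<And>i j. i < n \<Longrightarrow> j < n \<Longrightarrow> degree (M i j) \<le> m j"
  shows "coeff (fdet n M) (\<Sum>j<n. m j) = fdet n (\<lambda>i j. coeff (M i j) (m j))"
    and "degree (fdet n M) \<le> (\<Sum>j<n. m j)"
proof -
  have *: "degree (\<Prod>i<n. M i (p i)) \<le> (\<Sum>j<n. m j)"
    "coeff (\<Prod>i<n. M i (p i)) (\<Sum>j<n. m j) = (\<Prod>i<n. coeff (M i (p i)) (m (p i)))"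
    if p: "p permutes {..<n}" for p
  proof -
    have s: "(\<Sum>j<n. m j) = (\<Sum>i<n. m (p i))" using sum.permute[OF p, of m] by (simp add: o_def)
    have le: "degree (M i (p i)) \<le> m (p i)" if "i \<in> {..<n}" for i
      using that permutes_in_image[OF p, of i] assms by auto
    show "degree (\<Prod>i<n. M i (p i)) \<le> (\<Sum>j<n. m j)"
      unfolding s by (rule coeff_prod_top(2)) (use le in auto)
    show "coeff (\<Prod>i<n. M i (p i)) (\<Sum>j<n. m j) = (\<Prod>i<n. coeff (M i (p i)) (m (p i)))"
      unfolding s by (rule coeff_prod_top(1)) (use le in auto)
  qed
  have sg: "signof p * q = (if evenperm p then q else - q)" for p and q :: "'a poly"
    by (simp add: sign_def)
  show "coeff (fdet n M) (\<Sum>j<n. m j) = fdet n (\<lambda>i j. coeff (M i j) (m j))"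
    unfolding fdet_leibniz sg coeff_sum using *(2) by (intro sum.cong) (auto simp: sign_def)
  show "degree (fdet n M) \<le> (\<Sum>j<n. m j)"
    unfolding fdet_leibniz sg by (rule degree_sum_le) (use *(1) in \<open>auto simp: finite_permutations\<close>)
qed

text \<open>Zero estimate for exponential polynomials on \<open>\<real> \<times> \<real>\<^sup>*\<close>: the determinant of the translates by
  \<open>(\<sigma>, \<alpha>\<^sup>\<sigma>)\<close> eliminates the exponential variable, and its top coefficient is a Vandermonde determinant.\<close>

lemma zero_estimate:
  fixes p :: "nat \<Rightarrow> real poly" and \<alpha> :: real
  assumes \<alpha>: "\<alpha> > 0" "\<alpha> \<noteq> 1"
    and deg: "\<And>l. l < L \<Longrightarrow> degree (p l) \<le> D"
    and fin: "finite X" and card: "card X > D * L"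
    and zero: "\<And>x. x \<in> X \<Longrightarrow> \<exists>z. z \<noteq> 0 \<and> (\<forall>\<sigma><L. (\<Sum>l<L. poly (p l) (x + real \<sigma>) * (\<alpha> ^ \<sigma> * z) ^ l) = 0)"
    and l: "l < L"
  shows "p l = 0"
proof (rule ccontr)
  assume "p l \<noteq> 0"
  \<comment> \<open>Exponents with zero polynomial are discarded, so that every remaining column has
    a nonzero leading coefficient.\<close>
  define \<Lambda> where "\<Lambda> = {l. l < L \<and> p l \<noteq> 0}"
  have f\<Lambda>: "finite \<Lambda>" by (simp add: \<Lambda>_def)
  define n where "n = card \<Lambda>"
  have nL: "n \<le> L" unfolding n_def using card_mono[of "{..<L}" \<Lambda>] by (auto simp: \<Lambda>_def)
  have n0: "n > 0" using \<open>p l \<noteq> 0\<close> l f\<Lambda> by (auto simp: n_def card_gt_0_iff \<Lambda>_def)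
  obtain e where e: "bij_betw e {..<n} \<Lambda>"
    using ex_bij_betw_nat_finite[OF f\<Lambda>] by (auto simp: n_def lessThan_atLeast0)
  have e\<Lambda>: "e j < L" "p (e j) \<noteq> 0" if "j < n" for j
    using e that by (auto simp: bij_betw_def \<Lambda>_def)
  define M where "M \<sigma> j = smult (\<alpha> ^ (\<sigma> * e j)) (pcompose (p (e j)) [:real \<sigma>, 1:])" for \<sigma> j
  define m where "m j = degree (p (e j))" for j
  have dM: "degree (M \<sigma> j) = m j" for \<sigma> j
    using \<alpha> by (simp add: M_def m_def degree_pcompose)
  have cM: "coeff (M \<sigma> j) (m j) = lead_coeff (p (e j)) * (\<alpha> ^ e j) ^ \<sigma>" for \<sigma> j
  proof -
    have "coeff (pcompose (p (e j)) [:real \<sigma>, 1:]) (m j) = lead_coeff (pcompose (p (e j)) [:real \<sigma>, 1:])"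
      by (simp add: m_def degree_pcompose)
    also have "\<dots> = lead_coeff (p (e j))" by (subst lead_coeff_comp) auto
    finally show ?thesis by (simp add: M_def mult.commute flip: power_mult)
  qed
  let ?\<Delta> = "fdet n M"
  have "coeff ?\<Delta> (\<Sum>j<n. m j) = fdet n (\<lambda>\<sigma> j. 1 * lead_coeff (p (e j)) * (\<alpha> ^ e j) ^ \<sigma>)"
    by (subst fdet_poly_top(1)) (auto simp: dM cM)
  also have "\<dots> = (\<Prod>j<n. lead_coeff (p (e j))) * fdet n (\<lambda>\<sigma> j. (\<alpha> ^ e j) ^ \<sigma>)"
    unfolding fdet_scale by simp
  also have "\<dots> \<noteq> 0"
  proof -
    have "inj_on (\<lambda>j. \<alpha> ^ e j) {..<n}"
    proof (rule inj_onI)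
      fix i j assume "i \<in> {..<n}" "j \<in> {..<n}" "\<alpha> ^ e i = \<alpha> ^ e j"
      moreover then have "e i = e j" using \<alpha>
        by (metis less_irrefl linorder_neqE_nat not_less_iff_gr_or_eq power_strict_decreasing power_strict_increasing linorder_neqE_linordered_idom)
      ultimately show "i = j" using e by (auto simp: bij_betw_def dest: inj_onD)
    qed
    then show ?thesis using fdet_vandermonde e\<Lambda> by simp
  qed
  finally have \<Delta>0: "?\<Delta> \<noteq> 0" by auto
  have "degree ?\<Delta> \<le> (\<Sum>j<n. m j)" by (rule fdet_poly_top(2)) (simp add: dM)
  also have "\<dots> \<le> (\<Sum>j<n. D)" by (intro sum_mono) (use deg e\<Lambda> in \<open>auto simp: m_def\<close>)
  also have "\<dots> \<le> D * L" using nL by simp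
  finally have deg\<Delta>: "degree ?\<Delta> \<le> D * L" .
  have "poly ?\<Delta> x = 0" if x: "x \<in> X" for x
  proof (rule ccontr)
    assume ne: "poly ?\<Delta> x \<noteq> 0"
    obtain z where z: "z \<noteq> 0" "\<And>\<sigma>. \<sigma> < L \<Longrightarrow> (\<Sum>l<L. poly (p l) (x + real \<sigma>) * (\<alpha> ^ \<sigma> * z) ^ l) = 0"
      using zero[OF x] by blast
    have hom: "comm_ring_hom (\<lambda>q. poly q x)" by unfold_locales auto
    \<comment> \<open>The vector of the \<open>z ^ e j\<close> lies in the kernel of the matrix
      evaluated at \<open>x\<close>, so a nonzero determinant would make its first entry
      vanish.\<close>
    have "z ^ e 0 = 0"
    proof (rule fdet_kernel[of n "\<lambda>\<sigma> j. poly (M \<sigma> j) x" "\<lambda>j. z ^ e j"])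
      show "fdet n (\<lambda>\<sigma> j. poly (M \<sigma> j) x) \<noteq> 0" using ne hom_fdet[OF hom, of n M] by simp
      fix \<sigma> assume "\<sigma> < n"
      then have "0 = (\<Sum>l<L. poly (p l) (x + real \<sigma>) * (\<alpha> ^ \<sigma> * z) ^ l)" using z nL by simp
      also have "\<dots> = (\<Sum>l\<in>\<Lambda>. poly (p l) (x + real \<sigma>) * (\<alpha> ^ \<sigma> * z) ^ l)"
        by (rule sum.mono_neutral_right) (auto simp: \<Lambda>_def)
      also have "\<dots> = (\<Sum>j<n. poly (p (e j)) (x + real \<sigma>) * (\<alpha> ^ \<sigma> * z) ^ e j)"
        by (rule sum.reindex_bij_betw[OF e, symmetric])
      also have "\<dots> = (\<Sum>j<n. poly (M \<sigma> j) x * z ^ e j)"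
        by (intro sum.cong) (auto simp: M_def poly_pcompose power_mult_distrib add.commute simp flip: power_mult)
      finally show "(\<Sum>j<n. poly (M \<sigma> j) x * z ^ e j) = 0" by simp
    qed (rule n0)
    then show False using z(1) by simp
  qed
  then have "X \<subseteq> {x. poly ?\<Delta> x = 0}" by auto
  then have "card X \<le> card {x. poly ?\<Delta> x = 0}" using \<Delta>0 by (intro card_mono poly_roots_finite)
  also have "\<dots> \<le> degree ?\<Delta>" using \<Delta>0 by (rule card_poly_roots_bound)
  finally show False using deg\<Delta> card by simp
qed

section \<open>Binomial rows and exponential entries\<close>

text \<open>binomial(c + y, k) as a polynomial in y. The shift \<open>c\<close> allows centring the
  points at 0. Binomials are preferred to powers because they are integral at integers and still
  carry the gain 1 / k!.\<close>

definition binpoly :: "real \<Rightarrow> nat \<Rightarrow> real poly" where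
  "binpoly c k = smult (1 / fact k) (\<Prod>t<k. [:c - real t, 1:])"

lemma poly_binpoly: "real x = c + y \<Longrightarrow> poly (binpoly c k) y = real (x choose k)"
proof -
  assume x: "real x = c + y"
  have "poly (binpoly c k) y = (\<Prod>t<k. real x - real t) / fact k"
    by (simp add: binpoly_def poly_prod x algebra_simps)
  also have "\<dots> = real x gchoose k"
    by (simp add: gbinomial_prod_rev lessThan_atLeast0)
  finally show ?thesis by (simp add: binomial_gbinomial)
qed

lemma degree_binpoly: "degree (binpoly c k) \<le> k"
proof -
  have "degree (\<Prod>t<k. [:c - real t, 1:]) \<le> (\<Sum>t<k. degree [:c - real t, 1:])"
    by (rule coeff_prod_top(2)) auto
  then show ?thesis by (simp add: binpoly_def)
qed

text \<open>Evaluation at 0, 1, ..., K - 1 is triangular with unit diagonal.\<close>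

lemma binpoly_independent:
  assumes "(\<Sum>k<K. smult (c k) (binpoly 0 k)) = 0" "k < K"
  shows "c k = 0"
  using assms(2)
proof (induction k rule: less_induct)
  case (less k)
  have "0 = poly (\<Sum>k<K. smult (c k) (binpoly 0 k)) (real k)" by (simp add: assms(1))
  also have "\<dots> = (\<Sum>k'<K. c k' * real (k choose k'))"
    by (simp add: poly_sum poly_binpoly[of k])
  also have "\<dots> = (\<Sum>k'\<in>{k}. c k' * real (k choose k'))"
  proof (intro sum.mono_neutral_right ballI)
    fix k' assume "k' \<in> {..<K} - {k}"
    then show "c k' * real (k choose k') = 0" using less by (cases "k' < k") (auto simp: binomial_eq_0)
  qed (use less.prems in auto)
  finally show ?case by simp
qed

lemma binomial_le_pow_fact: "real (n choose k) \<le> real n ^ k / fact k"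
proof -
  have "real (n choose k) * fact k \<le> real n ^ k"
    using of_nat_mono[OF binomial_fact_pow[of n k], where ?'a = real] by simp
  then show ?thesis by (simp add: field_simps)
qed

definition exp_taylor :: "real \<Rightarrow> nat \<Rightarrow> real poly" where
  "exp_taylor c D = (\<Sum>d<D. monom (c ^ d / fact d) d)"

lemma poly_exp_taylor: "poly (exp_taylor c D) y = (\<Sum>d<D. (c * y) ^ d / fact d)"
  by (simp add: exp_taylor_def poly_sum poly_monom power_mult_distrib)

lemma pmaj_monom [simp]: "pmaj (monom a d) t = \<bar>a\<bar> * t ^ d"
  by (simp add: pmaj_def map_poly_monom poly_monom)

lemma sum_le_exp: "x \<ge> 0 \<Longrightarrow> (\<Sum>d<D. x ^ d / fact d) \<le> exp (x::real)"
  using sum_le_suminf[OF summable_exp_generic[of x], of "{..<D}"]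
  by (auto simp: exp_def field_simps)

lemma pmaj_exp_taylor:
  assumes "t \<ge> 0"
  shows "pmaj (exp_taylor c D) t \<le> exp (\<bar>c\<bar> * t)"
proof -
  have "pmaj (exp_taylor c D) t \<le> (\<Sum>d<D. pmaj (monom (c ^ d / fact d) d) t)"
    unfolding exp_taylor_def using assms by (rule pmaj_sum)
  also have "\<dots> = (\<Sum>d<D. (\<bar>c\<bar> * t) ^ d / fact d)"
    by (simp add: power_abs power_mult_distrib)
  also have "\<dots> \<le> exp (\<bar>c\<bar> * t)" using assms by (intro sum_le_exp) auto
  finally show ?thesis .
qed

lemma exp_taylor_tendsto: "(\<lambda>D. poly (exp_taylor c D) y) \<longlonglongrightarrow> exp (c * y)"
  using exp_converges[of "c * y"] by (simp add: poly_exp_taylor sums_def field_simps)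

lemma abs_exp_minus_one_le: "\<bar>u\<bar> \<le> 1 / 2 \<Longrightarrow> \<bar>exp u - 1\<bar> \<le> 2 * \<bar>u :: real\<bar>"
  using exp_bound_lemma[of u] exp_ge_add_one_self[of u] unfolding real_norm_def by linarith

text \<open>After centring at X / 2 the constant terms X / 2 - i are at most X / 2 in absolute
  value, because i < k \<le> X + 1 keeps i in [0, X].\<close>

lemma pmaj_binpoly:
  assumes X: "real k \<le> X + 1" and t: "t \<ge> 0"
  shows "pmaj (binpoly (X / 2) k) t \<le> (X / 2 + t) ^ k / fact k"
proof -
  have "pmaj (\<Prod>i<k. [:X / 2 - real i, 1:]) t \<le> (\<Prod>i<k. pmaj [:X / 2 - real i, 1:] t)"
    using t by (rule pmaj_prod)
  also have "\<dots> \<le> (\<Prod>i<k. X / 2 + t)"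
  proof (intro prod_mono conjI)
    fix i assume "i \<in> {..<k}"
    then have "real i \<le> X" using X by (auto simp: less_eq_real_def)
    then have "\<bar>X / 2 - real i\<bar> \<le> X / 2" by linarith
    then show "pmaj [:X / 2 - real i, 1:] t \<le> X / 2 + t" by simp
  qed (use t in auto)
  finally show ?thesis by (simp add: binpoly_def divide_right_mono)
qed

text \<open>The error allowed by \<open>interpolation_det_upper\<close> is shared evenly between the
  truncation of the Taylor series and the perturbation \<open>u\<close>. The truncation degree may
  be arbitrarily large, as \<open>pmaj\<close> of the Taylor polynomial stays below the
  exponential.\<close>

lemma exp_det_upper:
  fixes x :: "nat \<Rightarrow> nat" and k :: "nat \<Rightarrow> nat" and c :: "nat \<Rightarrow> real" and X \<rho> :: real
  defines "G \<equiv> \<lambda>i. ((1 + \<rho>) * X / 2) ^ k i / fact (k i) * exp (\<bar>c i\<bar> * (\<rho> * X / 2))"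
  assumes X: "X > 0" and rho: "\<rho> \<ge> 1"
    and x: "\<And>j. j < n \<Longrightarrow> real (x j) \<le> X"
    and k: "\<And>i. i < n \<Longrightarrow> real (k i) \<le> X + 1"
    and u: "\<And>i j. i < n \<Longrightarrow> j < n \<Longrightarrow> \<bar>u i j\<bar> \<le> 1 / (4 * \<rho> ^ n)"
  shows "\<bar>fdet n (\<lambda>i j. real (x j choose k i) * exp (c i * (real (x j) - X / 2) + u i j))\<bar>
     \<le> fact n * (\<Prod>i<n. 2 * G i) / \<rho> ^ (\<Sum>i<n. i)"
proof -
  define y where "y j = real (x j) - X / 2" for j
  have y: "\<bar>y j\<bar> \<le> X / 2" if "j < n" for j using x[OF that] unfolding y_def by linarith
  have rn: "\<rho> ^ n \<ge> 1" using rho by simp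
  have G0: "G i > 0" for i using X rho by (simp add: G_def)
  have C: "real (x j choose k i) * exp (c i * y j) \<le> G i" if "i < n" "j < n" for i j
  proof -
    have "real (x j choose k i) \<le> real (x j) ^ k i / fact (k i)" by (rule binomial_le_pow_fact)
    also have "\<dots> \<le> ((1 + \<rho>) * X / 2) ^ k i / fact (k i)"
    proof (intro divide_right_mono power_mono)
      have "1 * X \<le> \<rho> * X" using rho X by (intro mult_right_mono) auto
      then show "real (x j) \<le> (1 + \<rho>) * X / 2" using x[OF that(2)] by (simp add: algebra_simps)
    qed auto
    finally have 1: "real (x j choose k i) \<le> ((1 + \<rho>) * X / 2) ^ k i / fact (k i)" .
    have "c i * y j \<le> \<bar>c i\<bar> * \<bar>y j\<bar>" by (metis abs_ge_self abs_mult)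
    also have "\<dots> \<le> \<bar>c i\<bar> * (\<rho> * X / 2)"
    proof (rule mult_left_mono)
      have "1 * X \<le> \<rho> * X" using rho X by (intro mult_right_mono) auto
      then show "\<bar>y j\<bar> \<le> \<rho> * X / 2" using y[OF that(2)] by simp
    qed simp
    finally show ?thesis unfolding G_def using 1 X rho by (intro mult_mono) auto
  qed
  have "\<forall>\<^sub>F D in sequentially. \<forall>i\<in>{..<n}. \<forall>j\<in>{..<n}.
      \<bar>real (x j choose k i) * exp (c i * y j) - real (x j choose k i) * poly (exp_taylor (c i) D) (y j)\<bar>
        < G i / (2 * \<rho> ^ n)"
  proof (intro eventually_ball_finite ballI)
    fix i j assume "i \<in> {..<n}" "j \<in> {..<n}"
    have "(\<lambda>D. \<bar>real (x j choose k i) * exp (c i * y j) - real (x j choose k i) * poly (exp_taylor (c i) D) (y j)\<bar>)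
       \<longlonglongrightarrow> \<bar>real (x j choose k i) * exp (c i * y j) - real (x j choose k i) * exp (c i * y j)\<bar>"
      by (intro tendsto_intros exp_taylor_tendsto)
    then show "\<forall>\<^sub>F D in sequentially.
      \<bar>real (x j choose k i) * exp (c i * y j) - real (x j choose k i) * poly (exp_taylor (c i) D) (y j)\<bar>
        < G i / (2 * \<rho> ^ n)"
      by (rule order_tendstoD(2)) (use G0 rho in auto)
  qed auto
  then obtain D where D: "\<And>i j. i < n \<Longrightarrow> j < n \<Longrightarrow>
      \<bar>real (x j choose k i) * exp (c i * y j) - real (x j choose k i) * poly (exp_taylor (c i) D) (y j)\<bar>
        < G i / (2 * \<rho> ^ n)"
    by (auto simp: eventually_sequentially)
  define p where "p i = binpoly (X / 2) (k i) * exp_taylor (c i) D" for i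
  define E where "E i j = real (x j choose k i) * exp (c i * y j + u i j) - poly (p i) (y j)" for i j
  have "\<bar>fdet n (\<lambda>i j. poly (p i) (y j) + E i j)\<bar> \<le> fact n * (\<Prod>i<n. 2 * G i) / \<rho> ^ (\<Sum>i<n. i)"
  proof (rule interpolation_det_upper)
    show "X / 2 \<ge> 0" using X by simp
  next
    fix i assume i: "i < n"
    have "pmaj (p i) (\<rho> * (X / 2)) \<le> pmaj (binpoly (X / 2) (k i)) (\<rho> * (X / 2)) * pmaj (exp_taylor (c i) D) (\<rho> * (X / 2))"
      unfolding p_def using X rho by (intro pmaj_mult) auto
    also have "\<dots> \<le> (X / 2 + \<rho> * (X / 2)) ^ k i / fact (k i) * exp (\<bar>c i\<bar> * (\<rho> * (X / 2)))"
      using X rho k[OF i] by (intro mult_mono pmaj_binpoly pmaj_exp_taylor pmaj_nonneg) auto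
    also have "\<dots> = G i" by (simp add: G_def algebra_simps add_divide_distrib)
    finally show "pmaj (p i) (\<rho> * (X / 2)) \<le> G i" .
  next
    fix i j assume ij: "i < n" "j < n"
    have pp: "poly (p i) (y j) = real (x j choose k i) * poly (exp_taylor (c i) D) (y j)"
      unfolding p_def poly_mult by (subst poly_binpoly[of "x j"]) (auto simp: y_def)
    have "\<bar>u i j\<bar> \<le> 1 / (4 * \<rho> ^ n)" by (rule u[OF ij])
    moreover have "1 / (4 * \<rho> ^ n) \<le> 1 / 4" using rn by (simp add: field_simps)
    ultimately have "\<bar>exp (u i j) - 1\<bar> \<le> 2 * (1 / (4 * \<rho> ^ n))"
      using abs_exp_minus_one_le[of "u i j"] by linarith
    then have "\<bar>real (x j choose k i) * exp (c i * y j) * (exp (u i j) - 1)\<bar> \<le> G i * (2 * (1 / (4 * \<rho> ^ n)))"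
      unfolding abs_mult using C[OF ij] G0[of i] by (intro mult_mono) auto
    moreover have "\<bar>E i j\<bar> \<le> \<bar>real (x j choose k i) * exp (c i * y j) * (exp (u i j) - 1)\<bar> +
      \<bar>real (x j choose k i) * exp (c i * y j) - real (x j choose k i) * poly (exp_taylor (c i) D) (y j)\<bar>"
      unfolding E_def pp exp_add by (rule order.trans[OF _ abs_triangle_ineq]) (simp add: algebra_simps)
    moreover have "G i * (2 * (1 / (4 * \<rho> ^ n))) + G i / (2 * \<rho> ^ n) = G i / \<rho> ^ n" by (simp add: field_simps)
    ultimately show "\<bar>E i j\<bar> \<le> G i / \<rho> ^ n" using D[OF ij] by linarith
  qed (use rho y in auto)
  then show ?thesis by (simp add: E_def y_def)
qed

section \<open>The ring Z[phi] and Liouville's inequality\<close>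

text \<open>\<open>ZPhi a b\<close> is a + b phi with phi formal, so that both real embeddings,
  \<open>zval phi\<close> and \<open>zval psi\<close>, act on the same element.\<close>

datatype zphi = ZPhi int int

instantiation zphi :: comm_ring_1
begin

fun plus_zphi where "ZPhi a b + ZPhi c d = ZPhi (a + c) (b + d)"
fun minus_zphi where "ZPhi a b - ZPhi c d = ZPhi (a - c) (b - d)"
fun uminus_zphi where "- ZPhi a b = ZPhi (- a) (- b)"
fun times_zphi where "ZPhi a b * ZPhi c d = ZPhi (a * c + b * d) (a * d + b * c + b * d)"
definition "0 = ZPhi 0 0"
definition "1 = ZPhi 1 0"

instance
proof
  fix a b c :: zphi
  show "a + b + c = a + (b + c)" by (cases a; cases b; cases c) simp
  show "a + b = b + a" by (cases a; cases b) simp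
  show "0 + a = a" by (cases a) (simp add: zero_zphi_def)
  show "- a + a = 0" by (cases a) (simp add: zero_zphi_def)
  show "a - b = a + - b" by (cases a; cases b) simp
  show "a * b * c = a * (b * c)" by (cases a; cases b; cases c) (simp add: algebra_simps)
  show "a * b = b * a" by (cases a; cases b) (simp add: algebra_simps)
  show "1 * a = a" by (cases a) (simp add: one_zphi_def)
  show "(a + b) * c = a * c + b * c" by (cases a; cases b; cases c) (simp add: algebra_simps)
  show "(0::zphi) \<noteq> 1" by (simp add: zero_zphi_def one_zphi_def)
qed

end

definition phi :: real where "phi = (1 + sqrt 5) / 2"
definition psi :: real where "psi = (1 - sqrt 5) / 2"

lemma phi_sq: "phi * phi = phi + 1" and psi_sq: "psi * psi = psi + 1"
  by (simp_all add: phi_def psi_def field_simps)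

fun zval :: "real \<Rightarrow> zphi \<Rightarrow> real" where
  "zval t (ZPhi a b) = of_int a + of_int b * t"

lemma zval_hom:
  assumes "t * t = t + 1"
  shows "comm_ring_hom (zval t)"
proof
  fix x y :: zphi
  obtain a b c d where xy: "x = ZPhi a b" "y = ZPhi c d" by (cases x; cases y)
  show "zval t (x + y) = zval t x + zval t y" by (simp add: xy algebra_simps)
  have "zval t x * zval t y = of_int (a * c) + of_int (a * d + b * c) * t + of_int (b * d) * (t * t)"
    by (simp add: xy algebra_simps)
  then show "zval t (x * y) = zval t x * zval t y"
    unfolding assms by (simp add: xy algebra_simps)
qed (simp_all add: zero_zphi_def one_zphi_def)

interpretation zphi: comm_ring_hom "zval phi"
  by (rule zval_hom[OF phi_sq])
interpretation zpsi: comm_ring_hom "zval psi"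
  by (rule zval_hom[OF psi_sq])

text \<open>Otherwise the multiplicity of 5 would be even on the left and odd on the right.\<close>

lemma five_times_square_not_square:
  fixes b c :: int
  assumes "c ^ 2 = 5 * b ^ 2"
  shows "b = 0"
proof (rule ccontr)
  assume b: "b \<noteq> 0"
  have p: "prime (5::int)" by simp
  have c: "c \<noteq> 0" using assms b by auto
  have "multiplicity 5 (c ^ 2) = 2 * multiplicity 5 c"
    by (rule prime_elem_multiplicity_power_distrib) (use p c in auto)
  moreover have "multiplicity 5 (5 * b ^ 2) = Suc (multiplicity 5 (b ^ 2))"
    by (rule multiplicity_times_same) (use b in auto)
  moreover have "multiplicity 5 (b ^ 2) = 2 * multiplicity 5 b"
    by (rule prime_elem_multiplicity_power_distrib) (use p b in auto)
  ultimately have "2 * multiplicity 5 c = Suc (2 * multiplicity 5 b)" using assms by simp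
  then show False by presburger
qed

text \<open>Liouville's inequality: the product of the two embeddings is the norm a^2 + a b - b^2,
  an integer that is nonzero because 5 is not a square.\<close>

lemma zval_norm_ge_1:
  assumes "zval phi x \<noteq> 0"
  shows "\<bar>zval phi x\<bar> * \<bar>zval psi x\<bar> \<ge> 1"
proof -
  obtain a b where x: "x = ZPhi a b" by (cases x)
  have "zval phi x * zval psi x = of_int a * of_int a + of_int a * of_int b * (phi + psi) + of_int b * of_int b * (phi * psi)"
    by (simp add: x algebra_simps)
  also have "phi + psi = 1" by (simp add: phi_def psi_def field_simps)
  also have "phi * psi = -1" by (simp add: phi_def psi_def field_simps)
  finally have n: "zval phi x * zval psi x = of_int (a * a + a * b - b * b)" by simp
  have "a * a + a * b - b * b \<noteq> 0"
  proof
    assume 0: "a * a + a * b - b * b = 0"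
    have "(2 * a + b) ^ 2 = 4 * (a * a + a * b - b * b) + 5 * b ^ 2" by (simp add: power2_eq_square algebra_simps)
    then have "b = 0" using 0 by (intro five_times_square_not_square[of "2 * a + b"]) simp
    then show False using 0 assms x by simp
  qed
  then have "\<bar>a * a + a * b - b * b\<bar> \<ge> 1" by linarith
  then have "\<bar>zval phi x * zval psi x\<bar> \<ge> 1" unfolding n by linarith
  then show ?thesis by (simp add: abs_mult)
qed

section \<open>The determinant inequality\<close>

lemma mult_add_less: "k < K \<Longrightarrow> l < L \<Longrightarrow> k * L + l < K * (L::nat)"
proof -
  assume "k < K" "l < L"
  then have "k * L + l < Suc k * L" by simp
  also have "\<dots> \<le> K * L" using \<open>k < K\<close> by (intro mult_le_mono1) simp
  finally show ?thesis .
qed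

lemma prod_div_mod:
  fixes f :: "nat \<Rightarrow> nat \<Rightarrow> 'a::comm_monoid_mult"
  shows "(\<Prod>i<K * L. f (i div L) (i mod L)) = (\<Prod>k<K. \<Prod>l<L. f k l)"
proof (cases "L = 0")
  case False
  have "(\<Prod>k<K. \<Prod>l<L. f k l) = (\<Prod>(k, l)\<in>{..<K} \<times> {..<L}. f k l)"
    by (rule prod.cartesian_product)
  also have "\<dots> = (\<Prod>i<K * L. f (i div L) (i mod L))"
    by (rule prod.reindex_bij_witness[of _ "\<lambda>i. (i div L, i mod L)" "\<lambda>(k, l). k * L + l"])
      (use False in \<open>auto simp: less_mult_imp_div_less intro: mult_add_less\<close>)
  finally show ?thesis by simp
qed simp

lemma sum_div_mod:
  fixes f :: "nat \<Rightarrow> nat \<Rightarrow> 'a::comm_monoid_add"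
  shows "(\<Sum>i<K * L. f (i div L) (i mod L)) = (\<Sum>k<K. \<Sum>l<L. f k l)"
proof (cases "L = 0")
  case False
  have "(\<Sum>k<K. \<Sum>l<L. f k l) = (\<Sum>(k, l)\<in>{..<K} \<times> {..<L}. f k l)"
    by (rule sum.cartesian_product)
  also have "\<dots> = (\<Sum>i<K * L. f (i div L) (i mod L))"
    by (rule sum.reindex_bij_witness[of _ "\<lambda>i. (i div L, i mod L)" "\<lambda>(k, l). k * L + l"])
      (use False in \<open>auto simp: less_mult_imp_div_less intro: mult_add_less\<close>)
  finally show ?thesis by simp
qed simp

text \<open>A relation between the rows on \<open>P\<close> is an exponential polynomial vanishing
  on the grid. The zero estimate takes R S base points with L translates each in the first
  coordinate, hence the range \<open>R + L - 1\<close>; \<open>R \<le> b\<close> makes the values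
  \<open>i + b * j\<close> of the base points distinct, and \<open>(K - 1) * L\<close> is degree
  times number of exponents.\<close>

lemma exists_interpolation_minor:
  fixes \<alpha> \<beta> :: real and b K L R S :: nat
  defines "P \<equiv> {..<R + L - 1} \<times> {..<S}"
  assumes \<alpha>: "\<alpha> > 0" "\<alpha> \<noteq> 1" and \<beta>: "\<beta> > 0"
    and K: "K \<ge> 1" and R: "R \<ge> 1" "R \<le> b" and card: "(K - 1) * L < R * S" and L: "L \<ge> 1"
  obtains g where "\<And>j. j < K * L \<Longrightarrow> g j \<in> P"
    "fdet (K * L) (\<lambda>r j. real ((fst (g j) + b * snd (g j)) choose (r div L)) *
        (\<alpha> ^ fst (g j) * \<beta> ^ snd (g j)) ^ (r mod L)) \<noteq> 0"
proof -
  let ?f = "\<lambda>r pt. real ((fst pt + b * snd pt) choose (r div L)) * (\<alpha> ^ fst pt * \<beta> ^ snd pt) ^ (r mod L)"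
  have "\<exists>g. (\<forall>j<K * L. g j \<in> P) \<and> fdet (K * L) (\<lambda>r j. ?f r (g j)) \<noteq> 0"
  proof (rule exists_fdet_ne_0)
    fix c :: "nat \<Rightarrow> real"
    assume c: "\<forall>pt\<in>P. (\<Sum>r<K * L. c r * ?f r pt) = 0"
    define p where "p l = (\<Sum>k<K. smult (c (k * L + l)) (binpoly 0 k))" for l
    define X where "X = (\<lambda>(i, j). real (i + b * j)) ` ({..<R} \<times> {..<S})"
    have eval: "(\<Sum>l<L. poly (p l) (real (i + b * j)) * (\<alpha> ^ i * \<beta> ^ j) ^ l) = 0"
      if "(i, j) \<in> P" for i j
    proof -
      have "(\<Sum>l<L. poly (p l) (real (i + b * j)) * (\<alpha> ^ i * \<beta> ^ j) ^ l) =
        (\<Sum>l<L. \<Sum>k<K. c (k * L + l) * (real ((i + b * j) choose k) * (\<alpha> ^ i * \<beta> ^ j) ^ l))"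
        by (simp add: p_def poly_sum poly_binpoly[of "i + b * j"] sum_distrib_right mult.assoc)
      also have "\<dots> = (\<Sum>k<K. \<Sum>l<L. c (k * L + l) * (real ((i + b * j) choose k) * (\<alpha> ^ i * \<beta> ^ j) ^ l))"
        by (rule sum.swap)
      also have "\<dots> = (\<Sum>r<K * L. c (r div L * L + r mod L) *
          (real ((i + b * j) choose (r div L)) * (\<alpha> ^ i * \<beta> ^ j) ^ (r mod L)))"
        by (rule sum_div_mod[symmetric])
      also have "\<dots> = 0" using c that by auto
      finally show ?thesis .
    qed
    have p0: "p l = 0" if "l < L" for l
    proof (rule zero_estimate[OF \<alpha>, of L p "K - 1" X])
      fix l
      show "degree (p l) \<le> K - 1" unfolding p_def
        by (rule degree_sum_le) (auto intro!: order.trans[OF degree_smult_le] order.trans[OF degree_binpoly])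
    next
      have "inj_on (\<lambda>(i, j). real (i + b * j)) ({..<R} \<times> {..<S})"
      proof (rule inj_onI, clarify)
        fix i j i' j' assume a: "i < R" "i' < R" "real (i + b * j) = real (i' + b * j')"
        then have e: "i + b * j = i' + b * j'" by linarith
        have "j = (i + b * j) div b" "j' = (i' + b * j') div b" using a R by auto
        then have "j = j'" using e by simp
        then show "i = i' \<and> j = j'" using e by simp
      qed
      then have "card X = R * S" unfolding X_def by (subst card_image) auto
      then show "(K - 1) * L < card X" using card by simp
    next
      fix x assume "x \<in> X"
      then obtain i j where ij: "i < R" "j < S" "x = real (i + b * j)" by (auto simp: X_def)
      show "\<exists>z. z \<noteq> 0 \<and> (\<forall>\<sigma><L. (\<Sum>l<L. poly (p l) (x + real \<sigma>) * (\<alpha> ^ \<sigma> * z) ^ l) = 0)"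
      proof (intro exI[of _ "\<alpha> ^ i * \<beta> ^ j"] conjI allI impI)
        fix \<sigma> assume "\<sigma> < L"
        then have "(i + \<sigma>, j) \<in> P" using ij by (auto simp: P_def)
        from eval[OF this] show "(\<Sum>l<L. poly (p l) (x + real \<sigma>) * (\<alpha> ^ \<sigma> * (\<alpha> ^ i * \<beta> ^ j)) ^ l) = 0"
          by (simp add: ij(3) power_add mult_ac add_ac)
      qed (use \<alpha> \<beta> in simp)
    qed (use that in \<open>auto simp: X_def\<close>)
    show "\<forall>r<K * L. c r = 0"
    proof (intro allI impI)
      fix r assume r: "r < K * L"
      have "r mod L < L" using L by simp
      then have "(\<Sum>k<K. smult (c (k * L + r mod L)) (binpoly 0 k)) = 0" using p0 by (simp add: p_def)
      moreover have "r div L < K" using r by (simp add: less_mult_imp_div_less)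
      ultimately have "c (r div L * L + r mod L) = 0" by (rule binpoly_independent)
      then show "c r = 0" by simp
    qed
  qed
  then show ?thesis using that by blast
qed

lemma zval_of_nat_phi [simp]: "zval phi (of_nat n) = real n"
  by (induction n) (simp_all add: zphi.hom_add)

lemma zval_of_nat_psi [simp]: "zval psi (of_nat n) = real n"
  by (induction n) (simp_all add: zpsi.hom_add)

lemma fdet_eq_cols:
  assumes "j < n" "j' < n" "j \<noteq> j'" "\<And>i. i < n \<Longrightarrow> f i j = f i j'"
  shows "fdet n f = 0"
  using fdet_eq_rows[of j n j' "\<lambda>i j. f j i"] assms fdet_transpose[of n f] by simp

lemma sum_centered: "(\<Sum>l<2 * m + 1. real l - real m) = 0"
proof -
  have "(\<Sum>l<2 * m + 1. real l) = real (2 * m + 1) * real m"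
    by (induction m) (auto simp: algebra_simps)
  then show ?thesis by (simp add: sum_subtractf)
qed

lemma sum_abs_centered: "(\<Sum>l<2 * m + 1. \<bar>real l - real m\<bar>) = real m * real (m + 1)"
proof -
  have "(\<Sum>l<2 * m + 1. \<bar>real l - real m\<bar>) = (\<Sum>l<m. \<bar>real l - real m\<bar>) + (\<Sum>l\<in>{m..<2 * m + 1}. \<bar>real l - real m\<bar>)"
    by (subst sum.atLeastLessThan_concat[of 0 m "2 * m + 1", symmetric, unfolded atLeast0LessThan]) auto
  also have "(\<Sum>l\<in>{m..<2 * m + 1}. \<bar>real l - real m\<bar>) = (\<Sum>l<m + 1. real l)"
    by (rule sum.reindex_bij_witness[of _ "\<lambda>l. l + m" "\<lambda>l. l - m"]) auto
  also have "(\<Sum>l<m. \<bar>real l - real m\<bar>) = (\<Sum>l<m. real (l + 1))"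
    by (rule sum.reindex_bij_witness[of _ "\<lambda>l. m - 1 - l" "\<lambda>l. m - 1 - l"]) auto
  also have "(\<Sum>l<m. real (l + 1)) + (\<Sum>l<m + 1. real l) = real m * real (m + 1)"
    by (induction m) (auto simp: algebra_simps)
  finally show ?thesis .
qed

lemma sum_lessThan_real: "(\<Sum>i<n. real i) = real n * (real n - 1) / 2"
  by (induction n) (auto simp: field_simps)

lemma double_sum_split:
  fixes a c :: real
  shows "(\<Sum>k<K. \<Sum>l<L. a + f k + h l * c) = real (K * L) * a + real L * (\<Sum>k<K. f k) + real K * ((\<Sum>l<L. h l) * c)"
  by (simp add: sum.distrib sum_distrib_left[symmetric] sum_distrib_right[symmetric] algebra_simps)

text \<open>With denominators cleared the determinant lies in Z[phi]. The Schwarz lemma bounds its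
  value, the Leibniz expansion its conjugate, and the product is at least 1; the inequality is the
  logarithm of this. The odd number \<open>L\<close> of exponents makes them symmetric about
  \<open>L0\<close>.\<close>

lemma interpolation_inequality:
  fixes a1 a2 b1 b2 :: zphi and A B \<rho> :: real and b K L0 R S :: nat
  defines "L \<equiv> 2 * L0 + 1" and "R' \<equiv> R + 2 * L0"
    and "\<omega> \<equiv> ln (zval phi a1) - ln (zval phi a2)"
    and "\<Lambda> \<equiv> real b * (ln (zval phi a1) - ln (zval phi a2)) - (ln (zval phi b1) - ln (zval phi b2))"
  defines "X \<equiv> real (R' - 1 + b * (S - 1))"
  assumes pos: "zval phi a1 > 0" "zval phi a2 > 0" "zval phi b1 > 0" "zval phi b2 > 0"
    and a: "zval phi a1 \<le> exp A" "zval phi a2 \<le> exp A" "\<bar>zval psi a1\<bar> \<le> exp A" "\<bar>zval psi a2\<bar> \<le> exp A"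
    and bb: "zval phi b1 \<le> exp B" "zval phi b2 \<le> exp B" "\<bar>zval psi b1\<bar> \<le> exp B" "\<bar>zval psi b2\<bar> \<le> exp B"
    and AB: "A \<ge> 0" "B \<ge> 0"
    and \<omega>0: "\<omega> \<noteq> 0"
    and K: "K \<ge> 1" and L0: "L0 \<ge> 1" and R: "R \<ge> 1" "R \<le> b" and S: "S \<ge> 1"
    and card: "(K - 1) * L < R * S" and \<rho>: "\<rho> \<ge> 1"
    and small: "real (L0 * S) * \<bar>\<Lambda>\<bar> \<le> 1 / (4 * \<rho> ^ (K * L))"
  shows "(\<Sum>i<K * L. real i) * ln \<rho> \<le> 2 * ln (fact (K * L)) + real (K * L) * ln 2
     + real L * (\<Sum>k<K. real k * (ln ((1 + \<rho>) * X / 2) + ln X) - 2 * ln (fact k))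
     + real K * (real L0 * real (L0 + 1)) * (\<bar>\<omega>\<bar> * (\<rho> * X / 2))
     + 2 * real L0 * real R' * real S * ((real R' - 1) * A + (real S - 1) * B)"
proof -
  define n where "n = K * L"
  have L1: "L \<ge> 1" by (simp add: L_def)
  define \<alpha> where "\<alpha> = zval phi a1 / zval phi a2"
  define \<beta> where "\<beta> = zval phi b1 / zval phi b2"
  have \<alpha>: "\<alpha> > 0" "\<alpha> \<noteq> 1" using pos \<omega>0 by (auto simp: \<alpha>_def \<omega>_def)
  have \<beta>: "\<beta> > 0" using pos by (simp add: \<beta>_def)
  have R'L: "R + L - 1 = R'" by (simp add: R'_def L_def)
  obtain g where g: "\<And>j. j < n \<Longrightarrow> g j \<in> {..<R'} \<times> {..<S}"
    and gne: "fdet n (\<lambda>r j. real ((fst (g j) + b * snd (g j)) choose (r div L)) *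
        (\<alpha> ^ fst (g j) * \<beta> ^ snd (g j)) ^ (r mod L)) \<noteq> 0"
  proof (rule exists_interpolation_minor[OF \<alpha> \<beta> K R card L1, unfolded R'L, folded n_def], goal_cases)
    case (1 g)
    then show ?thesis using that[of g] by blast
  qed
  define x where "x j = fst (g j) + b * snd (g j)" for j
  define num where "num j = a1 ^ fst (g j) * b1 ^ snd (g j)" for j
  define den where "den j = a2 ^ fst (g j) * b2 ^ snd (g j)" for j
  \<comment> \<open>\<open>den j ^ (2 * L0)\<close> clears all denominators of column
    \<open>j\<close>, since \<open>r mod L\<close> is at most \<open>2 * L0\<close>.\<close>
  define F where "F r j = of_nat (x j choose (r div L)) * num j ^ (r mod L) * den j ^ (2 * L0 - r mod L)" for r j
  define cost where "cost pt = real (fst pt) * A + real (snd pt) * B" for pt :: "nat \<times> nat"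
  have "R' - 1 + b * (S - 1) > 0" using L0 R by (simp add: R'_def)
  then have X0: "X > 0" unfolding X_def by (rule iffD2[OF of_nat_0_less_iff])
  have xX: "real (x j) \<le> X" if "j < n" for j
  proof -
    have "fst (g j) \<le> R' - 1" "snd (g j) \<le> S - 1" using g[OF that] by (auto simp: mem_Times_iff)
    then have "x j \<le> R' - 1 + b * (S - 1)" unfolding x_def by (intro add_mono mult_left_mono) auto
    then show ?thesis unfolding X_def by (rule of_nat_mono)
  qed
  have rL: "r mod L \<le> 2 * L0" for r using L1 by (simp add: L_def mod_Suc_le_divisor)
  have kK: "r div L < K" if "r < n" for r using that by (simp add: n_def less_mult_imp_div_less)
  have kX: "real (r div L) \<le> X + 1" if "r < n" for r
  proof -
    have "(K - 1) * L \<ge> (K - 1) * 1" using L1 by (intro mult_le_mono2)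
    then have "K - 1 < R * S" using card by linarith
    also have "R * S = R + R * (S - 1)" using S by (cases S) auto
    also have "\<dots> \<le> R + b * (S - 1)" using R by (intro add_mono mult_right_mono) auto
    finally have "r div L \<le> R' - 1 + b * (S - 1) + 1" using kK[OF that] by (auto simp: R'_def)
    then have "real (r div L) \<le> real (R' - 1 + b * (S - 1) + 1)" by (rule of_nat_mono)
    then show ?thesis by (simp add: X_def)
  qed
  have cost0: "cost pt \<ge> 0" for pt using AB by (simp add: cost_def)
  have numv: "zval phi (num j) = zval phi a1 ^ fst (g j) * zval phi b1 ^ snd (g j)"
    and denv: "zval phi (den j) = zval phi a2 ^ fst (g j) * zval phi b2 ^ snd (g j)"
    and num': "zval psi (num j) = zval psi a1 ^ fst (g j) * zval psi b1 ^ snd (g j)"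
    and den': "zval psi (den j) = zval psi a2 ^ fst (g j) * zval psi b2 ^ snd (g j)" for j
    by (simp_all add: num_def den_def zphi.hom_mult zpsi.hom_mult zphi.hom_power zpsi.hom_power)
  have ppos: "zval phi (num j) > 0" "zval phi (den j) > 0" for j
    using pos by (simp_all add: numv denv)
  have ec: "exp A ^ fst (g j) * exp B ^ snd (g j) = exp (cost (g j))" for j
    by (simp add: cost_def exp_add flip: exp_of_nat_mult)
  have le_cost: "zval phi (num j) \<le> exp (cost (g j))" "zval phi (den j) \<le> exp (cost (g j))"
    "\<bar>zval psi (num j)\<bar> \<le> exp (cost (g j))" "\<bar>zval psi (den j)\<bar> \<le> exp (cost (g j))" for j
    unfolding ec[symmetric] numv denv num' den' abs_mult power_abs
    using a bb pos by (auto intro!: mult_mono power_mono)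
  have Fv: "zval phi (F r j) = real (x j choose (r div L)) * zval phi (num j) ^ (r mod L) * zval phi (den j) ^ (2 * L0 - r mod L)"
    and F': "zval psi (F r j) = real (x j choose (r div L)) * zval psi (num j) ^ (r mod L) * zval psi (den j) ^ (2 * L0 - r mod L)"
    for r j by (simp_all add: F_def zphi.hom_mult zpsi.hom_mult zphi.hom_power zpsi.hom_power)
  have D1: "zval phi (fdet n F) = fdet n (\<lambda>r j. zval phi (F r j))"
    and D2: "zval psi (fdet n F) = fdet n (\<lambda>r j. zval psi (F r j))"
    by (rule hom_fdet, unfold_locales)+
  have "fdet n (\<lambda>r j. zval phi (F r j)) = fdet n (\<lambda>r j. 1 * zval phi (den j) ^ (2 * L0) *
     (real ((fst (g j) + b * snd (g j)) choose (r div L)) * (\<alpha> ^ fst (g j) * \<beta> ^ snd (g j)) ^ (r mod L)))"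
  proof (rule fdet_cong)
    fix r j
    have "\<alpha> ^ fst (g j) * \<beta> ^ snd (g j) = zval phi (num j) / zval phi (den j)"
      by (simp add: \<alpha>_def \<beta>_def numv denv power_divide)
    moreover have "zval phi (den j) ^ (2 * L0) = zval phi (den j) ^ (r mod L) * zval phi (den j) ^ (2 * L0 - r mod L)"
      using rL[of r] by (simp flip: power_add)
    ultimately show "zval phi (F r j) = 1 * zval phi (den j) ^ (2 * L0) *
     (real ((fst (g j) + b * snd (g j)) choose (r div L)) * (\<alpha> ^ fst (g j) * \<beta> ^ snd (g j)) ^ (r mod L))"
      using ppos(2)[of j] by (simp add: Fv x_def power_divide)
  qed
  also have "\<dots> \<noteq> 0" unfolding fdet_scale using gne ppos by (simp add: less_imp_neq[symmetric])
  finally have ne: "zval phi (fdet n F) \<noteq> 0" unfolding D1 .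
  \<comment> \<open>Equal points would give equal columns. With distinct points the total height is
    at most the sum over the whole grid.\<close>
  have ginj: "inj_on g {..<n}"
  proof (rule inj_onI, rule ccontr)
    fix j j' assume j: "j \<in> {..<n}" "j' \<in> {..<n}" "g j = g j'" "j \<noteq> j'"
    then have "fdet n (\<lambda>r j. zval phi (F r j)) = 0"
      by (intro fdet_eq_cols[of j n j']) (auto simp: F_def num_def den_def x_def)
    then show False using ne D1 by simp
  qed
  \<comment> \<open>\<open>ro\<close> moves the centre of the points to X / 2, \<open>co\<close>
    makes the exponents symmetric about \<open>L0\<close>. The product of all \<open>ro\<close> is 1
    because the centred exponents sum to 0.\<close>
  define ro where "ro r = exp ((real (r mod L) - real L0) * \<omega> * (X / 2))" for r
  define co where "co j = exp (real L0 * (ln (zval phi (num j)) + ln (zval phi (den j))))" for j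
  define c where "c r = (real (r mod L) - real L0) * \<omega>" for r
  define u where "u r j = - (real (r mod L) - real L0) * real (snd (g j)) * \<Lambda>" for r j
  define G where "G r = ((1 + \<rho>) * X / 2) ^ (r div L) / fact (r div L) * exp (\<bar>c r\<bar> * (\<rho> * X / 2))" for r
  have G0: "G r > 0" for r using X0 \<rho> by (simp add: G_def)
  have "fdet n (\<lambda>r j. zval phi (F r j)) =
    fdet n (\<lambda>r j. ro r * co j * (real (x j choose (r div L)) * exp (c r * (real (x j) - X / 2) + u r j)))"
  proof (rule fdet_cong)
    fix r j
    define ln1 where "ln1 = ln (zval phi (num j))"
    define ln2 where "ln2 = ln (zval phi (den j))"
    \<comment> \<open>By ln \<beta> = b \<omega> - \<Lambda>, the logarithm at the point (i, j) is i
      \<omega> + j ln \<beta> = x \<omega> - j \<Lambda>: up to \<Lambda> the entries depend on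
      \<open>x\<close> alone.\<close>
    have diff: "ln1 - ln2 = real (x j) * \<omega> - real (snd (g j)) * \<Lambda>"
      using pos by (simp add: ln1_def ln2_def numv denv ln_mult ln_realpow x_def \<omega>_def \<Lambda>_def algebra_simps)
    have "zval phi (num j) ^ (r mod L) * zval phi (den j) ^ (2 * L0 - r mod L)
        = exp (real (r mod L) * ln1 + real (2 * L0 - r mod L) * ln2)"
      using ppos[of j] by (simp add: ln1_def ln2_def exp_add exp_of_nat_mult)
    also have "real (r mod L) * ln1 + real (2 * L0 - r mod L) * ln2
      = real L0 * (ln1 + ln2) + (real (r mod L) - real L0) * (ln1 - ln2)"
      using rL[of r] by (simp add: of_nat_diff algebra_simps)
    also have "\<dots> = (real (r mod L) - real L0) * \<omega> * (X / 2) + real L0 * (ln1 + ln2) + (c r * (real (x j) - X / 2) + u r j)"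
      unfolding diff by (simp add: c_def u_def algebra_simps)
    finally show "zval phi (F r j) = ro r * co j * (real (x j choose (r div L)) * exp (c r * (real (x j) - X / 2) + u r j))"
      by (simp add: Fv ro_def co_def ln1_def ln2_def exp_add mult_ac)
  qed
  also have "\<dots> = (\<Prod>r<n. ro r) * (\<Prod>j<n. co j) *
    fdet n (\<lambda>r j. real (x j choose (r div L)) * exp (c r * (real (x j) - X / 2) + u r j))"
    by (rule fdet_scale)
  also have "(\<Prod>r<n. ro r) = 1"
  proof -
    have "(\<Prod>r<n. ro r) = (\<Prod>k<K. \<Prod>l<L. exp ((real l - real L0) * \<omega> * (X / 2)))"
      unfolding n_def ro_def by (rule prod_div_mod[where f = "\<lambda>k l. exp ((real l - real L0) * \<omega> * (X / 2))"])
    also have "(\<Prod>l<L. exp ((real l - real L0) * \<omega> * (X / 2))) = exp ((\<Sum>l<L. real l - real L0) * \<omega> * (X / 2))"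
      unfolding sum_distrib_right by (rule exp_sum[symmetric]) simp
    also have "\<dots> = 1" unfolding L_def sum_centered by simp
    finally show ?thesis by simp
  qed
  finally have "\<bar>zval phi (fdet n F)\<bar> = (\<Prod>j<n. co j) *
     \<bar>fdet n (\<lambda>r j. real (x j choose (r div L)) * exp (c r * (real (x j) - X / 2) + u r j))\<bar>"
    unfolding D1 by (simp add: abs_mult abs_prod co_def)
  also have "\<dots> \<le> (\<Prod>j<n. co j) * (fact n * (\<Prod>r<n. 2 * G r) / \<rho> ^ (\<Sum>i<n. i))"
  proof (rule mult_left_mono)
    show "\<bar>fdet n (\<lambda>r j. real (x j choose (r div L)) * exp (c r * (real (x j) - X / 2) + u r j))\<bar>
      \<le> fact n * (\<Prod>r<n. 2 * G r) / \<rho> ^ (\<Sum>i<n. i)"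
      unfolding G_def
    proof (rule exp_det_upper[OF X0 \<rho> xX kX])
      fix r j assume "r < n" "j < n"
      have "\<bar>real (r mod L) - real L0\<bar> \<le> real L0" using rL[of r] by linarith
      moreover have "real (snd (g j)) \<le> real S" using g[OF \<open>j < n\<close>] by (auto simp: mem_Times_iff)
      ultimately have "\<bar>u r j\<bar> \<le> real L0 * real S * \<bar>\<Lambda>\<bar>"
        unfolding u_def abs_mult by (intro mult_mono) auto
      then show "\<bar>u r j\<bar> \<le> 1 / (4 * \<rho> ^ n)" using small by (simp add: n_def)
    qed auto
  qed (auto simp: co_def intro: prod_nonneg)
  finally have up1: "\<bar>zval phi (fdet n F)\<bar> \<le> (\<Prod>j<n. co j) * (fact n * (\<Prod>r<n. 2 * G r) / \<rho> ^ (\<Sum>i<n. i))" .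
  have up2: "\<bar>zval psi (fdet n F)\<bar> \<le> fact n * (\<Prod>r<n. X ^ (r div L) / fact (r div L)) * (\<Prod>j<n. exp (cost (g j)) ^ (2 * L0))"
    unfolding D2
  proof (rule abs_fdet_le)
    fix r j assume rj: "r < n" "j < n"
    have "real (x j choose (r div L)) \<le> real (x j) ^ (r div L) / fact (r div L)" by (rule binomial_le_pow_fact)
    also have "\<dots> \<le> X ^ (r div L) / fact (r div L)"
      using xX[OF rj(2)] by (intro divide_right_mono power_mono) auto
    finally have 1: "real (x j choose (r div L)) \<le> X ^ (r div L) / fact (r div L)" .
    have "\<bar>zval psi (num j)\<bar> ^ (r mod L) * \<bar>zval psi (den j)\<bar> ^ (2 * L0 - r mod L)
       \<le> exp (cost (g j)) ^ (r mod L) * exp (cost (g j)) ^ (2 * L0 - r mod L)"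
      using le_cost by (intro mult_mono power_mono) auto
    also have "\<dots> = exp (cost (g j)) ^ (2 * L0)" using rL[of r] by (simp flip: power_add)
    finally have 2: "\<bar>zval psi (num j)\<bar> ^ (r mod L) * \<bar>zval psi (den j)\<bar> ^ (2 * L0 - r mod L) \<le> exp (cost (g j)) ^ (2 * L0)" .
    have "\<bar>zval psi (F r j)\<bar> = real (x j choose (r div L)) * (\<bar>zval psi (num j)\<bar> ^ (r mod L) * \<bar>zval psi (den j)\<bar> ^ (2 * L0 - r mod L))"
      by (simp add: F' abs_mult power_abs)
    also have "\<dots> \<le> X ^ (r div L) / fact (r div L) * exp (cost (g j)) ^ (2 * L0)"
      using 1 2 X0 by (intro mult_mono) auto
    finally show "\<bar>zval psi (F r j)\<bar> \<le> X ^ (r div L) / fact (r div L) * exp (cost (g j)) ^ (2 * L0)" .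
  qed
  let ?U1 = "(\<Prod>j<n. co j) * (fact n * (\<Prod>r<n. 2 * G r) / \<rho> ^ (\<Sum>i<n. i))"
  let ?U2 = "fact n * (\<Prod>r<n. X ^ (r div L) / fact (r div L)) * (\<Prod>j<n. exp (cost (g j)) ^ (2 * L0))"
  have p1: "(\<Prod>j<n. co j) > 0" by (auto simp: co_def intro: prod_pos)
  have p2: "(\<Prod>r<n. 2 * G r) > 0" using G0 by (auto intro: prod_pos)
  have p3: "(\<Prod>r<n. X ^ (r div L) / fact (r div L)) > 0" using X0 by (auto intro: prod_pos)
  have p4: "(\<Prod>j<n. exp (cost (g j)) ^ (2 * L0)) > 0" by (auto intro: prod_pos)
  have "1 \<le> \<bar>zval phi (fdet n F)\<bar> * \<bar>zval psi (fdet n F)\<bar>" by (rule zval_norm_ge_1[OF ne])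
  also have "\<dots> \<le> ?U1 * ?U2" using up1 up2 p1 p2 \<rho> by (intro mult_mono) auto
  finally have "1 \<le> ?U1 * ?U2" .
  then have "0 \<le> ln (?U1 * ?U2)" by simp
  also have "\<dots> = (\<Sum>j<n. ln (co j)) + ln (fact n) + (\<Sum>r<n. ln (2 * G r)) - real (\<Sum>i<n. i) * ln \<rho>
    + ln (fact n) + (\<Sum>r<n. ln (X ^ (r div L) / fact (r div L))) + (\<Sum>j<n. ln (exp (cost (g j)) ^ (2 * L0)))"
  proof -
    have s1: "ln (\<Prod>j<n. co j) = (\<Sum>j<n. ln (co j))" by (rule ln_prod) (simp_all add: co_def)
    have s2: "ln (\<Prod>r<n. 2 * G r) = (\<Sum>r<n. ln (2 * G r))" by (rule ln_prod) (use G0 in \<open>simp_all add: less_imp_neq[symmetric]\<close>)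
    have s3: "ln (\<Prod>r<n. X ^ (r div L) / fact (r div L)) = (\<Sum>r<n. ln (X ^ (r div L) / fact (r div L)))"
      by (rule ln_prod) (use X0 in simp_all)
    have s4: "ln (\<Prod>j<n. exp (cost (g j)) ^ (2 * L0)) = (\<Sum>j<n. ln (exp (cost (g j)) ^ (2 * L0)))"
      by (rule ln_prod) simp_all
    have \<rho>0: "\<rho> > 0" using \<rho> by simp
    have f0: "(fact n :: real) > 0" by simp
    have rp: "\<rho> ^ (\<Sum>i<n. i) > 0" using \<rho>0 by simp
    have lnf: "ln (p * (f * q / r)) = ln p + (ln f + ln q - ln r)"
      if "p > 0" "f > 0" "q > 0" "r > 0" for p f q r :: real
      using that by (simp add: ln_mult ln_div)
    have lnm: "ln (p * q) = ln p + ln q" if "p > 0" "q > 0" for p q :: real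
      using that by (simp add: ln_mult)
    have lng: "ln (p * q * r) = ln p + ln q + ln r" if "p > 0" "q > 0" "r > 0" for p q r :: real
      using that by (simp add: ln_mult)
    have u1: "ln ?U1 = ln (\<Prod>j<n. co j) + (ln (fact n) + ln (\<Prod>r<n. 2 * G r) - real (\<Sum>i<n. i) * ln \<rho>)"
      unfolding lnf[OF p1 f0 p2 rp] using \<rho>0 by (simp add: ln_realpow)
    have u2: "ln ?U2 = ln (fact n) + ln (\<Prod>r<n. X ^ (r div L) / fact (r div L)) + ln (\<Prod>j<n. exp (cost (g j)) ^ (2 * L0))"
      by (rule lng[OF f0 p3 p4])
    have "ln (?U1 * ?U2) = ln ?U1 + ln ?U2"
      by (intro lnm mult_pos_pos divide_pos_pos p1 p2 p3 p4 rp f0)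
    then show ?thesis unfolding u1 u2 s1 s2 s3 s4 by simp
  qed
  finally have main: "real (\<Sum>i<n. i) * ln \<rho> \<le> 2 * ln (fact n) + (\<Sum>r<n. ln (2 * G r))
     + (\<Sum>r<n. ln (X ^ (r div L) / fact (r div L))) + (\<Sum>j<n. ln (co j)) + (\<Sum>j<n. ln (exp (cost (g j)) ^ (2 * L0)))"
    by simp
  have c1: "(\<Sum>r<n. ln (2 * G r)) + (\<Sum>r<n. ln (X ^ (r div L) / fact (r div L))) =
    (\<Sum>r<n. ln 2 + (real (r div L) * (ln ((1 + \<rho>) * X / 2) + ln X) - 2 * ln (fact (r div L)))
       + \<bar>real (r mod L) - real L0\<bar> * (\<bar>\<omega>\<bar> * (\<rho> * X / 2)))"
    unfolding sum.distrib[symmetric]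
  proof (intro sum.cong refl)
    fix r
    have lnq: "ln (2 * (q ^ k / f * exp t)) = ln 2 + (real k * ln q - ln f + t)"
      if "q > 0" "f > 0" for q f t :: real and k
      using that by (simp add: ln_mult ln_div ln_realpow)
    have q: "(1 + \<rho>) * X / 2 > 0" using X0 \<rho> by simp
    have "ln (2 * G r) = ln 2 + (real (r div L) * ln ((1 + \<rho>) * X / 2) - ln (fact (r div L)) + \<bar>c r\<bar> * (\<rho> * X / 2))"
      unfolding G_def by (rule lnq[OF q]) simp
    moreover have "ln (X ^ (r div L) / fact (r div L)) = real (r div L) * ln X - ln (fact (r div L))"
      using X0 by (simp add: ln_div ln_realpow)
    moreover have "\<bar>c r\<bar> = \<bar>real (r mod L) - real L0\<bar> * \<bar>\<omega>\<bar>" by (simp add: c_def abs_mult)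
    ultimately show "ln (2 * G r) + ln (X ^ (r div L) / fact (r div L)) =
      ln 2 + (real (r div L) * (ln ((1 + \<rho>) * X / 2) + ln X) - 2 * ln (fact (r div L)))
       + \<bar>real (r mod L) - real L0\<bar> * (\<bar>\<omega>\<bar> * (\<rho> * X / 2))"
      by (simp add: algebra_simps)
  qed
  also have "\<dots> = (\<Sum>k<K. \<Sum>l<L. ln 2 + (real k * (ln ((1 + \<rho>) * X / 2) + ln X) - 2 * ln (fact k))
       + \<bar>real l - real L0\<bar> * (\<bar>\<omega>\<bar> * (\<rho> * X / 2)))"
    unfolding n_def by (rule sum_div_mod[where f = "\<lambda>k l. ln 2 + (real k * (ln ((1 + \<rho>) * X / 2) + ln X) - 2 * ln (fact k))
       + \<bar>real l - real L0\<bar> * (\<bar>\<omega>\<bar> * (\<rho> * X / 2))"])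
  also have "\<dots> = real (K * L) * ln 2 + real L * (\<Sum>k<K. real k * (ln ((1 + \<rho>) * X / 2) + ln X) - 2 * ln (fact k))
     + real K * ((\<Sum>l<L. \<bar>real l - real L0\<bar>) * (\<bar>\<omega>\<bar> * (\<rho> * X / 2)))"
    by (rule double_sum_split)
  also have "(\<Sum>l<L. \<bar>real l - real L0\<bar>) = real L0 * real (L0 + 1)"
    unfolding L_def by (rule sum_abs_centered)
  finally have c1: "(\<Sum>r<n. ln (2 * G r)) + (\<Sum>r<n. ln (X ^ (r div L) / fact (r div L))) =
     real (K * L) * ln 2 + real L * (\<Sum>k<K. real k * (ln ((1 + \<rho>) * X / 2) + ln X) - 2 * ln (fact k))
     + real K * (real L0 * real (L0 + 1)) * (\<bar>\<omega>\<bar> * (\<rho> * X / 2))" by (simp add: mult.assoc)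
  have "(\<Sum>j<n. ln (co j)) + (\<Sum>j<n. ln (exp (cost (g j)) ^ (2 * L0))) \<le> (\<Sum>j<n. 4 * real L0 * cost (g j))"
    unfolding sum.distrib[symmetric]
  proof (intro sum_mono)
    fix j
    have "ln (zval phi (num j)) \<le> cost (g j)" "ln (zval phi (den j)) \<le> cost (g j)"
      using le_cost(1,2)[of j] ppos[of j] by (metis ln_exp ln_le_cancel_iff exp_gt_zero)+
    then have "real L0 * (ln (zval phi (num j)) + ln (zval phi (den j))) \<le> real L0 * (2 * cost (g j))"
      by (intro mult_left_mono) auto
    then show "ln (co j) + ln (exp (cost (g j)) ^ (2 * L0)) \<le> 4 * real L0 * cost (g j)"
      by (simp add: co_def ln_realpow)
  qed
  also have "\<dots> = (\<Sum>pt\<in>g ` {..<n}. 4 * real L0 * cost pt)" using ginj by (simp add: sum.reindex)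
  also have "\<dots> \<le> (\<Sum>pt\<in>{..<R'} \<times> {..<S}. 4 * real L0 * cost pt)"
  proof (rule sum_mono2)
    show "g ` {..<n} \<subseteq> {..<R'} \<times> {..<S}" by (rule image_subsetI) (use g in simp)
  qed (use cost0 in auto)
  also have "\<dots> = 4 * real L0 * (\<Sum>i<R'. \<Sum>j<S. real i * A + real j * B)"
    by (simp add: cost_def sum.cartesian_product sum_distrib_left case_prod_unfold)
  also have "(\<Sum>i<R'. \<Sum>j<S. real i * A + real j * B) = real S * A * (\<Sum>i<R'. real i) + real R' * B * (\<Sum>j<S. real j)"
    by (simp add: sum.distrib sum_distrib_left sum_distrib_right mult_ac)
  also have "4 * real L0 * \<dots> = 2 * real L0 * real R' * real S * ((real R' - 1) * A + (real S - 1) * B)"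
    unfolding sum_lessThan_real by (simp add: field_simps)
  finally show ?thesis using main c1 unfolding n_def by simp
qed

section \<open>Lower bound for linear forms in two logarithms\<close>

lemma ln_Suc_le: "n \<ge> 1 \<Longrightarrow> real n * (ln (real (Suc n)) - ln (real n)) \<le> 1"
proof -
  assume n: "n \<ge> 1"
  have "ln (real (Suc n)) - ln (real n) = ln (1 + 1 / real n)"
  proof -
    have "real (Suc n) = real n * (1 + 1 / real n)" using n by (simp add: field_simps)
    moreover have "ln (real n * (1 + 1 / real n)) = ln (real n) + ln (1 + 1 / real n)"
      using n by (subst ln_mult) (auto simp: add_pos_pos less_imp_neq[symmetric])
    ultimately show ?thesis by simp
  qed
  also have "\<dots> \<le> 1 / real n" by (rule ln_add_one_self_le_self) simp
  finally show ?thesis using n by (simp add: field_simps)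
qed

lemma ln_fact_ge: "n \<ge> 1 \<Longrightarrow> ln (fact n) \<ge> real n * ln (real n) - real n"
proof (induction n rule: nat_induct_at_least)
  case (Suc n)
  have "ln (fact (Suc n) :: real) = ln (real (Suc n)) + ln (fact n)"
    by (simp only: fact_Suc of_nat_mult of_nat_fact, subst ln_mult) auto
  moreover have "real n * ln (real (Suc n)) - real n * ln (real n) \<le> 1"
    using ln_Suc_le[OF Suc.hyps] by (simp add: right_diff_distrib)
  ultimately show ?case using Suc.IH by (simp add: distrib_right)
qed simp

text \<open>Stirling's estimate summed over the rows. It turns the growth ln X of the binomial rows
  into ln (X / K).\<close>

lemma sum_ln_fact_ge:
  "K \<ge> 1 \<Longrightarrow> (\<Sum>k<K. ln (fact k)) \<ge> real K * (real K - 1) / 2 * (ln (real K) - 3 / 2) - real K / 2"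
proof (induction K rule: nat_induct_at_least)
  case (Suc K)
  define l where "l = ln (real K)"
  define l' where "l' = ln (real (Suc K))"
  have 1: "ln (fact K) \<ge> real K * l - real K" using ln_fact_ge[OF Suc.hyps] by (simp add: l_def)
  have "(real K + 1) * (real K * (l' - l)) \<le> (real K + 1) * 1"
    using ln_Suc_le[OF Suc.hyps] by (intro mult_left_mono) (auto simp: l_def l'_def)
  then have 2: "real K * real K * l' + real K * l' \<le> real K * real K * l + real K * l + real K + 1"
    by (simp add: algebra_simps)
  have "(\<Sum>k<Suc K. ln (fact k)) \<ge> real K * (real K - 1) / 2 * (l - 3 / 2) - real K / 2 + (real K * l - real K)"
    using Suc.IH 1 by (simp add: l_def)
  moreover have "real (Suc K) * (real (Suc K) - 1) / 2 * (l' - 3 / 2) - real (Suc K) / 2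
      \<le> real K * (real K - 1) / 2 * (l - 3 / 2) - real K / 2 + (real K * l - real K)"
  proof -
    have e1: "real (Suc K) * (real (Suc K) - 1) / 2 * (l' - 3 / 2) - real (Suc K) / 2 =
        (real K * real K * l' + real K * l') / 2 - 3 / 4 * (real K * real K + real K) - (real K + 1) / 2"
      by (simp add: field_simps)
    have e2: "real K * (real K - 1) / 2 * (l - 3 / 2) - real K / 2 + (real K * l - real K) =
        (real K * real K * l - real K * l) / 2 - 3 / 4 * (real K * real K - real K) - real K / 2 + (real K * l - real K)"
      by (simp add: field_simps)
    have "(P + p) / 2 - 3 / 4 * (kk + k) - (k + 1) / 2 \<le> (Q - q) / 2 - 3 / 4 * (kk - k) - k / 2 + (q - k)"
      if "P + p \<le> Q + q + k + 1" for P p Q q kk k :: real using that by (simp add: field_simps)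
    from this[OF 2] show ?thesis unfolding e1 e2 .
  qed
  ultimately show ?case unfolding l'_def by linarith
qed simp

text \<open>The dilation factor will be exp 5, so that (1 + exp 5) / 2 is at most 75.\<close>

lemma exp5_le: "exp (5::real) \<le> 149"
proof -
  have "exp (1::real) \<le> 5837465777 / 2147483648 + inverse (2 ^ 32)" using e_approx_32 by linarith
  also have "\<dots> \<le> 27183 / 10000" by simp
  finally have "exp (1::real) ^ 5 \<le> (27183 / 10000) ^ 5" by (intro power_mono) auto
  moreover have "(27183 / 10000 :: real) ^ 5 \<le> 149" by (simp add: power_divide)
  moreover have "exp (1::real) ^ 5 = exp 5" by (simp flip: exp_of_nat_mult)
  ultimately show ?thesis by linarith
qed

lemma ln_75_le: "ln (75::real) \<le> 44 / 10"
proof -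
  have "exp (1::real) \<ge> 271 / 100"
  proof -
    have "inverse (2 ^ 32) = (1 / 4294967296 :: real)" by simp
    then show ?thesis using e_approx_32 by linarith
  qed
  then have "exp (1::real) ^ 4 \<ge> (271 / 100) ^ 4" by (intro power_mono) auto
  moreover have "(271 / 100 :: real) ^ 4 \<ge> 539 / 10" by (simp add: power_divide)
  moreover have "exp (1::real) ^ 4 = exp 4" by (simp flip: exp_of_nat_mult)
  ultimately have 1: "exp (4::real) \<ge> 539 / 10" by linarith
  have 2: "exp (4 / 10 :: real) \<ge> 14 / 10" using exp_ge_add_one_self[of "4 / 10 :: real"] by simp
  have "75 \<le> (539 / 10) * (14 / 10 :: real)" by simp
  also have "\<dots> \<le> exp 4 * exp (4 / 10)" using 1 2 by (intro mult_mono) auto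
  also have "\<dots> = exp (44 / 10)" by (simp flip: exp_add)
  finally have "ln (75::real) \<le> ln (exp (44 / 10))" by (subst ln_le_cancel_iff) auto
  then show ?thesis by simp
qed

lemma ln_le_small:
  assumes "x \<ge> (36000::real)"
  shows "2 * ln x + 1 \<le> x / 100"
proof -
  define y where "y = sqrt x"
  have y: "y > 0" "x = y * y" using assms by (auto simp: y_def)
  have "y \<ge> 189" unfolding y_def using assms by (intro real_le_rsqrt) auto
  have "ln (y / 16) \<le> y / 16 - 1" using y by (intro ln_le_minus_one) auto
  then have "ln y \<le> y / 16 - 1 + 4 * ln 2" using y ln_realpow[of 2 4] by (simp add: ln_div)
  moreover have "ln x = 2 * ln y" using y by (simp add: ln_mult)
  ultimately have "2 * ln x + 1 \<le> y / 4 + 16 * ln 2" by linarith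
  also have "\<dots> \<le> y / 4 + 16" using ln_le_minus_one[of 2] by simp
  also have "\<dots> \<le> x / 100"
  proof -
    have "y * 189 \<le> y * y" using \<open>y \<ge> 189\<close> y by (intro mult_left_mono) auto
    then show ?thesis using \<open>y \<ge> 189\<close> y(2) by linarith
  qed
  finally show ?thesis .
qed

text \<open>Grid sides \<open>S\<close> about 2 l A and \<open>R\<close> about 2 l B give a
  determinant of size N about 4 l^2 A B. At order N^2 the gain 5/2 exceeds the losses: 5/4 from the
  binomial rows, 22/100 from the exponentials, 1001/1000 from the heights. \<open>lnb\<close> says
  how large l must be relative to ln (b / B), and the conditions on \<open>\<omega>\<close> keep the
  exponentials cheap.\<close>

lemma two_log_bound:
  fixes a1 a2 b1 b2 :: zphi and A B :: real and b L0 :: nat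
  defines "l \<equiv> real (2 * L0 + 1)"
    and "\<omega> \<equiv> ln (zval phi a1) - ln (zval phi a2)"
    and "\<Lambda> \<equiv> real b * (ln (zval phi a1) - ln (zval phi a2)) - (ln (zval phi b1) - ln (zval phi b2))"
  assumes pos: "zval phi a1 > 0" "zval phi a2 > 0" "zval phi b1 > 0" "zval phi b2 > 0"
    and a: "zval phi a1 \<le> exp A" "zval phi a2 \<le> exp A" "\<bar>zval psi a1\<bar> \<le> exp A" "\<bar>zval psi a2\<bar> \<le> exp A"
    and bb: "zval phi b1 \<le> exp B" "zval phi b2 \<le> exp B" "\<bar>zval psi b1\<bar> \<le> exp B" "\<bar>zval psi b2\<bar> \<le> exp B"
    and A: "A \<ge> 1" and B: "B \<ge> 1000" and \<omega>0: "\<omega> \<noteq> 0" and L0: "L0 \<ge> 1"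
    and \<omega>1: "\<bar>\<omega>\<bar> \<le> A / 400" and \<omega>2: "50 * (real b * \<bar>\<omega>\<bar>) \<le> B"
    and b: "2 * l * B + 1 \<le> real b" and lnb: "ln (1 + real b / (2 * B)) + 37 / 10 \<le> 5 / 4 * l"
  shows "\<bar>\<Lambda>\<bar> \<ge> exp (- 26 * l\<^sup>2 * A * B)"
proof (rule ccontr)
  assume "\<not> ?thesis"
  then have \<Lambda>: "\<bar>\<Lambda>\<bar> < exp (- 26 * l\<^sup>2 * A * B)" by simp
  define L where "L = 2 * L0 + 1"
  have lL: "l = real L" by (simp add: l_def L_def)
  have l3: "l \<ge> 3" using L0 by (simp add: l_def)
  define S where "S = nat \<lceil>2 * l * A\<rceil>"
  define R where "R = nat \<lceil>2 * l * B\<rceil>"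
  define s where "s = real S"
  define r where "r = real R"
  have lA: "2 * l * A \<ge> 6"
  proof -
    have "l * A \<ge> 3 * 1" using l3 A by (intro mult_mono) auto
    then show ?thesis by linarith
  qed
  have lB: "2 * l * B \<ge> 6000"
  proof -
    have "l * B \<ge> 3 * 1000" using l3 B by (intro mult_mono) auto
    then show ?thesis by linarith
  qed
  have s: "s \<ge> 2 * l * A" "s \<le> 2 * l * A + 1" using lA unfolding s_def S_def by linarith+
  have r: "r \<ge> 2 * l * B" "r \<le> 2 * l * B + 1" using lB unfolding r_def R_def by linarith+
  have rs0: "r > 0" "s > 0" "r \<ge> 6000" "s \<ge> 6" using lA lB s r by linarith+
  have Rb: "R \<le> b" using r(2) b unfolding r_def by linarith
  have RS1: "R \<ge> 1" "S \<ge> 1" using rs0 by (auto simp: r_def s_def)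
  \<comment> \<open>The least \<open>K\<close> with \<open>R * S \<le> K * L\<close>, so that
    \<open>(K - 1) * L < R * S\<close> as the zero estimate requires.\<close>
  define K where "K = (R * S + L - 1) div L"
  have L1: "L > 0" by (simp add: L_def)
  have K1: "R * S \<le> K * L" and K2: "K * L < R * S + L"
  proof -
    have e: "K * L + (R * S + L - 1) mod L = R * S + L - 1" unfolding K_def by (rule div_mult_mod_eq)
    have "(R * S + L - 1) mod L < L" using L1 by simp
    then show "R * S \<le> K * L" using e L1 by linarith
    show "K * L < R * S + L" using e L1 by linarith
  qed
  have "R * S \<ge> 1 * 1" using RS1 by (intro mult_mono) auto
  then have K0: "K \<ge> 1" using K1 by (cases K) auto
  have card: "(K - 1) * L < R * S" using K2 K0 by (cases K) auto
  define k where "k = real K"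
  define N where "N = k * l"
  have NKL: "N = real (K * L)" by (simp add: N_def k_def lL)
  have N1: "r * s \<le> N" and N2: "N \<le> r * s + l"
  proof -
    show "r * s \<le> N" using of_nat_mono[OF K1, where ?'a = real] by (simp add: NKL r_def s_def)
    show "N \<le> r * s + l"
      using of_nat_mono[OF less_imp_le[OF K2], where ?'a = real] by (simp add: NKL r_def s_def lL)
  qed
  have rs_l: "r * s \<ge> 4 * l\<^sup>2 * A * B"
  proof -
    have "(2 * l * B) * (2 * l * A) \<le> r * s" using r s lA lB rs0 by (intro mult_mono) auto
    then show ?thesis by (simp add: power2_eq_square algebra_simps)
  qed
  have lA3: "l * A \<ge> 3" and lB3: "l * B \<ge> 3000" using lA lB by linarith+
  have l2AB: "l\<^sup>2 * A * B \<ge> 9000"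
  proof -
    have "3 * 3000 \<le> (l * A) * (l * B)"
      by (rule mult_mono) (use lA3 lB3 in linarith)+
    then show ?thesis by (simp add: power2_eq_square algebra_simps)
  qed
  have N36: "N \<ge> 36000" using rs_l l2AB N1 by simp
  have N5: "N \<le> 5 * l\<^sup>2 * A * B"
  proof -
    have "r * s \<le> (2 * l * B + 1) * (2 * l * A + 1)"
      by (rule mult_mono) (use r s rs0 in linarith)+
    also have "\<dots> = 4 * l\<^sup>2 * A * B + 2 * l * B + 2 * l * A + 1" by (simp add: power2_eq_square algebra_simps)
    finally have 1: "N \<le> 4 * l\<^sup>2 * A * B + 2 * l * B + 2 * l * A + 1 + l" using N2 by simp
    have "(l * B) * 3 \<le> (l * B) * (l * A)"
      by (rule mult_left_mono) (use lA3 lB3 in linarith)+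
    then have 2: "2 * l * B \<le> 2 / 3 * (l\<^sup>2 * A * B)" by (simp add: power2_eq_square algebra_simps)
    have "(l * A) * 3000 \<le> (l * A) * (l * B)"
      by (rule mult_left_mono) (use lA3 lB3 in linarith)+
    then have 3: "2 * l * A \<le> 2 / 3000 * (l\<^sup>2 * A * B)" by (simp add: power2_eq_square algebra_simps)
    have "l * 1 \<le> l * A" using l3 A by (intro mult_left_mono) auto
    then show ?thesis using 1 2 3 l2AB by linarith
  qed
  define rho where "rho = exp (5 :: real)"
  have rho1: "rho \<ge> 1" by (simp add: rho_def)
  have rhoN: "rho ^ (K * L) = exp (5 * N)" by (simp add: rho_def NKL flip: exp_of_nat_mult)
  \<comment> \<open>The constant 26 is 25 + 1: \<open>rho ^ (K * L)\<close> is exp (5 N) with N at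
    most 5 l^2 A B, and the remaining exp (l^2 A B) absorbs 4 L0 S.\<close>
  have small: "real (L0 * S) * \<bar>\<Lambda>\<bar> \<le> 1 / (4 * rho ^ (K * L))"
  proof -
    have "4 * real (L0 * S) \<le> 2 * l * s" by (simp add: l_def s_def algebra_simps)
    also have "\<dots> \<le> r * s" using lB r rs0 B l3
    proof -
      have "2 * l * 1 \<le> 2 * l * B" using l3 B by (intro mult_left_mono) auto
      then have "2 * l \<le> r" using r by simp
      then show ?thesis using rs0 by (intro mult_right_mono) auto
    qed
    also have "\<dots> \<le> 5 * l\<^sup>2 * A * B" using N1 N5 by simp
    also have "\<dots> \<le> exp (l\<^sup>2 * A * B)"
    proof -
      define t where "t = l\<^sup>2 * A * B"
      have t: "t \<ge> 9000" using l2AB by (simp add: t_def)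
      have "5 * t \<le> t * t / 4" using t mult_right_mono[of 20 t t] by simp
      also have "\<dots> \<le> (1 + t / 2) ^ 2" using t by (simp add: power2_eq_square field_simps)
      also have "\<dots> \<le> exp (t / 2) ^ 2" using t by (intro power_mono exp_ge_add_one_self) auto
      also have "\<dots> = exp t" by (simp flip: exp_of_nat_mult)
      finally show ?thesis by (simp add: t_def)
    qed
    finally have 1: "4 * real (L0 * S) \<le> exp (l\<^sup>2 * A * B)" .
    have "4 * real (L0 * S) * \<bar>\<Lambda>\<bar> \<le> exp (l\<^sup>2 * A * B) * exp (- 26 * l\<^sup>2 * A * B)"
      using 1 \<Lambda> by (intro mult_mono) auto
    also have "\<dots> = exp (- 5 * (5 * l\<^sup>2 * A * B))" unfolding exp_add[symmetric] by (rule arg_cong[of _ _ exp]) linarith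
    also have "\<dots> \<le> exp (- 5 * N)" unfolding exp_le_cancel_iff using N5 by linarith
    finally show ?thesis unfolding rhoN by (simp add: exp_minus field_simps)
  qed
  define X where "X = real (R + 2 * L0 - 1 + b * (S - 1))"
  have main: "(\<Sum>i<K * L. real i) * ln rho \<le> 2 * ln (fact (K * L)) + real (K * L) * ln 2
     + real L * (\<Sum>k<K. real k * (ln ((1 + rho) * X / 2) + ln X) - 2 * ln (fact k))
     + real K * (real L0 * real (L0 + 1)) * (\<bar>\<omega>\<bar> * (rho * X / 2))
     + 2 * real L0 * real (R + 2 * L0) * real S * ((real (R + 2 * L0) - 1) * A + (real S - 1) * B)"
    unfolding X_def L_def \<omega>_def
    by (rule interpolation_inequality[OF pos a bb])
      (use A B \<omega>0 K0 L0 RS1 Rb card rho1 small in \<open>auto simp: \<omega>_def \<Lambda>_def L_def\<close>)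
  have r2: "real (R + 2 * L0) = r + l - 1" by (simp add: r_def l_def)
  have XX: "X \<le> r + l + real b * s"
  proof -
    have "R + 2 * L0 - 1 + b * (S - 1) \<le> R + 2 * L0 + b * S" by (intro add_mono mult_left_mono) auto
    then have "X \<le> real (R + 2 * L0 + b * S)" unfolding X_def by (rule of_nat_mono)
    then show ?thesis using l3 by (simp add: r_def s_def l_def)
  qed
  have "1 \<le> R + 2 * L0 - 1 + b * (S - 1)" using L0 RS1 by simp
  then have X1: "X \<ge> 1" unfolding X_def by (metis of_nat_1 of_nat_mono)
  have lr: "l \<le> r / 2000"
  proof -
    have "2 * l * 1000 \<le> 2 * l * B" using l3 B by (intro mult_left_mono) auto
    then show ?thesis using r by linarith
  qed
  have k1: "k \<ge> 1" using K0 by (simp add: k_def)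
  have krs: "r * s / l \<le> k" using N1 l3 by (simp add: N_def field_simps)
  have XK: "ln (X / k) \<le> ln (1 + real b / (2 * B))"
  proof (subst ln_le_cancel_iff)
    have "X / k \<le> (r + l + real b * s) / (r * s / l)"
      using XX krs rs0 l3 X1 by (intro frac_le) auto
    also have "\<dots> = (r + l) / r * (l / s) + real b * (l / r)" using rs0 by (simp add: field_simps)
    also have "\<dots> \<le> 2 * (1 / 2) + real b * (1 / (2 * B))"
    proof (intro add_mono mult_mono mult_left_mono)
      show "(r + l) / r \<le> 2" using lr rs0 by (simp add: field_simps)
      have "2 * l * 1 \<le> 2 * l * A" using l3 A by (intro mult_left_mono) auto
      then show "l / s \<le> 1 / 2" using s rs0 by (simp add: field_simps)
      show "l / r \<le> 1 / (2 * B)" using r rs0 B by (simp add: field_simps)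
    qed (use rs0 l3 in auto)
    finally show "X / k \<le> 1 + real b / (2 * B)" by simp
  qed (use X1 k1 B in \<open>auto intro!: add_pos_nonneg\<close>)
  have T3: "(\<Sum>k<K. real k * (ln ((1 + rho) * X / 2) + ln X) - 2 * ln (fact k)) \<le> k * ((k - 1) * (5 / 4 * l) + 1)"
  proof -
    have "(1 + rho) * X / 2 > 0" using X1 rho1 by (intro divide_pos_pos mult_pos_pos) auto
    moreover have "(1 + rho) * X / 2 \<le> 75 * X"
      using exp5_le X1 mult_right_mono[of "1 + rho" 150 X] by (simp add: rho_def)
    ultimately have "ln ((1 + rho) * X / 2) \<le> ln (75 * X)" using X1 by (subst ln_le_cancel_iff) auto
    also have "\<dots> = ln 75 + ln X" using X1 by (simp add: ln_mult)
    finally have u: "ln ((1 + rho) * X / 2) + ln X \<le> 2 * ln X + 44 / 10" using ln_75_le by simp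
    have "(\<Sum>k<K. real k * (ln ((1 + rho) * X / 2) + ln X) - 2 * ln (fact k)) =
      (\<Sum>k<K. real k) * (ln ((1 + rho) * X / 2) + ln X) - 2 * (\<Sum>k<K. ln (fact k))"
      by (simp add: sum_subtractf sum_distrib_left sum_distrib_right)
    also have "\<dots> \<le> (\<Sum>k<K. real k) * (2 * ln X + 44 / 10) - 2 * (k * (k - 1) / 2 * (ln k - 3 / 2) - k / 2)"
      using u sum_ln_fact_ge[OF K0] by (intro diff_mono mult_left_mono sum_nonneg) (auto simp: k_def)
    \<comment> \<open>37/10 is 22/10, half the bound for ln 75, plus 3/2 from the
      factorials.\<close>
    also have "\<dots> = k * ((k - 1) * (ln X - ln k + 37 / 10) + 1)"
      unfolding sum_lessThan_real by (simp add: k_def field_simps)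
    also have "ln X - ln k = ln (X / k)" using X1 k1 by (simp add: ln_div)
    also have "k * ((k - 1) * (ln (X / k) + 37 / 10) + 1) \<le> k * ((k - 1) * (5 / 4 * l) + 1)"
      using XK lnb k1 by (intro mult_left_mono add_mono) auto
    finally show ?thesis .
  qed
  \<comment> \<open>\<open>\<omega>1\<close> controls the part r + l of the bound for
    \<open>X\<close>, and \<open>\<omega>2\<close> the part b s.\<close>
  have T4: "k * (real L0 * real (L0 + 1)) * (\<bar>\<omega>\<bar> * (rho * X / 2)) \<le> N * (22 / 100 * N)"
  proof -
    have "4 * (real L0 * real (L0 + 1)) \<le> l * l" by (simp add: l_def algebra_simps)
    then have 1: "real L0 * real (L0 + 1) \<le> l * l / 4" by simp
    have "\<bar>\<omega>\<bar> * X \<le> \<bar>\<omega>\<bar> * (r + l + real b * s)" using XX by (intro mult_left_mono) auto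
    also have "\<dots> \<le> \<bar>\<omega>\<bar> * (r * (2001 / 2000)) + (real b * \<bar>\<omega>\<bar>) * s"
      using lr mult_left_mono[of "r + l" "r * (2001 / 2000)" "\<bar>\<omega>\<bar>"] by (simp add: algebra_simps)
    also have "\<dots> \<le> A / 400 * (r * (2001 / 2000)) + B / 50 * s"
      using \<omega>1 \<omega>2 rs0 by (intro add_mono mult_right_mono) auto
    finally have 2: "l * (\<bar>\<omega>\<bar> * X) \<le> l * (A / 400 * (r * (2001 / 2000)) + B / 50 * s)"
      using l3 by (intro mult_left_mono) auto
    have "(l * A) * r \<le> s / 2 * r" using s rs0 by (intro mult_right_mono) auto
    moreover have "(l * B) * s \<le> r / 2 * s" using r rs0 by (intro mult_right_mono) auto
    ultimately have 3: "l * (\<bar>\<omega>\<bar> * X) \<le> r * s * (113 / 10000)" using 2 rs0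
    proof -
      have "l * (A / 400 * (r * (2001 / 2000)) + B / 50 * s) = (l * A * r) * (2001 / 800000) + (l * B * s) / 50"
        by (simp add: field_simps)
      moreover have "s / 2 * r = r * s / 2" "r / 2 * s = r * s / 2" by simp_all
      moreover have "r * s > 0" using rs0 by simp
      ultimately show ?thesis using 2 \<open>(l * A) * r \<le> s / 2 * r\<close> \<open>(l * B) * s \<le> r / 2 * s\<close> by linarith
    qed
    have "k * (real L0 * real (L0 + 1)) * (\<bar>\<omega>\<bar> * (rho * X / 2)) \<le> k * (l * l / 4) * (\<bar>\<omega>\<bar> * (149 * X / 2))"
      using 1 k1 X1 exp5_le by (intro mult_mono) (auto simp: rho_def)
    also have "\<dots> = N * (149 / 8 * (l * (\<bar>\<omega>\<bar> * X)))" by (simp add: N_def)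
    also have "\<dots> \<le> N * (149 / 8 * (r * s * (113 / 10000)))" using 3 N36 by (intro mult_left_mono) auto
    also have "\<dots> \<le> N * (22 / 100 * N)" using N1 N36 by (intro mult_left_mono) auto
    finally show ?thesis .
  qed
  have T5: "2 * real L0 * real (R + 2 * L0) * real S * ((real (R + 2 * L0) - 1) * A + (real S - 1) * B) \<le> N * (1001 / 1000 * N)"
  proof -
    define w where "w = r * (2001 / 2000)"
    have w: "r + l \<le> w" "w > 0" using lr rs0 by (auto simp: w_def)
    have "(real (R + 2 * L0) - 1) * A + (real S - 1) * B \<le> w * A + s * B"
      unfolding r2 using w l3 A B by (intro add_mono mult_right_mono) (auto simp: s_def)
    moreover have "2 * real L0 * real (R + 2 * L0) * real S \<le> l * w * s"
      unfolding r2 s_def[symmetric] using w rs0 l3 by (intro mult_mono) (auto simp: l_def)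
    moreover have "(real (R + 2 * L0) - 1) * A + (real S - 1) * B \<ge> 0"
      unfolding r2 using rs0 l3 A B RS1 by (intro add_nonneg_nonneg mult_nonneg_nonneg) auto
    ultimately have "2 * real L0 * real (R + 2 * L0) * real S * ((real (R + 2 * L0) - 1) * A + (real S - 1) * B)
       \<le> l * w * s * (w * A + s * B)"
      using w rs0 l3 by (intro mult_mono[where b = "l * w * s" and d = "w * A + s * B"]) auto
    also have "\<dots> = w * s * (w * (l * A) + s * (l * B))" by (simp add: algebra_simps)
    also have "\<dots> \<le> w * s * (w * (s / 2) + s * (r / 2))"
      using w rs0 r s by (intro mult_left_mono add_mono) auto
    also have "\<dots> = (r * s) * (r * s) * (2001 / 2000 * (4001 / 4000))" by (simp add: w_def field_simps)
    also have "\<dots> \<le> (N * N) * (1001 / 1000)" using N1 rs0 N36 by (intro mult_mono) auto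
    finally show ?thesis by simp
  qed
  have T1: "ln (fact (K * L)) \<le> N * ln N"
  proof -
    have "(fact (K * L) :: real) \<le> real ((K * L) ^ (K * L))" by (rule fact_le_power)
    moreover have "real (K * L) > 0" using N36 NKL by linarith
    ultimately have "ln (fact (K * L) :: real) \<le> ln (real (K * L) ^ (K * L))"
      by (subst ln_le_cancel_iff) auto
    then show ?thesis using N36 by (simp add: ln_realpow NKL)
  qed
  have "N * (N - 1) / 2 * 5 \<le> 2 * (N * ln N) + N * ln 2 + l * (k * ((k - 1) * (5 / 4 * l) + 1))
     + N * (22 / 100 * N) + N * (1001 / 1000 * N)"
  proof -
    have e: "(\<Sum>i<K * L. real i) * ln rho = N * (N - 1) / 2 * 5"
      unfolding sum_lessThan_real NKL by (simp add: rho_def)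
    have "real L * (\<Sum>k<K. real k * (ln ((1 + rho) * X / 2) + ln X) - 2 * ln (fact k)) \<le> l * (k * ((k - 1) * (5 / 4 * l) + 1))"
      unfolding lL using T3 by (intro mult_left_mono) (auto simp: lL)
    moreover have "real K * (real L0 * real (L0 + 1)) * (\<bar>\<omega>\<bar> * (rho * X / 2)) \<le> N * (22 / 100 * N)"
      using T4 by (simp add: k_def)
    ultimately show ?thesis using main T1 T5 unfolding e NKL[symmetric] by linarith
  qed
  also have "l * (k * ((k - 1) * (5 / 4 * l) + 1)) = N * (5 / 4 * N - 5 / 4 * l + 1)"
    by (simp add: N_def field_simps)
  finally have "N * ((N - 1) / 2 * 5) \<le> N * (2 * ln N + ln 2 + (5 / 4 * N - 5 / 4 * l + 1) + 22 / 100 * N + 1001 / 1000 * N)"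
    by (simp add: algebra_simps)
  then have "(N - 1) / 2 * 5 \<le> 2 * ln N + ln 2 + (5 / 4 * N - 5 / 4 * l + 1) + 22 / 100 * N + 1001 / 1000 * N"
    using N36 by (subst (asm) mult_le_cancel_left_pos) auto
  moreover have "2 * ln N + 1 \<le> N / 100" using ln_le_small[OF N36] .
  moreover have "ln 2 \<le> (1::real)" using ln_le_minus_one[of "2::real"] by simp
  \<comment> \<open>On the right N has the coefficient 1/100 + 5/4 + 22/100 + 1001/1000 = 2.481,
    below 5/2.\<close>
  ultimately have "5 / 2 * N - 5 / 2 \<le> N / 100 - 1 + 1 + (5 / 4 * N - 15 / 4 + 1) + 22 / 100 * N + 1001 / 1000 * N"
    using l3 by (simp add: field_simps)
  then show False using N36 by (simp add: field_simps)
qed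

section \<open>Lower bound for linear forms in three logarithms\<close>

lemma e_bounds: "exp (1::real) \<ge> 2718 / 1000" "exp (1::real) \<le> 2719 / 1000"
proof -
  have "inverse (2 ^ 32) = (1 / 4294967296 :: real)" by simp
  then show "exp (1::real) \<ge> 2718 / 1000" "exp (1::real) \<le> 2719 / 1000"
    using e_approx_32 by linarith+
qed

lemma ln_le_iff: "x > 0 \<Longrightarrow> ln x \<le> y \<longleftrightarrow> x \<le> exp (y::real)"
  using ln_le_cancel_iff[of x "exp y"] by simp

lemma exp_rational_ge:
  assumes "(2718 / 1000) ^ a \<ge> (x::real) ^ b" "b > 0" "x \<ge> 0"
  shows "exp (real a / real b) \<ge> x"
proof -
  have "x ^ b \<le> exp 1 ^ a" using assms(1) e_bounds(1) by (meson order.trans power_mono zero_le_divide_iff zero_le_numeral)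
  also have "\<dots> = exp (real a / real b) ^ b" using assms(2) by (simp flip: exp_of_nat_mult)
  finally show ?thesis using assms by (meson exp_ge_zero power_mono_iff)
qed

lemma exp_rational_le:
  assumes "(2719 / 1000) ^ a \<le> (x::real) ^ b" "b > 0" "x \<ge> 0"
  shows "exp (real a / real b) \<le> x"
proof -
  have "exp (real a / real b) ^ b = exp 1 ^ a" using assms(2) by (simp flip: exp_of_nat_mult)
  also have "\<dots> \<le> (2719 / 1000) ^ a" using e_bounds(2) by (intro power_mono) auto
  also have "\<dots> \<le> x ^ b" by (rule assms)
  finally show ?thesis using assms by (meson exp_ge_zero power_mono_iff)
qed

lemma sqrt5_bounds: "sqrt 5 > 2236 / 1000" "sqrt 5 < 2237 / 1000"
  by (rule real_less_rsqrt, simp add: power2_eq_square) (rule real_less_lsqrt, auto simp: power2_eq_square)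

lemma phi_bounds: "phi > 1618 / 1000" "phi < 16185 / 10000"
  using sqrt5_bounds by (auto simp: phi_def)

lemma psi_bounds: "psi > - 6185 / 10000" "psi < - 618 / 1000"
  using sqrt5_bounds by (auto simp: psi_def)

lemma abs_psi_le_1: "\<bar>psi\<bar> \<le> 1"
  using psi_bounds by linarith

lemma ln_phi_bounds: "ln phi \<ge> 48 / 100" "ln phi \<le> 1 / 2"
proof -
  have "exp (real 1 / real 2) \<ge> phi"
    by (rule exp_rational_ge) (use phi_bounds phi_sq in \<open>auto simp: power2_eq_square\<close>)
  then show "ln phi \<le> 1 / 2" using phi_bounds by (subst ln_le_iff) auto
  have "exp (real 12 / real 25) \<le> (1618 / 1000 :: real)"
    by (rule exp_rational_le) (auto simp: power_divide)
  then have "exp (48 / 100) \<le> phi" using phi_bounds by simp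
  then show "ln phi \<ge> 48 / 100" using phi_bounds by (subst ln_ge_iff) auto
qed

lemma ln3_bounds: "ln (3::real) \<ge> 109 / 100" "ln (3::real) \<le> 11 / 10"
proof -
  have "exp (real 11 / real 10) \<ge> (3::real)"
    by (rule exp_rational_ge) (auto simp: power_divide)
  then show "ln (3::real) \<le> 11 / 10" by (subst ln_le_iff) auto
  have "exp (real 12 / real 11) \<le> (3 :: real)"
    by (rule exp_rational_le) (auto simp: power_divide)
  moreover have "exp (109 / 100) \<le> exp (real 12 / real 11)" by simp
  ultimately have "exp (109 / 100) \<le> (3::real)" by linarith
  then show "ln (3::real) \<ge> 109 / 100" by (subst ln_ge_iff) auto
qed

definition zphi_gen :: zphi where "zphi_gen = ZPhi 0 1"

lemma zval_gen [simp]: "zval t zphi_gen = t"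
  by (simp add: zphi_gen_def)

lemma zval_numeral_phi [simp]: "zval phi (numeral k) = numeral k"
  using zval_of_nat_phi[of "numeral k"] by simp

lemma zval_numeral_psi [simp]: "zval psi (numeral k) = numeral k"
  using zval_of_nat_psi[of "numeral k"] by simp

lemma zval_phi_eq_0D: "zval phi x = 0 \<Longrightarrow> zval psi x = 0"
proof -
  assume x: "zval phi x = 0"
  obtain a b where ab: "x = ZPhi a b" by (cases x)
  have e: "real_of_int b * sqrt 5 = - (2 * real_of_int a + real_of_int b)"
    using x by (simp add: ab phi_def field_simps)
  have "(real_of_int (2 * a + b)) ^ 2 = (real_of_int b * sqrt 5) ^ 2"
    unfolding e power2_minus by simp
  also have "\<dots> = real_of_int (5 * b ^ 2)" by (simp add: power_mult_distrib)
  finally have "(2 * a + b) ^ 2 = 5 * b ^ 2" by (metis of_int_eq_iff of_int_power)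
  then have "b = 0" by (rule five_times_square_not_square)
  then show ?thesis using x by (simp add: ab)
qed

text \<open>Conjugation would give psi^p = 3^q, but |psi| is below 1. This makes \<alpha> different
  from 1.\<close>

lemma phi_power_ne_3_power: "q \<ge> 1 \<Longrightarrow> phi ^ p \<noteq> 3 ^ q"
proof
  assume q: "q \<ge> 1" and "phi ^ p = 3 ^ q"
  then have "zval phi (zphi_gen ^ p - 3 ^ q) = 0"
    by (simp add: zphi.hom_minus zphi.hom_power)
  then have "zval psi (zphi_gen ^ p - 3 ^ q) = 0" by (rule zval_phi_eq_0D)
  then have "psi ^ p = 3 ^ q" by (simp add: zpsi.hom_minus zpsi.hom_power)
  moreover have "\<bar>psi ^ p\<bar> \<le> 1" using abs_psi_le_1 by (simp add: power_abs power_le_one)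
  moreover have "(3::real) ^ q \<ge> 3 ^ 1" using q by (intro power_increasing) auto
  ultimately show False by simp
qed

text \<open>The linear form \<open>n ln \<phi> - m ln 3 - ln \<gamma>\<close> in three logarithms is regrouped as
  \<open>b ln \<alpha> - ln \<beta>\<close> in two: \<open>\<alpha> = \<phi>\<^sup>p / 3\<^sup>q\<close> with \<open>p / q\<close> a Dirichlet approximation of
  \<open>ln 3 / ln \<phi>\<close>, and \<open>(n, m) = b (p, q) + (n', m')\<close> with a small remainder, which \<open>\<beta>\<close> absorbs.\<close>

lemma log_form_bound:
  fixes g1 g2 :: zphi and n m Q L0 :: nat and h :: real
  defines "l \<equiv> real (2 * L0 + 1)"
    and "\<Lambda> \<equiv> real n * ln phi - real m * ln 3 - (ln (zval phi g1) - ln (zval phi g2))"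
  assumes pos: "zval phi g1 > 0" "zval phi g2 > 0"
    and g: "zval phi g1 \<le> exp h" "zval phi g2 \<le> exp h" "\<bar>zval psi g1\<bar> \<le> exp h" "\<bar>zval psi g2\<bar> \<le> exp h"
    and h: "h \<ge> 0" and Q: "Q \<ge> 1000" and L0: "L0 \<ge> 1"
    and lQ: "ln (real Q) \<le> 5 / 4 * l" and Ql: "208 * l \<le> real Q"
    and m: "5 * l * real Q * (h + 2 * real Q) \<le> real m"
  shows "\<bar>\<Lambda>\<bar> \<ge> exp (- 26 * l\<^sup>2 * (6 / 5 * real Q * h + 36 / 25 * (real Q)\<^sup>2 + 55 * real m / real Q))"
proof (cases "\<bar>\<Lambda>\<bar> \<le> 1")
  case False
  have "- 26 * l\<^sup>2 * (6 / 5 * real Q * h + 36 / 25 * (real Q)\<^sup>2 + 55 * real m / real Q) \<le> 0"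
    using h by (simp add: mult_nonneg_nonneg add_nonneg_nonneg)
  then have "exp (- 26 * l\<^sup>2 * (6 / 5 * real Q * h + 36 / 25 * (real Q)\<^sup>2 + 55 * real m / real Q)) \<le> 1" by simp
  then show ?thesis using False by linarith
next
  case True
  define F where "F = real Q"
  have F: "F \<ge> 1000" using Q by (simp add: F_def)
  have lp: "ln phi > 0" using ln_phi_bounds by linarith
  obtain p' q' :: int where pq': "0 < q'" "q' \<le> int Q" "\<bar>of_int q' * (ln 3 / ln phi) - of_int p'\<bar> < 1 / real Q"
  proof (rule Dirichlet_approx[of Q "ln 3 / ln phi"])
    show "Q > 0" using Q by simp
  next
    fix h k :: int
    assume "0 < k" "k \<le> int Q" "\<bar>of_int k * (ln 3 / ln phi) - of_int h\<bar> < 1 / real Q"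
    then show ?thesis by (rule that[of k h])
  qed
  define q where "q = nat q'"
  define u where "u = real q"
  have q1: "q \<ge> 1" "q \<le> Q" "of_int q' = u" using pq' by (auto simp: q_def u_def)
  have u: "u \<ge> 1" "u \<le> F" using q1 by (auto simp: u_def F_def)
  have "ln 3 / ln phi \<ge> 1" using lp ln3_bounds ln_phi_bounds by (simp add: field_simps)
  then have "u * 1 \<le> u * (ln 3 / ln phi)" using u by (intro mult_left_mono) auto
  moreover have "1 / real Q \<le> 1 / 1000" using Q by (intro divide_left_mono) auto
  ultimately have "real_of_int p' > 0" using pq'(3) u unfolding q1(3) by linarith
  then have p'0: "p' > 0" by simp
  define p where "p = nat p'"
  have p: "of_int p' = real p" using p'0 by (simp add: p_def)
  define \<omega> where "\<omega> = real p * ln phi - u * ln 3"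
  have \<omega>Q: "\<bar>\<omega>\<bar> \<le> 1 / (2 * F)"
  proof -
    have "\<bar>\<omega>\<bar> = ln phi * \<bar>u * (ln 3 / ln phi) - real p\<bar>"
      using lp by (simp add: \<omega>_def abs_mult[symmetric, of "ln phi", simplified abs_of_pos] right_diff_distrib abs_minus_commute abs_mult_pos' mult.commute)
    also have "\<dots> \<le> 1 / 2 * (1 / F)"
      using pq'(3) ln_phi_bounds lp unfolding q1(3) p F_def by (intro mult_mono) auto
    finally show ?thesis by simp
  qed
  have \<omega>0: "\<omega> \<noteq> 0"
  proof
    assume "\<omega> = 0"
    then have "ln (phi ^ p) = ln (3 ^ q)" using phi_bounds by (simp add: \<omega>_def u_def ln_realpow)
    then have "phi ^ p = 3 ^ q" using phi_bounds by (subst (asm) ln_inj_iff) auto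
    then show False using phi_power_ne_3_power[OF q1(1)] by blast
  qed
  define b where "b = m div q"
  define m' where "m' = m mod q"
  define v where "v = real b"
  have mb: "real m = v * u + real m'" unfolding v_def b_def m'_def u_def
    by (metis div_mult_mod_eq of_nat_add of_nat_mult)
  have m'u: "real m' \<le> u" using q1 by (simp add: m'_def u_def less_imp_le)
  define n' where "n' = int n - int b * int p"
  have nb: "real n = v * real p + of_int n'" by (simp add: n'_def v_def)
  \<comment> \<open>\<open>z / 2\<close> will bound b |\<omega>|, since b is at most m / q and
    |\<omega>| at most 1 / (2 Q).\<close>
  define z where "z = real m / (u * F)"
  have z0: "z \<ge> 0" using u F by (simp add: z_def)
  have bw: "v * \<bar>\<omega>\<bar> \<le> z / 2"
  proof -
    have "v * u \<le> real m" using mb by simp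
    then have "v \<le> real m / u" using u by (simp add: field_simps)
    then have "v * \<bar>\<omega>\<bar> \<le> real m / u * (1 / (2 * F))" using \<omega>Q u by (intro mult_mono) auto
    then show ?thesis by (simp add: z_def)
  qed
  define A where "A = u * ln 3 + 1"
  \<comment> \<open>The summands account for gamma, for 3^m' with m' below Q, for |\<Lambda>| \<le>
    1 and for b \<omega>. The factor 26 also meets the requirement 50 b |\<omega>| \<le> B and the
    bound on b / B.\<close>
  define B where "B = h + 11 / 10 * F + 1 + 26 * z"
  \<comment> \<open>The remainder \<open>n'\<close> can be negative; \<open>nat\<close> puts the
    power of phi into \<open>b1\<close> or \<open>b2\<close> according to its sign.\<close>
  define b1 where "b1 = g1 * 3 ^ m' * zphi_gen ^ nat (- n')"
  define b2 where "b2 = g2 * zphi_gen ^ nat n'"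
  have zb1: "zval phi b1 = zval phi g1 * 3 ^ m' * phi ^ nat (- n')"
    "zval psi b1 = zval psi g1 * 3 ^ m' * psi ^ nat (- n')"
    by (simp_all add: b1_def zphi.hom_mult zphi.hom_power zpsi.hom_mult zpsi.hom_power)
  have zb2: "zval phi b2 = zval phi g2 * phi ^ nat n'" "zval psi b2 = zval psi g2 * psi ^ nat n'"
    by (simp_all add: b2_def zphi.hom_mult zphi.hom_power zpsi.hom_mult zpsi.hom_power)
  have pb: "zval phi b1 > 0" "zval phi b2 > 0" using pos phi_bounds by (auto simp: zb1 zb2)
  have lb1: "ln (zval phi b1) = ln (zval phi g1) + real m' * ln 3 + real (nat (- n')) * ln phi"
    using pos phi_bounds by (simp add: zb1 ln_mult ln_realpow)
  have lb2: "ln (zval phi b2) = ln (zval phi g2) + real (nat n') * ln phi"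
    using pos phi_bounds by (simp add: zb2 ln_mult ln_realpow)
  have "real_of_int n' * ln phi = real (nat n') * ln phi - real (nat (- n')) * ln phi"
    by (cases "n' \<ge> 0") auto
  then have lb: "ln (zval phi b1) - ln (zval phi b2) = v * \<omega> - \<Lambda>"
    unfolding lb1 lb2 \<Lambda>_def mb nb \<omega>_def by (simp add: algebra_simps)
  have vw: "\<bar>v * \<omega>\<bar> \<le> z / 2" using bw by (simp add: abs_mult v_def)
  have lng: "ln (zval phi g1) \<le> h" "ln (zval phi g2) \<le> h"
    using g pos by (metis ln_exp ln_le_cancel_iff exp_gt_zero)+
  have m'3: "real m' * ln 3 \<le> 11 / 10 * F" "real m' * ln 3 \<ge> 0"
  proof -
    have "real m' * ln 3 \<le> F * (11 / 10)" using m'u u ln3_bounds by (intro mult_mono) auto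
    then show "real m' * ln 3 \<le> 11 / 10 * F" by simp
  qed simp
  \<comment> \<open>One of \<open>b1\<close>, \<open>b2\<close> is free of phi and bounded directly;
    their logarithms differ by b \<omega> - \<Lambda>, which transfers the bound to the
    other.\<close>
  have lB: "ln (zval phi b1) \<le> B" "ln (zval phi b2) \<le> B"
  proof -
    have "ln (zval phi b1) \<le> h + 11 / 10 * F + 1 + z \<and> ln (zval phi b2) \<le> h + 11 / 10 * F + 1 + z"
    proof (cases "n' \<ge> 0")
      case True
      then have "ln (zval phi b1) \<le> h + 11 / 10 * F" using lb1 lng m'3 by simp
      then show ?thesis using lb vw z0 \<open>\<bar>\<Lambda>\<bar> \<le> 1\<close> by (auto simp: abs_le_iff)
    next
      case False
      then have "ln (zval phi b2) \<le> h" using lb2 lng by simp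
      then show ?thesis using lb vw z0 F \<open>\<bar>\<Lambda>\<bar> \<le> 1\<close> by (auto simp: abs_le_iff)
    qed
    then show "ln (zval phi b1) \<le> B" "ln (zval phi b2) \<le> B" using z0 by (auto simp: B_def)
  qed
  have hB: "h + 11 / 10 * F \<le> B" "h \<le> B" using z0 F by (auto simp: B_def)
  have bB: "zval phi b1 \<le> exp B" "zval phi b2 \<le> exp B"
    using lB pb by (simp_all add: ln_le_iff)
  have psi_le: "\<bar>psi ^ k\<bar> \<le> 1" for k using abs_psi_le_1 by (simp add: power_abs power_le_one)
  have bB': "\<bar>zval psi b1\<bar> \<le> exp B" "\<bar>zval psi b2\<bar> \<le> exp B"
  proof -
    have "\<bar>zval psi b1\<bar> = \<bar>zval psi g1\<bar> * 3 ^ m' * \<bar>psi ^ nat (- n')\<bar>" by (simp add: zb1 abs_mult)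
    also have "\<dots> \<le> exp h * exp (real m' * ln 3) * 1"
      using g psi_le by (intro mult_mono) (auto simp: exp_of_nat_mult)
    also have "\<dots> \<le> exp B" using hB m'3 by (simp flip: exp_add)
    finally show "\<bar>zval psi b1\<bar> \<le> exp B" .
    have "\<bar>zval psi b2\<bar> \<le> exp h * 1" unfolding zb2 abs_mult using g psi_le by (intro mult_mono) auto
    also have "\<dots> \<le> exp B" using hB by simp
    finally show "\<bar>zval psi b2\<bar> \<le> exp B" .
  qed
  have A1: "A \<ge> 1" using u by (simp add: A_def)
  have B1: "B \<ge> 1000" using h F z0 by (simp add: B_def)
  have z3: "zval phi (3 ^ q) = 3 ^ q" "zval psi (3 ^ q) = 3 ^ q"
    and zp: "zval phi (zphi_gen ^ p) = phi ^ p" "zval psi (zphi_gen ^ p) = psi ^ p"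
    by (simp_all add: zphi.hom_power zpsi.hom_power)
  have 3: "exp (u * ln 3) = 3 ^ q" by (simp add: u_def exp_of_nat_mult)
  have aA: "phi ^ p \<le> exp A" "3 ^ q \<le> exp A" "\<bar>psi ^ p\<bar> \<le> exp A"
  proof -
    have "real p * ln phi = \<omega> + u * ln 3" by (simp add: \<omega>_def)
    also have "\<dots> \<le> A"
    proof -
      have "1 / (2 * F) \<le> 1" using F by (simp add: field_simps)
      then show ?thesis using \<omega>Q by (simp add: A_def abs_le_iff)
    qed
    finally have "ln (phi ^ p) \<le> A" using phi_bounds by (simp add: ln_realpow)
    then show "phi ^ p \<le> exp A" using phi_bounds by (simp add: ln_le_iff)
    show "3 ^ q \<le> exp A" unfolding 3[symmetric] by (simp add: A_def)
    show "\<bar>psi ^ p\<bar> \<le> exp A" using psi_le[of p] A1 exp_ge_add_one_self[of A] by linarith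
  qed
  have l3: "l \<ge> 3" using L0 by (simp add: l_def)
  have \<omega>eq: "ln (zval phi (zphi_gen ^ p)) - ln (zval phi (3 ^ q)) = \<omega>"
    using phi_bounds by (simp add: zp z3 ln_realpow \<omega>_def u_def)
  have \<Lambda>eq: "real b * (ln (zval phi (zphi_gen ^ p)) - ln (zval phi (3 ^ q))) - (ln (zval phi b1) - ln (zval phi b2)) = \<Lambda>"
    unfolding \<omega>eq lb by (simp add: v_def)
  have "\<bar>\<Lambda>\<bar> \<ge> exp (- 26 * l\<^sup>2 * A * B)"
    unfolding \<Lambda>eq[symmetric] l_def
  proof (rule two_log_bound)
    show "\<bar>ln (zval phi (zphi_gen ^ p)) - ln (zval phi (3 ^ q))\<bar> \<le> A / 400"
    proof -
      have "1 / (2 * F) \<le> 1 / 400" using F by (intro divide_left_mono) auto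
      then show ?thesis unfolding \<omega>eq using \<omega>Q A1 by simp
    qed
    show "50 * (real b * \<bar>ln (zval phi (zphi_gen ^ p)) - ln (zval phi (3 ^ q))\<bar>) \<le> B"
      unfolding \<omega>eq using bw h F z0 by (simp add: v_def B_def)
    show "2 * real (2 * L0 + 1) * B + 1 \<le> real b"
    proof -
      define w where "w = real m / u"
      have "w - 1 \<le> v" using mb m'u u by (simp add: w_def field_simps)
      have zw: "z = w / F" by (simp add: z_def w_def)
      have w0: "w \<ge> 0" using u by (simp add: w_def)
      have "52 * l * w \<le> F / 4 * w" using Ql w0 unfolding F_def by (intro mult_right_mono) auto
      then have 1: "52 * l * z \<le> w / 4" unfolding zw using F by (simp add: field_simps)
      have "real m / F \<le> w" unfolding w_def using u F by (intro divide_left_mono) auto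
      moreover have "5 * l * (h + 2 * F) \<le> real m / F" using m F by (simp add: F_def field_simps)
      ultimately have 2: "5 * l * (h + 2 * F) \<le> w" by linarith
      have lh: "l * h \<ge> 0" "l * F \<ge> 3 * F" using l3 h F by (auto intro: mult_right_mono)
      have e1: "2 * l * B = 2 * (l * h) + 22 / 10 * (l * F) + 2 * l + 52 * l * z"
        by (simp add: B_def algebra_simps)
      have e2: "5 * l * (h + 2 * F) = 5 * (l * h) + 10 * (l * F)" by (simp add: algebra_simps)
      have lF: "l * 1000 \<le> l * F" using l3 F by (intro mult_left_mono) auto
      have "2 * l * B + 1 \<le> v" using 1 2 lh lF e1 e2 F \<open>w - 1 \<le> v\<close> by linarith
      then show ?thesis by (simp add: l_def v_def)
    qed
    show "ln (1 + real b / (2 * B)) + 37 / 10 \<le> 5 / 4 * real (2 * L0 + 1)"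
    proof -
      have "v / (2 * B) \<le> F / 52"
      proof -
        have "v * u \<le> real m" using mb by simp
        then have "v \<le> z * F" using u F by (simp add: z_def field_simps)
        moreover have "z * F * 52 \<le> 2 * B * F" using h F z0 by (simp add: B_def)
        ultimately have "v * 52 \<le> 2 * B * F" by linarith
        then show ?thesis using B1 by (simp add: field_simps)
      qed
      then have "1 + v / (2 * B) \<le> F / 49" using F by simp
      then have "ln (1 + v / (2 * B)) \<le> ln (F / 49)"
        using B1 F by (subst ln_le_cancel_iff) (auto intro!: add_pos_nonneg simp: v_def)
      also have "\<dots> = ln F - ln 49" using F by (simp add: ln_div)
      also have "ln 49 \<ge> (37 / 10 :: real)"
      proof -
        have "exp (real 15 / real 4) \<le> (49::real)" by (rule exp_rational_le) (auto simp: power_divide)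
        moreover have "exp (37 / 10) \<le> exp (real 15 / real 4)" by simp
        ultimately have "exp (37 / 10) \<le> (49::real)" by linarith
        then show ?thesis by (subst ln_ge_iff) auto
      qed
      then have "ln F - ln 49 \<le> ln F - 37 / 10" by simp
      finally show ?thesis using lQ by (simp add: F_def l_def v_def)
    qed
  qed (use pos pb aA bB bB' A1 B1 L0 \<omega>0 phi_bounds phi_power_ne_3_power[OF q1(1), of p] in \<open>auto simp: \<omega>eq z3 zp\<close>)
  moreover have "A * B \<le> 6 / 5 * F * h + 36 / 25 * F\<^sup>2 + 55 * real m / F"
  proof -
    have AF: "A \<le> 11 / 10 * u + 1" using u ln3_bounds mult_left_mono[of "ln 3" "11 / 10" u] by (simp add: A_def)
    then have "A \<le> 6 / 5 * F" using u F by linarith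
    then have 1: "A * (h + 11 / 10 * F + 1) \<le> 6 / 5 * F * (h + 6 / 5 * F)"
      using A1 h F by (intro mult_mono) auto
    have "A \<le> 21 / 10 * u" using AF u by linarith
    then have "A * (26 * z) \<le> 21 / 10 * u * (26 * z)" using z0 by (intro mult_right_mono) auto
    also have "\<dots> = 546 / 10 * real m / F" using u by (simp add: z_def field_simps)
    also have "\<dots> \<le> 55 * real m / F" using F by (intro divide_right_mono) auto
    finally have "A * B \<le> 6 / 5 * F * (h + 6 / 5 * F) + 55 * real m / F"
      using 1 by (simp add: B_def algebra_simps)
    then show ?thesis by (simp add: power2_eq_square algebra_simps)
  qed
  then have "26 * l\<^sup>2 * (A * B) \<le> 26 * l\<^sup>2 * (6 / 5 * F * h + 36 / 25 * F\<^sup>2 + 55 * real m / F)"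
    by (intro mult_left_mono) auto
  then have "exp (- 26 * l\<^sup>2 * (6 / 5 * F * h + 36 / 25 * F\<^sup>2 + 55 * real m / F)) \<le> exp (- 26 * l\<^sup>2 * A * B)"
    by (simp add: mult.assoc)
  ultimately show ?thesis unfolding F_def by linarith
qed

text \<open>Real parameters are rounded: \<open>x\<close> up to \<open>Q\<close>, and 8/10 (ln x +
  1/1000) up to an odd \<open>l\<close>, which costs at most 2 and explains 201/100. The slightly
  larger constants absorb the rounding.\<close>

lemma log_form_bound_real:
  fixes g1 g2 :: zphi and n m :: nat and h x W :: real
  defines "\<Lambda> \<equiv> real n * ln phi - real m * ln 3 - (ln (zval phi g1) - ln (zval phi g2))"
  assumes pos: "zval phi g1 > 0" "zval phi g2 > 0"
    and g: "zval phi g1 \<le> exp h" "zval phi g2 \<le> exp h" "\<bar>zval psi g1\<bar> \<le> exp h" "\<bar>zval psi g2\<bar> \<le> exp h"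
    and h: "h \<ge> 0" and x: "x \<ge> 1000" and W: "W \<ge> 8 / 10 * ln x + 201 / 100"
    and Wx: "208 * W \<le> x" and m: "6 * W * x * (h + 2 * x) \<le> real m"
  shows "\<bar>\<Lambda>\<bar> \<ge> exp (- 26 * W\<^sup>2 * (121 / 100 * x * h + 145 / 100 * x\<^sup>2 + 55 * real m / x))"
proof -
  define Q where "Q = nat \<lceil>x\<rceil>"
  have Q: "real Q \<ge> x" "real Q \<le> x + 1" using x unfolding Q_def by linarith+
  then have Qx: "real Q \<le> 1001 / 1000 * x" using x by linarith
  have "ln (real Q) \<le> ln (1001 / 1000 * x)" using Q x Qx by (subst ln_le_cancel_iff) auto
  also have "\<dots> = ln (1001 / 1000) + ln x" using x by (subst ln_mult) auto
  also have "ln (1001 / 1000) \<le> (1 / 1000 :: real)" using ln_le_minus_one[of "1001 / 1000"] by simp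
  finally have lnQ: "ln (real Q) \<le> ln x + 1 / 1000" by simp
  have lnx: "ln x \<ge> 4"
  proof -
    have "exp (real 4 / real 1) \<le> (1000::real)" by (rule exp_rational_le) (auto simp: power_divide)
    then show ?thesis using x by (subst ln_ge_iff) auto
  qed
  define t where "t = (8 / 10 * (ln x + 1 / 1000) - 1) / 2"
  have t0: "t > 1" using lnx by (simp add: t_def)
  define L0 where "L0 = nat \<lceil>t\<rceil>"
  define l where "l = real (2 * L0 + 1)"
  have L0: "real L0 \<ge> t" "real L0 \<le> t + 1" using t0 unfolding L0_def by linarith+
  then have l: "l \<ge> 8 / 10 * (ln x + 1 / 1000)" "l \<le> W" using W by (auto simp: l_def t_def field_simps)
  have L01: "L0 \<ge> 1" using L0(1) t0 by (cases L0) auto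
  have l0: "l \<ge> 3" using L01 by (simp add: l_def)
  have W0: "W > 0" using l l0 by simp
  define S1 where "S1 = 6 / 5 * real Q * h + 36 / 25 * (real Q)\<^sup>2 + 55 * real m / real Q"
  define S2 where "S2 = 121 / 100 * x * h + 145 / 100 * x\<^sup>2 + 55 * real m / x"
  have "\<bar>\<Lambda>\<bar> \<ge> exp (- 26 * l\<^sup>2 * S1)"
    unfolding \<Lambda>_def l_def S1_def
  proof (rule log_form_bound[OF pos g h])
    show "Q \<ge> 1000" using Q x by linarith
    show "ln (real Q) \<le> 5 / 4 * real (2 * L0 + 1)" using l lnQ by (simp add: l_def)
    show "208 * real (2 * L0 + 1) \<le> real Q" using l Wx Q by (simp add: l_def)
    have "5 * l * real Q * (h + 2 * real Q) \<le> 5 * W * (1001 / 1000 * x) * (1001 / 1000 * (h + 2 * x))"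
      using l l0 W0 Qx h x by (intro mult_mono) auto
    also have "\<dots> = 5 * (1001 / 1000)^2 * (W * x * (h + 2 * x))" by (simp add: power2_eq_square)
    also have "\<dots> \<le> 6 * (W * x * (h + 2 * x))" using W0 h x by (intro mult_right_mono) (auto simp: power_divide)
    finally show "5 * real (2 * L0 + 1) * real Q * (h + 2 * real Q) \<le> real m" using m by (simp add: l_def)
  qed (rule L01)
  moreover have "26 * l\<^sup>2 * S1
     \<le> 26 * W\<^sup>2 * S2"
  proof -
    have 1: "l\<^sup>2 \<le> W\<^sup>2" using l l0 by (intro power_mono) auto
    have "6 / 5 * real Q \<le> 121 / 100 * x" using Qx x by simp
    then have 2: "6 / 5 * real Q * h \<le> 121 / 100 * x * h" using h by (rule mult_right_mono)
    have "(real Q)\<^sup>2 \<le> (1001 / 1000 * x)\<^sup>2" using Qx by (intro power_mono) auto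
    then have "(real Q)\<^sup>2 \<le> 1002001 / 1000000 * x\<^sup>2" by (simp add: power2_eq_square)
    then have 3: "36 / 25 * (real Q)\<^sup>2 \<le> 145 / 100 * x\<^sup>2" using zero_le_power2[of x] by linarith
    have 4: "55 * real m / real Q \<le> 55 * real m / x" using Q x by (intro divide_left_mono) auto
    have "26 * l\<^sup>2 * S1
      \<le> 26 * l\<^sup>2 * S2"
      unfolding S1_def S2_def by (rule mult_left_mono[OF add_mono[OF add_mono[OF 2 3] 4]]) simp
    also have "\<dots> \<le> 26 * W\<^sup>2 * S2"
      using 1 h x by (intro mult_right_mono) (auto simp: S2_def)
    finally show ?thesis .
  qed
  then have "- 26 * W\<^sup>2 * S2 \<le> - 26 * l\<^sup>2 * S1" by linarith
  ultimately have "exp (- 26 * W\<^sup>2 * S2) \<le> \<bar>\<Lambda>\<bar>" by (meson exp_le_cancel_iff order.trans)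
  then show ?thesis by (simp only: S2_def)
qed

lemma abs_ln_le_2: "\<bar>y - 1\<bar> \<le> 1 / 2 \<Longrightarrow> \<bar>ln y\<bar> \<le> 2 * \<bar>y - 1 :: real\<bar>"
proof -
  assume y: "\<bar>y - 1\<bar> \<le> 1 / 2"
  then have y0: "y \<ge> 1 / 2" by linarith
  have 1: "ln y \<le> y - 1" using y0 by (intro ln_le_minus_one) auto
  have "- ln y = ln (1 / y)" using y0 by (simp add: ln_div)
  also have "\<dots> \<le> 1 / y - 1" using y0 by (intro ln_le_minus_one) auto
  also have "\<dots> = (1 - y) / y" using y0 by (simp add: field_simps)
  also have "\<dots> \<le> 2 * \<bar>y - 1\<bar>"
  proof -
    have "(1 - y) / y \<le> \<bar>y - 1\<bar> / y" using y0 by (intro divide_right_mono) auto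
    also have "\<dots> \<le> \<bar>y - 1\<bar> / (1 / 2)" using y0 by (intro divide_left_mono) auto
    finally show ?thesis by simp
  qed
  finally have 2: "- ln y \<le> 2 * \<bar>y - 1\<bar>" .
  have "y - 1 \<le> 2 * \<bar>y - 1\<bar>" by (simp add: abs_if)
  then have "ln y \<le> 2 * \<bar>y - 1\<bar>" using 1 by (rule order.trans[rotated])
  then show ?thesis using 2 by (simp add: abs_le_iff)
qed

lemma fib_closed_phi: "real (fib n) = (phi ^ n - psi ^ n) / sqrt 5"
  using fib_closed_form[of n] by (simp add: phi_def psi_def)

lemma phi_power_Suc2: "phi ^ Suc (Suc n) = phi ^ Suc n + phi ^ n"
proof -
  have "phi ^ Suc (Suc n) = phi * phi * phi ^ n" by simp
  then show ?thesis unfolding phi_sq by (simp add: algebra_simps)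
qed

lemma phi_power_le_fib: "phi ^ n \<le> real (fib (n + 2))"
proof (induction n rule: fib.induct)
  case 1 then show ?case by simp
next
  case 2 then show ?case using phi_bounds by (simp add: numeral_3_eq_3)
next
  case (3 n)
  have "real (fib (Suc (Suc n) + 2)) = real (fib (Suc n + 2)) + real (fib (n + 2))" by simp
  then show ?case using 3 unfolding phi_power_Suc2 by linarith
qed

section \<open>The equation between differences\<close>

text \<open>The negated exponent of the lower bound: \<open>x\<close> is the Dirichlet parameter,
  \<open>h\<close> the logarithmic height of the constant term, and \<open>W\<close> bounds the
  number of exponentials.\<close>

definition cost :: "real \<Rightarrow> real \<Rightarrow> real \<Rightarrow> nat \<Rightarrow> real" where
  "cost W x h m = 26 * W\<^sup>2 * (121 / 100 * x * h + 145 / 100 * x\<^sup>2 + 55 * real m / x)"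

definition admissible :: "real \<Rightarrow> real \<Rightarrow> real \<Rightarrow> nat \<Rightarrow> bool" where
  "admissible W x h m \<longleftrightarrow> x \<ge> 1000 \<and> W \<ge> 8 / 10 * ln x + 201 / 100 \<and> 208 * W \<le> x \<and> 6 * W * x * (h + 2 * x) \<le> real m"

text \<open>The constant term is sqrt 5 times two quotients. As sqrt 5 = 2 phi - 1 has conjugate -
  sqrt 5 and logarithm below 1, it adds the summand 1 to \<open>1 + s + t\<close>.\<close>

lemma log_form_bound_product:
  assumes pos: "zval phi a1 > 0" "zval phi a2 > 0" "zval phi b1 > 0" "zval phi b2 > 0"
    and a: "zval phi a1 \<le> exp s" "zval phi a2 \<le> exp s" "\<bar>zval psi a1\<bar> \<le> exp s" "\<bar>zval psi a2\<bar> \<le> exp s"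
    and b: "zval phi b1 \<le> exp t" "zval phi b2 \<le> exp t" "\<bar>zval psi b1\<bar> \<le> exp t" "\<bar>zval psi b2\<bar> \<le> exp t"
    and st: "s \<ge> 0" "t \<ge> 0" "1 + s + t \<le> h" and adm: "admissible W x h m"
  shows "exp (- cost W x h m) \<le> \<bar>real n * ln phi - real m * ln 3 - ln (sqrt 5)
      - (ln (zval phi a1) - ln (zval phi a2)) - (ln (zval phi b1) - ln (zval phi b2))\<bar>"
proof -
  define r where "r = ZPhi (- 1) 2"
  have r: "zval phi r = sqrt 5" "zval psi r = - sqrt 5" by (simp_all add: r_def phi_def psi_def field_simps)
  have s5: "sqrt 5 \<le> exp 1" using sqrt5_bounds e_bounds by linarith
  have e: "exp 1 * exp s * exp t \<le> exp h" using st by (simp flip: exp_add)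
  have e': "exp s * exp t \<le> exp h" using st by (simp flip: exp_add)
  have v: "zval phi (r * a1 * b1) = sqrt 5 * zval phi a1 * zval phi b1" "zval phi (a2 * b2) = zval phi a2 * zval phi b2"
    "\<bar>zval psi (r * a1 * b1)\<bar> = sqrt 5 * \<bar>zval psi a1\<bar> * \<bar>zval psi b1\<bar>" "\<bar>zval psi (a2 * b2)\<bar> = \<bar>zval psi a2\<bar> * \<bar>zval psi b2\<bar>"
    by (simp_all add: zphi.hom_mult zpsi.hom_mult r abs_mult)
  have "exp (- 26 * W\<^sup>2 * (121 / 100 * x * h + 145 / 100 * x\<^sup>2 + 55 * real m / x)) \<le>
     \<bar>real n * ln phi - real m * ln 3 - (ln (zval phi (r * a1 * b1)) - ln (zval phi (a2 * b2)))\<bar>"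
  proof (rule log_form_bound_real)
    show "zval phi (r * a1 * b1) \<le> exp h" unfolding v
      by (rule order.trans[OF mult_mono[OF mult_mono[OF s5 a(1)] b(1)] e]) (use pos in auto)
    show "zval phi (a2 * b2) \<le> exp h" unfolding v
      by (rule order.trans[OF mult_mono[OF a(2) b(2)] e']) (use pos in auto)
    show "\<bar>zval psi (r * a1 * b1)\<bar> \<le> exp h" unfolding v
      by (rule order.trans[OF mult_mono[OF mult_mono[OF s5 a(3)] b(3)] e]) auto
    show "\<bar>zval psi (a2 * b2)\<bar> \<le> exp h" unfolding v
      by (rule order.trans[OF mult_mono[OF a(4) b(4)] e']) auto
  qed (use pos st adm in \<open>auto simp: v admissible_def\<close>)
  moreover have "ln (zval phi (r * a1 * b1)) - ln (zval phi (a2 * b2)) =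
     ln (sqrt 5) + (ln (zval phi a1) - ln (zval phi a2)) + (ln (zval phi b1) - ln (zval phi b2))"
    using pos unfolding v by (simp add: ln_mult)
  ultimately show ?thesis by (simp add: cost_def algebra_simps)
qed

text \<open>Two representations of the same c, with l = n - d and i = m - k;
  \<open>d + 2 \<le> n\<close> is the condition l \<ge> 2.\<close>

locale collision =
  fixes n d m k :: nat
  assumes d: "d \<ge> 1" and k: "k \<ge> 1" and dn: "d + 2 \<le> n" and km: "k \<le> m"
    and eq: "int (fib n) - int (fib (n - d)) = 3 ^ m - 3 ^ (m - k)"
begin

definition "D = (1 / phi) ^ d"
definition "E = (1 / 3 :: real) ^ k"
definition "Lam = real n * ln phi - real m * ln 3 - ln (sqrt 5)"
definition "X = real d * ln phi"
definition "Y = real k * ln 3"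

lemma DE: "D = exp (- X)" "E = exp (- Y)"
proof -
  have "exp (- X) = exp (real d * (- ln phi))" by (simp add: X_def)
  also have "\<dots> = exp (- ln phi) ^ d" by (rule exp_of_nat_mult)
  finally show "D = exp (- X)" using phi_bounds by (simp add: D_def exp_minus inverse_eq_divide)
  have "exp (- Y) = exp (real k * (- ln 3))" by (simp add: Y_def)
  also have "\<dots> = exp (- ln 3) ^ k" by (rule exp_of_nat_mult)
  finally show "E = exp (- Y)" by (simp add: E_def exp_minus inverse_eq_divide)
qed

lemma E_bounds: "E > 0" "E \<le> 1 / 3" "1 / 3 ^ m \<le> E"
proof -
  show "E > 0" by (simp add: E_def)
  have "(1 / 3 :: real) ^ k \<le> (1 / 3) ^ 1" using k by (intro power_decreasing) auto
  then show "E \<le> 1 / 3" by (simp add: E_def)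
  have "(1 / 3 :: real) ^ m \<le> (1 / 3) ^ k" using km by (intro power_decreasing) auto
  then show "1 / 3 ^ m \<le> E" by (simp add: E_def power_divide)
qed

lemma D_bounds: "D > 0" "D \<le> 6185 / 10000"
proof -
  show "D > 0" using phi_bounds by (simp add: D_def)
  have "(1 / phi) ^ d \<le> (1 / phi) ^ 1" using d phi_bounds by (intro power_decreasing) auto
  also have "\<dots> \<le> 6185 / 10000" using phi_bounds by (simp add: field_simps)
  finally show "D \<le> 6185 / 10000" by (simp add: D_def)
qed

text \<open>F_(n-2) \<le> F_n - F_(n-d) \<le> 3^m, hence phi^(n-4) \<le> 3^m, where n - 4 \<ge> d -
  2; 262/100 bounds phi^2. This absorbs 1 / 3^m into O(D).\<close>

lemma three_power_ge: "1 / 3 ^ m \<le> 262 / 100 * D"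
proof -
  have "int (fib (n - d)) \<le> int (fib (n - 1))" using d by (intro of_nat_mono fib_mono) simp
  moreover have "fib n = fib (n - 1) + fib (n - 2)"
    using dn fib2[of "n - 2"] by (simp add: numeral_2_eq_2 Suc_diff_Suc)
  ultimately have "int (fib (n - 2)) \<le> 3 ^ m" using eq zero_le_power[of "3::int" "m - k"] by linarith
  then have "real_of_int (int (fib (n - 2))) \<le> real_of_int (3 ^ m)" by (rule of_int_le_iff[THEN iffD2])
  then have f: "real (fib (n - 2)) \<le> 3 ^ m" by simp
  have "phi ^ d \<le> phi ^ 2 * 3 ^ m"
  proof (cases "n \<ge> 4")
    case True
    have "phi ^ (n - 4) \<le> real (fib (n - 4 + 2))" by (rule phi_power_le_fib)
    moreover have "n - 4 + 2 = n - 2" using True by simp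
    ultimately have "phi ^ (n - 4) \<le> real (fib (n - 2))" by metis
    then have "phi ^ (n - 4) \<le> 3 ^ m" using f by linarith
    then have "phi ^ 2 * phi ^ (n - 4) \<le> phi ^ 2 * 3 ^ m" by (intro mult_left_mono) auto
    moreover have "phi ^ d \<le> phi ^ (2 + (n - 4))" using dn True phi_bounds by (intro power_increasing) auto
    ultimately show ?thesis unfolding power_add by linarith
  next
    case False
    then have "d = 1" using d dn by simp
    have "phi ^ 1 * 1 \<le> phi ^ 2 * 3 ^ m" using phi_bounds by (intro mult_mono power_increasing) auto
    then show ?thesis using \<open>d = 1\<close> by simp
  qed
  moreover have "phi ^ 2 \<le> 262 / 100" using phi_sq phi_bounds by (simp add: power2_eq_square)
  then have "phi ^ 2 * 3 ^ m \<le> 262 / 100 * 3 ^ m" by (intro mult_right_mono) auto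
  ultimately have "phi ^ d \<le> 262 / 100 * 3 ^ m" by linarith
  then have "1 \<le> 262 / 100 * D * 3 ^ m" using phi_bounds by (simp add: D_def power_divide field_simps)
  then show ?thesis by (simp add: field_simps)
qed

text \<open>By Binet's formula phi^n (1 - D) and sqrt 5 3^m (1 - E) differ by psi^n - psi^(n-d),
  which is at most 62/100 as n - d \<ge> 2. Their quotient is thus within 1 / (2 3^m) of 1.\<close>

lemma Lam_full: "\<bar>Lam + ln (1 - D) - ln (1 - E)\<bar> \<le> 1 / 3 ^ m"
proof -
  have s5: "sqrt 5 > 0" by simp
  have "real_of_int (int (fib n) - int (fib (n - d))) = real_of_int (3 ^ m - 3 ^ (m - k))" unfolding eq ..
  then have 1: "real (fib n) - real (fib (n - d)) = 3 ^ m - 3 ^ (m - k)" by simp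
  have pd: "phi ^ (n - d) = phi ^ n * D"
    using dn phi_bounds by (simp add: D_def power_diff power_divide)
  have ek: "(3::real) ^ (m - k) = 3 ^ m * E" using km by (simp add: E_def power_diff power_divide)
  have main: "phi ^ n * (1 - D) - sqrt 5 * 3 ^ m * (1 - E) = psi ^ n - psi ^ (n - d)"
  proof -
    have f: "real (fib i) * sqrt 5 = phi ^ i - psi ^ i" for i by (simp add: fib_closed_phi)
    have "(real (fib n) - real (fib (n - d))) * sqrt 5 = (3 ^ m - 3 ^ m * E) * sqrt 5" unfolding 1 ek ..
    then have "(phi ^ n - psi ^ n) - (phi ^ n * D - psi ^ (n - d)) = (3 ^ m - 3 ^ m * E) * sqrt 5"
      unfolding left_diff_distrib f pd by simp
    then show ?thesis by (simp add: algebra_simps)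
  qed
  have "\<bar>psi ^ (n - d)\<bar> \<le> \<bar>psi\<bar> ^ 2" unfolding power_abs using dn abs_psi_le_1 by (intro power_decreasing) auto
  moreover have "\<bar>psi ^ n\<bar> \<le> \<bar>psi\<bar> ^ 3" unfolding power_abs using d dn abs_psi_le_1 by (intro power_decreasing) auto
  moreover have "\<bar>psi\<bar> ^ 2 = psi + 1" using psi_sq by (simp add: power2_eq_square)
  moreover have "\<bar>psi\<bar> ^ 3 \<le> (6185 / 10000) ^ 3" using psi_bounds by (intro power_mono) auto
  moreover have "(6185 / 10000 :: real) ^ 3 \<le> 237 / 1000" by (simp add: power_divide)
  ultimately have ps: "\<bar>psi ^ n - psi ^ (n - d)\<bar> \<le> 62 / 100" using psi_bounds by linarith
  define T where "T = sqrt 5 * 3 ^ m * (1 - E)"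
  have "1 / 3 \<le> (1::real)" by simp
  have T: "T \<ge> 149 / 100 * 3 ^ m"
  proof -
    have "2236 / 1000 * (2 / 3) * 3 ^ m \<le> sqrt 5 * (1 - E) * 3 ^ m"
      using sqrt5_bounds E_bounds by (intro mult_right_mono mult_mono) auto
    moreover have "149 / 100 * 3 ^ m \<le> 2236 / 1000 * (2 / 3) * (3 ^ m :: real)" by (intro mult_right_mono) auto
    ultimately show ?thesis by (simp add: T_def mult_ac)
  qed
  have T0: "T > 0" using T by (rule less_le_trans[rotated]) simp
  define r where "r = phi ^ n * (1 - D) / T"
  have "phi ^ n * (1 - D) - T = psi ^ n - psi ^ (n - d)" using main by (simp add: T_def)
  then have "r - 1 = (psi ^ n - psi ^ (n - d)) / T" using T0 by (simp add: r_def field_simps)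
  then have "\<bar>r - 1\<bar> = \<bar>psi ^ n - psi ^ (n - d)\<bar> / T" using T0 by simp
  also have "\<dots> \<le> (62 / 100) / (149 / 100 * 3 ^ m)" using ps T T0 by (intro frac_le) auto
  also have "\<dots> \<le> 1 / (2 * 3 ^ m)" by (simp add: field_simps)
  finally have r1: "\<bar>r - 1\<bar> \<le> 1 / (2 * 3 ^ m)" .
  also have "\<dots> \<le> 1 / 2" by (simp add: field_simps)
  finally have "\<bar>ln r\<bar> \<le> 2 * \<bar>r - 1\<bar>" by (rule abs_ln_le_2)
  then have "\<bar>ln r\<bar> \<le> 1 / 3 ^ m" using r1 by simp
  moreover have "ln r = Lam + ln (1 - D) - ln (1 - E)"
    using phi_bounds D_bounds E_bounds T0
    by (simp add: r_def T_def Lam_def ln_div ln_mult ln_realpow)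
  ultimately show ?thesis by simp
qed

lemma ln_E: "\<bar>ln (1 - E)\<bar> \<le> 2 * E"
  using abs_ln_le_2[of "1 - E"] E_bounds by simp

lemma ln_D: "\<bar>ln (1 - D)\<bar> \<le> 263 / 100 * D"
proof -
  have D1: "1 - D \<ge> 3815 / 10000" using D_bounds by simp
  have "- ln (1 - D) = ln (1 / (1 - D))" using D1 by (simp add: ln_div)
  also have "\<dots> \<le> 1 / (1 - D) - 1" using D1 by (intro ln_le_minus_one) auto
  also have "\<dots> = D / (1 - D)" using D1 by (simp add: field_simps)
  also have "\<dots> \<le> D / (3815 / 10000)" using D1 D_bounds by (intro divide_left_mono) auto
  also have "\<dots> \<le> 263 / 100 * D" using D_bounds by simp
  finally have "- ln (1 - D) \<le> 263 / 100 * D" .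
  moreover have "ln (1 - D) \<le> 0" using D1 D_bounds by simp
  ultimately show ?thesis by linarith
qed

lemma Lam_d: "\<bar>Lam + ln (1 - D)\<bar> \<le> 3 * E"
  using Lam_full ln_E E_bounds by linarith

lemma Lam_k: "\<bar>Lam - ln (1 - E)\<bar> \<le> 6 * D"
  using Lam_full ln_D three_power_ge D_bounds by linarith

lemma Lam_0: "\<bar>Lam\<bar> \<le> 3 * E + 3 * D"
  using Lam_full ln_D ln_E E_bounds D_bounds by linarith

lemma phi_d: "zval phi (zphi_gen ^ d) = phi ^ d" "zval phi (zphi_gen ^ d - 1) = phi ^ d - 1"
  "zval psi (zphi_gen ^ d) = psi ^ d" "zval psi (zphi_gen ^ d - 1) = psi ^ d - 1"
  by (simp_all add: zphi.hom_power zpsi.hom_power zphi.hom_minus zpsi.hom_minus)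

lemma three_k: "zval phi (3 ^ k) = 3 ^ k" "zval phi (3 ^ k - 1) = 3 ^ k - 1"
  "zval psi (3 ^ k) = 3 ^ k" "zval psi (3 ^ k - 1) = 3 ^ k - 1"
  by (simp_all add: zphi.hom_power zpsi.hom_power zphi.hom_minus zpsi.hom_minus)

lemma expX: "exp X = phi ^ d" and expY: "exp Y = 3 ^ k"
  using phi_bounds by (simp_all add: X_def Y_def exp_of_nat_mult)

lemma XY_pos: "X > 0" "Y > 0"
  using d k ln_phi_bounds by (auto simp: X_def Y_def)

text \<open>1 - D is the quotient of phi^d - 1 and phi^d. The 1 in \<open>X + 1\<close> makes room
  for the conjugate psi^d - 1, which can approach 2 in absolute value.\<close>

lemma d_part:
  "zval phi (zphi_gen ^ d) > 0" "zval phi (zphi_gen ^ d - 1) > 0"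
  "zval phi (zphi_gen ^ d) \<le> exp (X + 1)" "zval phi (zphi_gen ^ d - 1) \<le> exp (X + 1)"
  "\<bar>zval psi (zphi_gen ^ d)\<bar> \<le> exp (X + 1)" "\<bar>zval psi (zphi_gen ^ d - 1)\<bar> \<le> exp (X + 1)"
  "ln (zval phi (zphi_gen ^ d)) - ln (zval phi (zphi_gen ^ d - 1)) = - ln (1 - D)"
proof -
  have le: "exp X \<le> exp (X + 1)" "2 \<le> exp (X + 1)"
    using exp_ge_add_one_self[of "X + 1"] XY_pos by auto
  have "\<bar>psi ^ d\<bar> \<le> 1" using abs_psi_le_1 by (simp add: power_abs power_le_one)
  moreover have p1: "phi ^ d > 1" using d phi_bounds by (intro one_less_power) auto
  ultimately show "zval phi (zphi_gen ^ d) > 0" "zval phi (zphi_gen ^ d - 1) > 0"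
    "zval phi (zphi_gen ^ d) \<le> exp (X + 1)" "zval phi (zphi_gen ^ d - 1) \<le> exp (X + 1)"
    "\<bar>zval psi (zphi_gen ^ d)\<bar> \<le> exp (X + 1)" "\<bar>zval psi (zphi_gen ^ d - 1)\<bar> \<le> exp (X + 1)"
    using le unfolding phi_d expX by linarith+
  have "phi ^ d - 1 = phi ^ d * (1 - D)" using phi_bounds by (simp add: D_def power_divide field_simps)
  then show "ln (zval phi (zphi_gen ^ d)) - ln (zval phi (zphi_gen ^ d - 1)) = - ln (1 - D)"
    using p1 D_bounds phi_bounds unfolding phi_d by (simp add: ln_mult)
qed

lemma k_part:
  "zval phi (3 ^ k - 1) > 0" "zval phi (3 ^ k) > 0"
  "zval phi (3 ^ k - 1) \<le> exp Y" "zval phi (3 ^ k) \<le> exp Y"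
  "\<bar>zval psi (3 ^ k - 1)\<bar> \<le> exp Y" "\<bar>zval psi (3 ^ k)\<bar> \<le> exp Y"
  "ln (zval phi (3 ^ k - 1)) - ln (zval phi (3 ^ k)) = ln (1 - E)"
proof -
  have 1: "(3::real) ^ k > 1" using k by (intro one_less_power) auto
  then show "zval phi (3 ^ k - 1) > 0" "zval phi (3 ^ k) > 0"
    "zval phi (3 ^ k - 1) \<le> exp Y" "zval phi (3 ^ k) \<le> exp Y"
    "\<bar>zval psi (3 ^ k - 1)\<bar> \<le> exp Y" "\<bar>zval psi (3 ^ k)\<bar> \<le> exp Y"
    unfolding three_k expY by auto
  have "(3::real) ^ k - 1 = 3 ^ k * (1 - E)" by (simp add: E_def power_divide field_simps)
  then show "ln (zval phi (3 ^ k - 1)) - ln (zval phi (3 ^ k)) = ln (1 - E)"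
    using 1 E_bounds unfolding three_k by (simp add: ln_mult)
qed

lemma ln_6_le: "ln (6::real) \<le> 2"
proof -
  have "exp (real 2 / real 1) \<ge> (6::real)" by (rule exp_rational_ge) (auto simp: power_divide)
  then show ?thesis by (subst ln_le_iff) auto
qed

lemma exp_cost_le:
  fixes c z :: real
  shows "exp (- c) \<le> 6 * exp (- z) \<Longrightarrow> z \<le> c + 2"
proof -
  assume "exp (- c) \<le> 6 * exp (- z)"
  then have "ln (exp (- c)) \<le> ln (6 * exp (- z))" by (subst ln_le_cancel_iff) auto
  then show ?thesis using ln_6_le by (simp add: ln_mult)
qed

lemma step1:
  assumes "admissible W x 1 m"
  shows "min X Y \<le> cost W x 1 m + 2"
proof (rule exp_cost_le)
  have "exp (- cost W x 1 m) \<le> \<bar>real n * ln phi - real m * ln 3 - ln (sqrt 5)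
     - (ln (zval phi 1) - ln (zval phi 1)) - (ln (zval phi 1) - ln (zval phi 1))\<bar>"
    by (rule log_form_bound_product[where s = 0 and t = 0]) (use assms in auto)
  also have "\<dots> = \<bar>Lam\<bar>" by (simp add: Lam_def)
  also have "\<dots> \<le> 3 * E + 3 * D" by (rule Lam_0)
  also have "\<dots> \<le> 6 * exp (- min X Y)" unfolding DE by (simp add: min_def)
  finally show "exp (- cost W x 1 m) \<le> 6 * exp (- min X Y)" .
qed

text \<open>The factor belonging to the smaller of \<open>X\<close> and \<open>Y\<close> stays in
  the constant term, at the price of that height; dropping the other costs only O(exp (- max X
  Y)).\<close>

lemma step2:
  assumes h: "2 + min X Y \<le> h" and adm: "admissible W x h m"
  shows "max X Y \<le> cost W x h m + 2"
proof (rule exp_cost_le)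
  show "exp (- cost W x h m) \<le> 6 * exp (- max X Y)"
  proof (cases "X \<le> Y")
    case True
    have "exp (- cost W x h m) \<le> \<bar>real n * ln phi - real m * ln 3 - ln (sqrt 5)
       - (ln (zval phi (zphi_gen ^ d)) - ln (zval phi (zphi_gen ^ d - 1))) - (ln (zval phi 1) - ln (zval phi 1))\<bar>"
      by (rule log_form_bound_product[where s = "X + 1" and t = 0]) (use d_part XY_pos adm h True in auto)
    also have "\<dots> = \<bar>Lam + ln (1 - D)\<bar>" unfolding d_part by (simp add: Lam_def)
    also have "\<dots> \<le> 3 * E" by (rule Lam_d)
    also have "\<dots> \<le> 6 * E" using E_bounds by simp
    finally show ?thesis using True by (simp add: DE max_def)
  next
    case False
    have "exp (- cost W x h m) \<le> \<bar>real n * ln phi - real m * ln 3 - ln (sqrt 5)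
       - (ln (zval phi 1) - ln (zval phi 1)) - (ln (zval phi (3 ^ k - 1)) - ln (zval phi (3 ^ k)))\<bar>"
      by (rule log_form_bound_product[where s = 0 and t = Y]) (use k_part XY_pos adm h False in auto)
    also have "\<dots> = \<bar>Lam - ln (1 - E)\<bar>" unfolding k_part by (simp add: Lam_def)
    also have "\<dots> \<le> 6 * D" by (rule Lam_k)
    finally show ?thesis using False by (simp add: DE max_def)
  qed
qed

lemma step3:
  assumes h: "2 + X + Y \<le> h" and adm: "admissible W x h m"
  shows "real m * ln 3 \<le> cost W x h m"
proof -
  have "exp (- cost W x h m) \<le> \<bar>real n * ln phi - real m * ln 3 - ln (sqrt 5)
     - (ln (zval phi (zphi_gen ^ d)) - ln (zval phi (zphi_gen ^ d - 1)))
     - (ln (zval phi (3 ^ k - 1)) - ln (zval phi (3 ^ k)))\<bar>"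
    by (rule log_form_bound_product[where s = "X + 1" and t = Y]) (use d_part k_part XY_pos adm h in auto)
  also have "\<dots> = \<bar>Lam + ln (1 - D) - ln (1 - E)\<bar>" unfolding d_part k_part by (simp add: Lam_def)
  also have "\<dots> \<le> 1 / 3 ^ m" by (rule Lam_full)
  also have "\<dots> = exp (- (real m * ln 3))" by (simp add: exp_minus exp_of_nat_mult inverse_eq_divide)
  finally show ?thesis by simp
qed

end

section \<open>Absolute bounds for m\<close>

text \<open>Tangent line at 10. It trades each logarithm for a multiple of \<open>u\<close>, so that
  \<open>W\<close> takes the form \<open>w * u\<close>.\<close>

lemma ln_le_linear: "u \<ge> 10 \<Longrightarrow> ln u \<le> 234 / 1000 * (u::real)"
proof -
  assume u: "u \<ge> 10"
  have "exp (real 7 / real 3) \<ge> (10::real)" by (rule exp_rational_ge) (auto simp: power_divide)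
  then have l10: "ln (10::real) \<le> 7 / 3" by (subst ln_le_iff) auto
  have "ln u = ln (10 * (u / 10))" by simp
  also have "\<dots> = ln 10 + ln (u / 10)" using u by (subst ln_mult) auto
  also have "ln (u / 10) \<le> u / 10 - 1" using u by (intro ln_le_minus_one) auto
  finally show ?thesis using l10 u by linarith
qed

lemma monomial_le:
  assumes "u \<ge> (10::real)" "i \<le> j" "c \<le> 10 ^ (j - i)"
  shows "c * u ^ i \<le> u ^ j"
proof -
  have "c * u ^ i \<le> u ^ (j - i) * u ^ i"
    using assms by (intro mult_right_mono order.trans[OF assms(3)] power_mono) auto
  then show ?thesis using assms(2) by (simp flip: power_add)
qed

lemma root_power:
  assumes "real m \<ge> 10 ^ r" "r > 0"
  obtains u where "u \<ge> 10" "real m = u ^ r"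
proof
  show "real m = root r (real m) ^ r" using assms by simp
  have "root r (10 ^ r) \<le> root r (real m)" using assms by (intro real_root_le_mono) auto
  then show "root r (real m) \<ge> 10" using assms by (simp add: real_root_power_cancel)
qed

lemma admissible_monomial:
  assumes "real m = u ^ N"
    and "8 / 10 * ln (r * u ^ i) + 201 / 100 \<le> w * u" "1000 \<le> r * u ^ i" "208 * w * u \<le> r * u ^ i"
    and "6 * w * r * t * u ^ (i + j + 1) + 12 * w * r\<^sup>2 * u ^ (2 * i + 1) \<le> u ^ N"
  shows "admissible (w * u) (r * u ^ i) (t * u ^ j) m"
proof -
  have e: "u ^ (i + j + 1) = u ^ i * u ^ j * u" "u ^ (2 * i + 1) = u ^ i * u ^ i * u"
    by (simp_all add: power_add mult_2)
  have "6 * (w * u) * (r * u ^ i) * (t * u ^ j + 2 * (r * u ^ i)) =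
      6 * w * r * t * u ^ (i + j + 1) + 12 * w * r\<^sup>2 * u ^ (2 * i + 1)"
    unfolding e power2_eq_square by (simp add: algebra_simps)
  then show ?thesis unfolding admissible_def using assms by (simp add: mult.assoc)
qed

lemma cost_monomial:
  assumes "real m = u ^ N" "i \<le> N" "u > 0" "r > 0"
  shows "cost (w * u) (r * u ^ i) (t * u ^ j) m = 26 * w\<^sup>2 * (121 / 100 * r * t) * u ^ (i + j + 2)
    + 26 * w\<^sup>2 * (145 / 100 * r\<^sup>2) * u ^ (2 * i + 2) + 26 * w\<^sup>2 * (55 / r) * u ^ (N - i + 2)"
proof -
  have e: "u ^ (i + j + 2) = u ^ i * u ^ j * u\<^sup>2" "u ^ (2 * i + 2) = u ^ i * u ^ i * u\<^sup>2"
    "u ^ (N - i + 2) = u ^ (N - i) * u\<^sup>2"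
    by (simp_all add: power_add mult_2 power2_eq_square)
  have e': "55 * u ^ N / (r * u ^ i) = 55 / r * u ^ (N - i)"
    using assms by (simp add: power_diff)
  have e'': "(w * u)\<^sup>2 = w\<^sup>2 * u\<^sup>2" "(r * u ^ i)\<^sup>2 = r\<^sup>2 * (u ^ i * u ^ i)"
    by (simp_all add: power_mult_distrib power2_eq_square)
  show ?thesis unfolding cost_def assms(1) e e' e'' by (simp add: algebra_simps)
qed

lemma ln5_ge: "ln (5::real) \<ge> 16 / 10"
proof -
  have "exp (real 8 / real 5) \<le> (5::real)" by (rule exp_rational_le) (auto simp: power_divide)
  then show ?thesis by (subst ln_ge_iff) auto
qed

lemma ln2_le: "ln (2::real) \<le> 7 / 10"
  using ln2_le_25_over_36 by simp

context collision
begin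

text \<open>With \<open>m = u\<^sup>N\<close> every quantity of the descent becomes a monomial in \<open>u \<ge> 10\<close>.\<close>

lemma m_bound_1:
  shows "real m < 10 ^ 120"
proof (rule ccontr)
  assume "\<not> ?thesis"
  then have "10 ^ 120 \<le> real m" by (rule leI)
  then obtain u where u: "u \<ge> 10" and m: "real m = u ^ 120" by (rule root_power) auto
  have lu: "ln u \<le> 234 / 1000 * u" using u by (rule ln_le_linear)
  have u0: "u > 0" using u by simp
  note le = monomial_le[OF u]
  \<comment> \<open>\<open>x\<close> near m^(1/3) = u^40 balances x^2 with m / x; 31/4 exceeds 40 *
    8/10 * 234/1000, the slope needed for \<open>W\<close>.\<close>
  have a0: "admissible ((31 / 4) * u) (2 * u ^ 40) (1 * u ^ 0) m"
  proof (rule admissible_monomial[OF m])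
    have L: "ln (2 * u ^ 40) = ln 2 + 40 * ln u" using u0 by (simp add: ln_mult ln_realpow)
    show "8 / 10 * ln (2 * u ^ 40) + 201 / 100 \<le> (31 / 4) * u" using L lu ln2_le ln5_ge u by linarith
    show "1000 \<le> 2 * u ^ 40" "208 * (31 / 4) * u \<le> 2 * u ^ 40" using le[of 0 40 100000] le[of 1 40 100000] by simp_all
    show "6 * (31 / 4) * 2 * 1 * u ^ (40 + 0 + 1) + 12 * (31 / 4) * (2)\<^sup>2 * u ^ (2 * 40 + 1) \<le> u ^ 120"
      using le[of 41 120 186] le[of 81 120 744] by (simp add: power_divide)
  qed
  have "min X Y \<le> cost ((31 / 4) * u) (2 * u ^ 40) (1 * u ^ 0) m + 2"
    using step1[of "31 / 4 * u" "2 * u ^ 40"] a0 by simp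
  also have "\<dots> \<le> 52100 * u ^ 82"
  proof -
    have "cost ((31 / 4) * u) (2 * u ^ 40) (1 * u ^ 0) m = 26 * ((31 / 4))\<^sup>2 * (121 / 100 * 2 * 1) * u ^ (40 + 0 + 2)
        + 26 * ((31 / 4))\<^sup>2 * (145 / 100 * (2)\<^sup>2) * u ^ (2 * 40 + 2) + 26 * ((31 / 4))\<^sup>2 * (55 / (2)) * u ^ (120 - 40 + 2)"
      by (rule cost_monomial[OF m]) (use u0 in auto)
    then show ?thesis using le[of 42 82 1000000000] le[of 0 82 1000] zero_less_power[OF u0, of 82] by (simp add: power_divide)
  qed
  finally have mn: "min X Y \<le> 52100 * u ^ 82" .
  \<comment> \<open>With h of order u^82, \<open>x\<close> of order u^19 gives x h and m / x the
    same order u^101.\<close>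
  have a1: "admissible ((38 / 10) * u) ((1 / 30) * u ^ 19) (52200 * u ^ 82) m"
  proof (rule admissible_monomial[OF m])
    have "ln (1 / 30 * u ^ 19) \<le> ln (u ^ 19)" using u0 by (subst ln_le_cancel_iff) auto
    then have L: "ln (1 / 30 * u ^ 19) \<le> 19 * ln u" using u0 by (simp add: ln_realpow)
    show "8 / 10 * ln ((1 / 30) * u ^ 19) + 201 / 100 \<le> (38 / 10) * u" using L lu ln2_le ln5_ge u by linarith
    show "1000 \<le> (1 / 30) * u ^ 19" "208 * (38 / 10) * u \<le> (1 / 30) * u ^ 19" using le[of 0 19 100000] le[of 1 19 100000] by simp_all
    show "6 * (38 / 10) * (1 / 30) * 52200 * u ^ (19 + 82 + 1) + 12 * (38 / 10) * ((1 / 30))\<^sup>2 * u ^ (2 * 19 + 1) \<le> u ^ 120"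
      using le[of 102 120 79344] le[of 39 120 "38 / 375"] by (simp add: power_divide)
  qed
  have "max X Y \<le> cost ((38 / 10) * u) ((1 / 30) * u ^ 19) (52200 * u ^ 82) m + 2"
    by (rule step2[OF _ a1]) (use mn le[of 0 82 1] in simp)
  also have "\<dots> \<le> 1420000 * u ^ 103"
  proof -
    have "cost ((38 / 10) * u) ((1 / 30) * u ^ 19) (52200 * u ^ 82) m = 26 * ((38 / 10))\<^sup>2 * (121 / 100 * (1 / 30) * 52200) * u ^ (19 + 82 + 2)
        + 26 * ((38 / 10))\<^sup>2 * (145 / 100 * ((1 / 30))\<^sup>2) * u ^ (2 * 19 + 2) + 26 * ((38 / 10))\<^sup>2 * (55 / ((1 / 30))) * u ^ (120 - 19 + 2)"
      by (rule cost_monomial[OF m]) (use u0 in auto)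
    then show ?thesis using le[of 40 103 1000000000] le[of 0 103 1000] zero_less_power[OF u0, of 103] by (simp add: power_divide)
  qed
  finally have mx: "max X Y \<le> 1420000 * u ^ 103" .
  \<comment> \<open>Now h is of order u^103, and \<open>x\<close> of order u^8 leaves a cost of
    order u^114, six powers below m.\<close>
  have a2: "admissible ((16 / 10) * u) ((1 / 60) * u ^ 8) (1430000 * u ^ 103) m"
  proof (rule admissible_monomial[OF m])
    have "ln (1 / 60 * u ^ 8) \<le> ln (u ^ 8 / 5)" using u0 by (subst ln_le_cancel_iff) auto
    then have L: "ln (1 / 60 * u ^ 8) \<le> 8 * ln u - ln 5" using u0 by (simp add: ln_realpow ln_div)
    show "8 / 10 * ln ((1 / 60) * u ^ 8) + 201 / 100 \<le> (16 / 10) * u" using L lu ln2_le ln5_ge u by linarith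
    show "1000 \<le> (1 / 60) * u ^ 8" "208 * (16 / 10) * u \<le> (1 / 60) * u ^ 8" using le[of 0 8 100000] le[of 1 8 100000] by simp_all
    show "6 * (16 / 10) * (1 / 60) * 1430000 * u ^ (8 + 103 + 1) + 12 * (16 / 10) * ((1 / 60))\<^sup>2 * u ^ (2 * 8 + 1) \<le> u ^ 120"
      using le[of 112 120 457600] le[of 17 120 "4 / 375"] by (simp add: power_divide)
  qed
  have "real m * ln 3 \<le> cost ((16 / 10) * u) ((1 / 60) * u ^ 8) (1430000 * u ^ 103) m"
  proof (rule step3[OF _ a2])
    have "X + Y = min X Y + max X Y" by (simp add: min_def max_def)
    moreover have "2 * u ^ 0 \<le> u ^ 103" "52100 * u ^ 82 \<le> u ^ 103" by (rule le; simp)+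
    ultimately show "2 + X + Y \<le> 1430000 * u ^ 103" using mn mx unfolding power_0 by linarith
  qed
  also have "\<dots> \<le> 450000 * u ^ 114"
  proof -
    have "cost ((16 / 10) * u) ((1 / 60) * u ^ 8) (1430000 * u ^ 103) m = 26 * ((16 / 10))\<^sup>2 * (121 / 100 * (1 / 60) * 1430000) * u ^ (8 + 103 + 2)
        + 26 * ((16 / 10))\<^sup>2 * (145 / 100 * ((1 / 60))\<^sup>2) * u ^ (2 * 8 + 2) + 26 * ((16 / 10))\<^sup>2 * (55 / ((1 / 60))) * u ^ (120 - 8 + 2)"
      by (rule cost_monomial[OF m]) (use u0 in auto)
    then show ?thesis using le[of 113 114 10] le[of 18 114 1000000000] le[of 0 114 1000] zero_less_power[OF u0, of 114] by (simp add: power_divide)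
  qed
  also have "450000 * u ^ 114 < u ^ 120 * (109 / 100)"
  proof -
    have "1000000 * u ^ 114 \<le> u ^ 120" by (rule le) auto
    moreover have "u ^ 114 > 0" using u0 by simp
    ultimately show ?thesis by linarith
  qed
  also have "u ^ 120 * (109 / 100) \<le> real m * ln 3" unfolding m using ln3_bounds u0 by (intro mult_left_mono) auto
  finally show False by simp
qed

text \<open>The bound 300 is supplied by the first reduction. It makes the height in the second form
  constant, so \<open>x\<close> near m^(1/3) serves already there, and one form fewer is
  needed.\<close>

lemma m_bound_2:
  assumes mn: "min X Y \<le> 300"
  shows "real m < 10 ^ 51"
proof (rule ccontr)
  assume "\<not> ?thesis"
  then have "10 ^ 51 \<le> real m" by (rule leI)
  then obtain u where u: "u \<ge> 10" and m: "real m = u ^ 51" by (rule root_power) auto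
  have lu: "ln u \<le> 234 / 1000 * u" using u by (rule ln_le_linear)
  have u0: "u > 0" using u by simp
  note le = monomial_le[OF u]
  have a0: "admissible ((345 / 100) * u) (2 * u ^ 17) (302 * u ^ 0) m"
  proof (rule admissible_monomial[OF m])
    have L: "ln (2 * u ^ 17) = ln 2 + 17 * ln u" using u0 by (simp add: ln_mult ln_realpow)
    show "8 / 10 * ln (2 * u ^ 17) + 201 / 100 \<le> (345 / 100) * u" using L lu ln2_le ln5_ge u by linarith
    show "1000 \<le> 2 * u ^ 17" "208 * (345 / 100) * u \<le> 2 * u ^ 17" using le[of 0 17 100000] le[of 1 17 100000] by simp_all
    show "6 * (345 / 100) * 2 * 302 * u ^ (17 + 0 + 1) + 12 * (345 / 100) * (2)\<^sup>2 * u ^ (2 * 17 + 1) \<le> u ^ 51"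
      using le[of 18 51 "125028 / 5"] le[of 35 51 "1656 / 5"] by (simp add: power_divide)
  qed
  have "max X Y \<le> cost ((345 / 100) * u) (2 * u ^ 17) (302 * u ^ 0) m + 2"
    using step2[of 302 "345 / 100 * u" "2 * u ^ 17"] a0 mn by simp
  also have "\<dots> \<le> 10400 * u ^ 36"
  proof -
    have "cost ((345 / 100) * u) (2 * u ^ 17) (302 * u ^ 0) m = 26 * ((345 / 100))\<^sup>2 * (121 / 100 * 2 * 302) * u ^ (17 + 0 + 2)
        + 26 * ((345 / 100))\<^sup>2 * (145 / 100 * (2)\<^sup>2) * u ^ (2 * 17 + 2) + 26 * ((345 / 100))\<^sup>2 * (55 / (2)) * u ^ (51 - 17 + 2)"
      by (rule cost_monomial[OF m]) (use u0 in auto)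
    then show ?thesis using le[of 19 36 1000000000] le[of 0 36 1000] zero_less_power[OF u0, of 36] by (simp add: power_divide)
  qed
  finally have mx: "max X Y \<le> 10400 * u ^ 36" .
  have a1: "admissible ((152 / 100) * u) ((1 / 5) * u ^ 7) (10500 * u ^ 36) m"
  proof (rule admissible_monomial[OF m])
    have L: "ln (1 / 5 * u ^ 7) = 7 * ln u - ln 5" using u0 by (simp add: ln_realpow ln_div)
    show "8 / 10 * ln ((1 / 5) * u ^ 7) + 201 / 100 \<le> (152 / 100) * u" using L lu ln2_le ln5_ge u by linarith
    show "1000 \<le> (1 / 5) * u ^ 7" "208 * (152 / 100) * u \<le> (1 / 5) * u ^ 7" using le[of 0 7 100000] le[of 1 7 100000] by simp_all
    show "6 * (152 / 100) * (1 / 5) * 10500 * u ^ (7 + 36 + 1) + 12 * (152 / 100) * ((1 / 5))\<^sup>2 * u ^ (2 * 7 + 1) \<le> u ^ 51"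
      using le[of 44 51 38304] le[of 15 51 "912 / 625"] by (simp add: power_divide)
  qed
  have "real m * ln 3 \<le> cost ((152 / 100) * u) ((1 / 5) * u ^ 7) (10500 * u ^ 36) m"
  proof (rule step3[OF _ a1])
    have "X + Y = min X Y + max X Y" by (simp add: min_def max_def)
    moreover have "302 * u ^ 0 \<le> u ^ 36" by (rule le) auto
    ultimately show "2 + X + Y \<le> 10500 * u ^ 36" using mn mx unfolding power_0 by linarith
  qed
  also have "\<dots> \<le> 40000 * u ^ 46"
  proof -
    have "cost ((152 / 100) * u) ((1 / 5) * u ^ 7) (10500 * u ^ 36) m = 26 * ((152 / 100))\<^sup>2 * (121 / 100 * (1 / 5) * 10500) * u ^ (7 + 36 + 2)
        + 26 * ((152 / 100))\<^sup>2 * (145 / 100 * ((1 / 5))\<^sup>2) * u ^ (2 * 7 + 2) + 26 * ((152 / 100))\<^sup>2 * (55 / ((1 / 5))) * u ^ (51 - 7 + 2)"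
      by (rule cost_monomial[OF m]) (use u0 in auto)
    then show ?thesis using le[of 45 46 10] le[of 16 46 1000000000] le[of 0 46 1000] zero_less_power[OF u0, of 46] by (simp add: power_divide)
  qed
  also have "40000 * u ^ 46 < u ^ 51 * (109 / 100)"
  proof -
    have "100000 * u ^ 46 \<le> u ^ 51" by (rule le) auto
    moreover have "u ^ 46 > 0" using u0 by simp
    ultimately show ?thesis by linarith
  qed
  also have "u ^ 51 * (109 / 100) \<le> real m * ln 3" unfolding m using ln3_bounds u0 by (intro mult_left_mono) auto
  finally show False by simp
qed

text \<open>With both heights bounded only the full form is left: \<open>x\<close> of order u^6
  gives a cost of order u^14 against m = u^18.\<close>

lemma m_bound_3:
  assumes XY: "X \<le> 140" "Y \<le> 140"
  shows "real m < 10 ^ 18"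
proof (rule ccontr)
  assume "\<not> ?thesis"
  then have "10 ^ 18 \<le> real m" by (rule leI)
  then obtain u where u: "u \<ge> 10" and m: "real m = u ^ 18" by (rule root_power) auto
  have lu: "ln u \<le> 234 / 1000 * u" using u by (rule ln_le_linear)
  have u0: "u > 0" using u by simp
  note le = monomial_le[OF u]
  have a0: "admissible ((139 / 100) * u) (2 * u ^ 6) (282 * u ^ 0) m"
  proof (rule admissible_monomial[OF m])
    have L: "ln (2 * u ^ 6) = ln 2 + 6 * ln u" using u0 by (simp add: ln_mult ln_realpow)
    show "8 / 10 * ln (2 * u ^ 6) + 201 / 100 \<le> (139 / 100) * u" using L lu ln2_le ln5_ge u by linarith
    show "1000 \<le> 2 * u ^ 6" "208 * (139 / 100) * u \<le> 2 * u ^ 6" using le[of 0 6 100000] le[of 1 6 100000] by simp_all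
    show "6 * (139 / 100) * 2 * 282 * u ^ (6 + 0 + 1) + 12 * (139 / 100) * (2)\<^sup>2 * u ^ (2 * 6 + 1) \<le> u ^ 18"
      using le[of 7 18 "235188 / 25"] le[of 13 18 "3336 / 25"] by (simp add: power_divide)
  qed
  have "real m * ln 3 \<le> cost ((139 / 100) * u) (2 * u ^ 6) (282 * u ^ 0) m"
    using step3[of 282 "139 / 100 * u" "2 * u ^ 6"] a0 XY by simp
  also have "\<dots> \<le> 2000 * u ^ 14"
  proof -
    have "cost ((139 / 100) * u) (2 * u ^ 6) (282 * u ^ 0) m = 26 * ((139 / 100))\<^sup>2 * (121 / 100 * 2 * 282) * u ^ (6 + 0 + 2)
        + 26 * ((139 / 100))\<^sup>2 * (145 / 100 * (2)\<^sup>2) * u ^ (2 * 6 + 2) + 26 * ((139 / 100))\<^sup>2 * (55 / (2)) * u ^ (18 - 6 + 2)"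
      by (rule cost_monomial[OF m]) (use u0 in auto)
    then show ?thesis using le[of 8 14 1000000] le[of 0 14 1000] zero_less_power[OF u0, of 14] by (simp add: power_divide)
  qed
  also have "2000 * u ^ 14 < u ^ 18 * (109 / 100)"
  proof -
    have "10000 * u ^ 14 \<le> u ^ 18" by (rule le) auto
    moreover have "u ^ 14 > 0" using u0 by simp
    ultimately show ?thesis by linarith
  qed
  also have "u ^ 18 * (109 / 100) \<le> real m * ln 3" unfolding m using ln3_bounds u0 by (intro mult_left_mono) auto
  finally show False by simp
qed

end

section \<open>Fixed-point logarithms\<close>

text \<open>Schoolbook long division by a small divisor, linear in the length of the dividend; the code
  equations of \<open>div\<close> on \<open>int\<close> are quadratic.\<close>

fun divs :: "num \<Rightarrow> int \<Rightarrow> int \<times> int" where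
  "divs num.One d = (if d \<le> 1 then (1, 1 - d) else (0, 1))"
| "divs (num.Bit0 n) d = (case divs n d of (q, r) \<Rightarrow>
     let r' = Int.dup r in if d \<le> r' then (Int.dup q + 1, r' - d) else (Int.dup q, r'))"
| "divs (num.Bit1 n) d = (case divs n d of (q, r) \<Rightarrow>
     let r' = Int.dup r + 1 in if d \<le> r' then (Int.dup q + 1, r' - d) else (Int.dup q, r'))"

lemma divs_invariant:
  assumes "d > 0"
  shows "numeral n = fst (divs n d) * d + snd (divs n d) \<and> 0 \<le> snd (divs n d) \<and> snd (divs n d) < d"
proof (induction n)
  case One
  then show ?case using assms by auto
next
  case (Bit0 n)
  obtain q r where qr: "divs n d = (q, r)" by (cases "divs n d")
  have IH: "numeral n = q * d + r" "0 \<le> r" "r < d" using Bit0 unfolding qr by simp_all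
  show ?case unfolding divs.simps qr Let_def prod.case numeral_Bit0[of n] IH(1) Int.dup_def
    using IH(2,3) by (cases "d \<le> r + r") (simp_all add: distrib_right)
next
  case (Bit1 n)
  obtain q r where qr: "divs n d = (q, r)" by (cases "divs n d")
  have IH: "numeral n = q * d + r" "0 \<le> r" "r < d" using Bit1 unfolding qr by simp_all
  show ?case unfolding divs.simps qr Let_def prod.case numeral_Bit1[of n] IH(1) Int.dup_def
    using IH(2,3) by (cases "d \<le> r + r + 1") (simp_all add: distrib_right)
qed

text \<open>A copy of \<open>div\<close> with code equations of its own, so that evaluation uses the
  long division.\<close>

definition idiv :: "int \<Rightarrow> int \<Rightarrow> int" where "idiv x d = x div d"

lemma idiv_code [code]:
  "idiv 0 d = 0"
  "idiv (Int.Pos n) d = (if d > 0 then fst (divs n d) else Int.Pos n div d)"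
  "idiv (Int.Neg n) d = Int.Neg n div d"
proof -
  show "idiv 0 d = 0" "idiv (Int.Neg n) d = Int.Neg n div d" by (simp_all add: idiv_def)
  show "idiv (Int.Pos n) d = (if d > 0 then fst (divs n d) else Int.Pos n div d)"
    using divs_invariant[of d n] int_div_pos_eq[of "numeral n" d "fst (divs n d)" "snd (divs n d)"]
    by (auto simp: idiv_def mult.commute)
qed

fun shrs :: "nat \<Rightarrow> num \<Rightarrow> int" where
  "shrs 0 n = Int.Pos n"
| "shrs (Suc g) num.One = 0"
| "shrs (Suc g) (num.Bit0 n) = shrs g n"
| "shrs (Suc g) (num.Bit1 n) = shrs g n"

lemma shrs_eq: "shrs g n = numeral n div 2 ^ g"
proof (induction g n rule: shrs.induct)
  case (2 g)
  have "1 < (2::int) ^ Suc g" by (rule one_less_power) auto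
  then show ?case by (simp add: div_pos_pos_trivial)
next
  case (3 g n)
  have "numeral (num.Bit0 n) div (2 * 2 ^ g) = (numeral (num.Bit0 n) div 2) div (2 ^ g :: int)"
    by (rule zdiv_zmult2_eq) simp
  then show ?case using 3 by simp
next
  case (4 g n)
  have "numeral (num.Bit1 n) div (2 * 2 ^ g) = (numeral (num.Bit1 n) div 2) div (2 ^ g :: int)"
    by (rule zdiv_zmult2_eq) simp
  then show ?case using 4 by simp
qed simp_all

definition ishr :: "nat \<Rightarrow> int \<Rightarrow> int" where "ishr g x = x div 2 ^ g"

lemma ishr_code [code]:
  "ishr g 0 = 0" "ishr g (Int.Pos n) = shrs g n" "ishr g (Int.Neg n) = Int.Neg n div 2 ^ g"
  by (simp_all add: ishr_def shrs_eq)

fun lows :: "nat \<Rightarrow> num \<Rightarrow> int" where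
  "lows 0 n = 0"
| "lows (Suc g) num.One = 1"
| "lows (Suc g) (num.Bit0 n) = Int.dup (lows g n)"
| "lows (Suc g) (num.Bit1 n) = Int.dup (lows g n) + 1"



lemma double_mod:
  fixes a b N :: int
  assumes "0 \<le> b" "b < N"
  shows "(2 * (N * a + b) + 1) mod (2 * N) = 2 * b + 1"
proof -
  have "2 * (N * a + b) + 1 = (2 * b + 1) + a * (2 * N)" by (simp add: algebra_simps)
  then show ?thesis
    unfolding mod_mult_self1 by (simp only: mod_mult_self1, intro mod_pos_pos_trivial) (use assms in linarith)+
qed

lemma lows_eq: "lows g n = numeral n mod 2 ^ g"
proof (induction g n rule: lows.induct)
  case (1 n)
  show ?case by simp
next
  case (2 g)
  have "1 < (2::int) ^ Suc g" by (rule one_less_power) auto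
  then show ?case by simp
next
  case (3 g n)
  have "(numeral (num.Bit0 n) :: int) mod (2 * 2 ^ g) = 2 * (numeral n mod 2 ^ g)"
    by (simp only: numeral_Bit0_eq_double[of n] mult_mod_right)
  then show ?case by (simp only: lows.simps 3 power_Suc Int.dup_def mult_2)
next
  case (4 g n)
  have "(2 * (2 ^ g * (numeral n div 2 ^ g) + numeral n mod 2 ^ g) + 1) mod (2 * 2 ^ g) =
      2 * (numeral n mod 2 ^ g) + (1::int)"
    by (rule double_mod) simp_all
  then have "(2 * numeral n + 1) mod (2 * 2 ^ g) = 2 * (numeral n mod 2 ^ g) + (1::int)"
    by (simp only: mult_div_mod_eq)
  then have "(numeral n + numeral n + 1) mod (2 ^ g + 2 ^ g) = numeral n mod 2 ^ g + numeral n mod 2 ^ g + (1::int)"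
    by (simp only: mult_2)
  then show ?case
    by (simp only: lows.simps 4 power_Suc Int.dup_def mult_2 numeral_Bit1[of n])
qed

definition ilow :: "nat \<Rightarrow> int \<Rightarrow> int" where "ilow g x = x mod 2 ^ g"

lemma ilow_code [code]:
  "ilow g 0 = 0" "ilow g (Int.Pos n) = lows g n" "ilow g (Int.Neg n) = Int.Neg n mod 2 ^ g"
  by (simp_all add: ilow_def lows_eq)

section \<open>Certified enclosures of ln phi, ln 3 and ln 5\<close>

text \<open>Numerator and denominator, left unreduced, of the sum of 1 / (j_i y^i), so that
  evaluation stays in the integers.\<close>

fun horner :: "int \<Rightarrow> int list \<Rightarrow> int \<times> int" where
  "horner y [] = (0, 1)"
| "horner y (j # js) = (case horner y js of (p, q) \<Rightarrow> let r = q * y in (r + j * p, j * r))"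

lemma horner_sum:
  assumes "y > 0" "\<forall>j\<in>set js. j > 0"
  shows "snd (horner y js) > 0 \<and>
    of_int (fst (horner y js)) / of_int (snd (horner y js)) = (\<Sum>i<length js. 1 / (of_int (js ! i) * of_int y ^ i) :: real)"
  using assms(2)
proof (induction js)
  case (Cons j js)
  obtain p q where pq: "horner y js = (p, q)" by (cases "horner y js")
  have IH: "q > 0" "of_int p / of_int q = (\<Sum>i<length js. 1 / (of_int (js ! i) * of_int y ^ i) :: real)"
    using Cons by (simp_all add: pq)
  have "j > 0" using Cons.prems by simp
  have "(\<Sum>i<length (j # js). 1 / (of_int ((j # js) ! i) * of_int y ^ i) :: real) =
      1 / of_int j + (\<Sum>i<length js. 1 / (of_int (js ! i) * (of_int y * of_int y ^ i)))"
    by (simp only: length_Cons sum.lessThan_Suc_shift nth_Cons_0 nth_Cons_Suc power_0 power_Suc mult_1_right)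
  also have "(\<Sum>i<length js. 1 / (of_int (js ! i) * (of_int y * of_int y ^ i)) :: real) = (of_int p / of_int q) / of_int y"
    unfolding IH(2) sum_divide_distrib by (intro sum.cong) (auto simp: mult_ac)
  also have "1 / of_int j + of_int p / of_int q / of_int y = (of_int (q * y + j * p) / of_int (j * (q * y)) :: real)"
    using IH(1) \<open>j > 0\<close> assms(1) by (simp add: add_divide_distrib)
  finally show ?case using IH(1) \<open>j > 0\<close> assms(1)
    by (simp only: pq horner.simps Let_def prod.case fst_conv snd_conv) simp
qed simp

text \<open>The series is ln ((x + 1) / (x - 1)) = 2 (1 / x + 1 / (3 x^3) + ...). \<open>L\<close>
  is \<open>Z\<close> times the partial sum rounded down, and
  \<open>3 * Z \<le> x ^ (2 * n + 1)\<close> keeps the scaled tail at most 1.\<close>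

definition log_cert :: "int \<Rightarrow> nat \<Rightarrow> int \<Rightarrow> int \<Rightarrow> bool" where
  "log_cert x n Z L \<longleftrightarrow> (case horner (x * x) (map (\<lambda>i. 2 * int i + 1) [0..<n]) of (p, q) \<Rightarrow>
     let u = q * x; r = 2 * Z * p - L * u in 0 \<le> r \<and> r < u \<and> 3 * Z \<le> x ^ (2 * n + 1))"

lemma log_cert:
  assumes "log_cert x n Z L" "x \<ge> 3" "Z > 0"
  shows "\<bar>of_int Z * ln ((of_int x + 1) / (of_int x - 1)) - of_int L\<bar> \<le> (2::real)"
proof -
  define w where "w = (of_int x :: real)"
  have w: "w \<ge> 3" using assms(2) by (simp add: w_def)
  define js where "js = map (\<lambda>i. 2 * int i + 1) [0..<n]"
  obtain p q where pq: "horner (x * x) js = (p, q)" by (cases "horner (x * x) js")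
  have h: "q > 0" "of_int p / of_int q = (\<Sum>i<n. 1 / (of_int (js ! i) * of_int (x * x) ^ i) :: real)"
    using horner_sum[of "x * x" js] assms(2) pq by (auto simp: js_def)
  have c: "0 \<le> 2 * Z * p - L * (q * x)" "2 * Z * p - L * (q * x) < q * x" "3 * Z \<le> x ^ (2 * n + 1)"
    using assms(1) pq by (auto simp: log_cert_def Let_def js_def)
  define y where "y = (w + 1) / (w - 1)"
  have y: "y > 1" "(y - 1) / (y + 1) = 1 / w" using w by (simp_all add: y_def field_simps)
  define d where "d = (1 / w) ^ (2 * n + 1) / (1 - (1 / w)\<^sup>2) / of_nat (2 * n + 1)"
  have "ln y \<in> {\<Sum>i<n. 2 * (1 / w) ^ (2 * i + 1) / of_nat (2 * i + 1)..
       (\<Sum>i<n. 2 * (1 / w) ^ (2 * i + 1) / of_nat (2 * i + 1)) + 2 * d}"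
    using ln_approx_bounds[OF y(1), of n] unfolding y(2) d_def .
  also have "(\<Sum>i<n. 2 * (1 / w) ^ (2 * i + 1) / of_nat (2 * i + 1)) = 2 / w * (of_int p / of_int q)"
    unfolding h(2) sum_distrib_left
    by (intro sum.cong refl) (simp add: js_def w_def power_mult power2_eq_square power_divide power_mult_distrib mult_ac)
  finally have b: "2 / w * (of_int p / of_int q) \<le> ln y" "ln y \<le> 2 / w * (of_int p / of_int q) + 2 * d" by auto
  have Z: "real_of_int Z > 0" using assms(3) by simp
  have q: "real_of_int q > 0" using h by simp
  have "of_int L \<le> of_int Z * (2 / w * (of_int p / of_int q))"
  proof -
    have "real_of_int (L * (q * x)) \<le> real_of_int (2 * Z * p)" using c(1) by (simp only: of_int_le_iff)
    then show ?thesis using q w by (simp add: field_simps w_def)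
  qed
  moreover have "of_int Z * (2 / w * (of_int p / of_int q)) \<le> of_int L + 1"
  proof -
    have "real_of_int (2 * Z * p) \<le> real_of_int ((L + 1) * (q * x))" using c(2) by (simp only: of_int_le_iff) (simp add: algebra_simps)
    then show ?thesis using q w by (simp add: field_simps w_def)
  qed
  moreover have "of_int Z * (2 * d) \<le> 1"
  proof -
    have "(1 / w)\<^sup>2 \<le> (1 / 3)\<^sup>2" by (rule power_mono) (use w in \<open>auto simp: field_simps\<close>)
    then have "1 - (1 / w)\<^sup>2 \<ge> 2 / 3" by (simp add: power_divide)
    then have "d \<le> (1 / w) ^ (2 * n + 1) / (2 / 3) / 1"
      unfolding d_def by (intro divide_right_mono frac_le) (use w in auto)
    then have "of_int Z * (2 * d) \<le> of_int Z * (2 * ((1 / w) ^ (2 * n + 1) / (2 / 3) / 1))"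
      using Z by (intro mult_left_mono) auto
    then have "of_int Z * (2 * d) \<le> 3 * of_int Z * (1 / w) ^ (2 * n + 1)" by (simp add: mult_ac)
    moreover have "real_of_int (3 * Z) \<le> of_int (x ^ (2 * n + 1))" using c(3) by (simp only: of_int_le_iff)
    then have "3 * of_int Z * (1 / w) ^ (2 * n + 1) \<le> 1"
      using w by (simp add: w_def[symmetric] power_divide field_simps)
    ultimately show ?thesis by simp
  qed
  moreover have "of_int Z * (2 / w * (of_int p / of_int q)) \<le> of_int Z * ln y"
    "of_int Z * ln y \<le> of_int Z * (2 / w * (of_int p / of_int q)) + of_int Z * (2 * d)"
    using mult_left_mono[OF b(1), of "of_int Z"] mult_left_mono[OF b(2), of "of_int Z"] Z
    by (simp_all only: distrib_left less_imp_le)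
  ultimately have "\<bar>of_int Z * ln y - of_int L\<bar> \<le> 2" by (simp only: abs_le_iff) linarith
  then show ?thesis by (simp add: y_def w_def)
qed

text \<open>The tail is dominated by a geometric series of ratio at most 2/3, hence the factor
  3.\<close>

lemma neg_ln_approx:
  fixes t :: real
  assumes "0 \<le> t" "t \<le> 2 / 3"
  shows "(\<Sum>j<J. t ^ (j + 1) / real (j + 1)) \<le> - ln (1 - t)"
    "- ln (1 - t) \<le> (\<Sum>j<J. t ^ (j + 1) / real (j + 1)) + 3 * t ^ (J + 1)"
proof -
  have "(\<lambda>n. - ((- (- t)) ^ n) / of_nat n) sums ln (1 + - t)"
    by (rule ln_series') (use assms in simp)
  then have "(\<lambda>n. - (- ((- (- t)) ^ n) / of_nat n)) sums (- ln (1 - t))"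
    using sums_minus by fastforce
  then have "(\<lambda>n. t ^ n / real n) sums (- ln (1 - t))" by simp
  then have s: "(\<lambda>n. t ^ (n + 1) / real (n + 1)) sums (- ln (1 - t))"
    using sums_Suc_iff[of "\<lambda>n. t ^ n / real n" "- ln (1 - t)"] by simp
  then have "(\<lambda>n. t ^ (n + J + 1) / real (n + J + 1)) sums (- ln (1 - t) - (\<Sum>j<J. t ^ (j + 1) / real (j + 1)))"
    using sums_iff_shift[of "\<lambda>n. t ^ (n + 1) / real (n + 1)" J] by simp
  note tail = this
  show "(\<Sum>j<J. t ^ (j + 1) / real (j + 1)) \<le> - ln (1 - t)"
    using sums_le[OF _ sums_zero tail] assms(1) by simp
  have g: "(\<lambda>n. t ^ (J + 1) * t ^ n) sums (t ^ (J + 1) * (1 / (1 - t)))"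
    by (intro sums_mult geometric_sums) (use assms in auto)
  have "- ln (1 - t) - (\<Sum>j<J. t ^ (j + 1) / real (j + 1)) \<le> t ^ (J + 1) * (1 / (1 - t))"
  proof (rule sums_le[OF _ tail g])
    fix n
    have "t ^ (n + J + 1) / real (n + J + 1) \<le> t ^ (n + J + 1) / 1"
      by (intro divide_left_mono) (use assms in auto)
    also have "\<dots> = t ^ (J + 1) * t ^ n" by (simp add: power_add mult_ac)
    finally show "t ^ (n + J + 1) / real (n + J + 1) \<le> t ^ (J + 1) * t ^ n" .
  qed
  also have "\<dots> \<le> t ^ (J + 1) * 3" by (intro mult_left_mono) (use assms in \<open>auto simp: field_simps\<close>)
  finally show "- ln (1 - t) \<le> (\<Sum>j<J. t ^ (j + 1) / real (j + 1)) + 3 * t ^ (J + 1)" by simp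
qed

text \<open>The list runs from index \<open>n + 1\<close> down to \<open>0\<close>. With \<open>c = u + 1 / u\<close> its entries are
  proportional to \<open>u ^ i - u ^ (- i)\<close>, so their ratios to the first one approximate the powers of
  \<open>1 / u\<close> by rationals with a common denominator.\<close>

fun lucseq :: "int \<Rightarrow> nat \<Rightarrow> int list" where
  "lucseq c 0 = [1, 0]"
| "lucseq c (Suc n) = (case lucseq c n of (a # b # ws) \<Rightarrow> (c * a - b) # a # b # ws | ws \<Rightarrow> ws)"

fun harm_sum :: "int \<Rightarrow> int \<Rightarrow> int list \<Rightarrow> int" where
  "harm_sum M j [] = 0"
| "harm_sum M j (w # ws) = idiv M j * w + harm_sum M (j + 1) ws"

lemma lucseq_nth:
  assumes "u \<noteq> 0" "u \<noteq> 1" "u \<noteq> - 1" "real_of_int c = u + 1 / u"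
  shows "length (lucseq c n) = n + 2 \<and>
    (\<forall>i<n + 2. real_of_int (lucseq c n ! i) * (u - 1 / u) = u ^ (n + 1 - i) - (1 / u) ^ (n + 1 - i))"
proof (induction n)
  case 0
  then show ?case using assms(4) by (auto simp: less_Suc_eq)
next
  case (Suc n)
  obtain a b ws where w: "lucseq c n = a # b # ws"
    using Suc by (cases "lucseq c n"; cases "tl (lucseq c n)") auto
  have len: "length ws = n" using Suc w by simp
  have nth: "real_of_int (lucseq c n ! i) * (u - 1 / u) = u ^ (n + 1 - i) - (1 / u) ^ (n + 1 - i)" if "i < n + 2" for i
    using Suc that by blast
  have ab: "real_of_int a * (u - 1 / u) = u ^ (n + 1) - (1 / u) ^ (n + 1)" "real_of_int b * (u - 1 / u) = u ^ n - (1 / u) ^ n"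
    using nth[of 0] nth[of 1] by (simp_all add: w)
  have "real_of_int (c * a - b) * (u - 1 / u) = (u + 1 / u) * (real_of_int a * (u - 1 / u)) - real_of_int b * (u - 1 / u)"
    using assms(4) by (simp add: algebra_simps)
  also have "\<dots> = u ^ (n + 2) - (1 / u) ^ (n + 2) + u * (1 / u) * ((u ^ n) - (1 / u) ^ n) - (u ^ n - (1 / u) ^ n)"
  proof -
    have "(u + v) * (u ^ (n + 1) - v ^ (n + 1)) - (u ^ n - v ^ n) =
        u ^ (n + 2) - v ^ (n + 2) + u * v * (u ^ n - v ^ n) - (u ^ n - v ^ n)" for v
      by (simp add: algebra_simps)
    then show ?thesis unfolding ab .
  qed
  also have "\<dots> = u ^ (n + 2) - (1 / u) ^ (n + 2)" using assms(1) by simp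
  finally have c: "real_of_int (c * a - b) * (u - 1 / u) = u ^ (n + 2) - (1 / u) ^ (n + 2)" .
  have "real_of_int (lucseq c (Suc n) ! i) * (u - 1 / u) = u ^ (Suc n + 1 - i) - (1 / u) ^ (Suc n + 1 - i)"
    if "i < Suc n + 2" for i
  proof (cases i)
    case 0
    then show ?thesis using c by (simp add: w)
  next
    case (Suc i')
    then show ?thesis using nth[of i'] that by (simp add: w)
  qed
  then show ?case using len by (simp add: w)
qed

lemma harm_sum_eq:
  assumes "\<And>i. i < length ws \<Longrightarrow> ws ! i = 0 \<or> (j + int i) dvd M" "j > 0"
  shows "real_of_int (harm_sum M j ws) = of_int M * (\<Sum>i<length ws. of_int (ws ! i) / real_of_int (j + int i))"
  using assms
proof (induction ws arbitrary: j)
  case (Cons w ws)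
  have "real_of_int (harm_sum M (j + 1) ws) = of_int M * (\<Sum>i<length ws. of_int (ws ! i) / real_of_int (j + 1 + int i))"
  proof (rule Cons.IH)
    fix i assume "i < length ws"
    then show "ws ! i = 0 \<or> (j + 1 + int i) dvd M" using Cons.prems(1)[of "Suc i"] by (simp add: add_ac)
  qed (use Cons.prems in simp)
  moreover have "real_of_int (idiv M j * w) = of_int M * (of_int w / of_int j)"
  proof (cases "w = 0")
    case False
    then have "j dvd M" using Cons.prems(1)[of 0] by simp
    then show ?thesis by (simp add: idiv_def real_of_int_div)
  qed simp
  ultimately show ?case
    by (simp only: harm_sum.simps of_int_add length_Cons sum.lessThan_Suc_shift nth_Cons_0 nth_Cons_Suc distrib_left of_nat_0
       add_0_right of_nat_Suc) (simp add: add_ac)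
qed simp

text \<open>In the series of - ln (1 - t) with t = 1 / u, each power of t is replaced by a ratio of
  entries of \<open>lucseq\<close>, at an error of 2 t^(J+1). With the tail this makes (2 J + 3)
  t^(J+1), at most 1 after scaling by \<open>Z\<close>; rounding adds another 1.\<close>

lemma log_phi24_cert:
  fixes u :: real and Z L M w :: int
  assumes u: "real_of_int c = u + 1 / u" "u \<ge> real_of_int v" "v \<ge> 3"
    and ws: "lucseq c J = w # ws"
    and M: "\<forall>j\<in>{1..J}. int j dvd M" "M > 0"
    and cert: "0 \<le> Z * harm_sum M 1 ws - L * (M * w)" "Z * harm_sum M 1 ws - L * (M * w) < M * w"
    and Z: "(2 * int J + 3) * Z \<le> v ^ (J + 1)" "Z > 0"
  shows "\<bar>of_int Z * (- ln (1 - 1 / u)) - of_int L\<bar> \<le> 2"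
proof -
  define t where "t = 1 / u"
  have u3: "u \<ge> 3" using u(2,3) by linarith
  have t: "0 < t" "t \<le> 1 / 3" "u * t = 1" using u3 by (auto simp: t_def field_simps)
  have tn: "u ^ n * t ^ n = 1" for n using t(3) by (metis power_mult_distrib power_one)
  have ut: "u - t > 0" using u3 t(2) by linarith
  have "u \<noteq> 0" "u \<noteq> 1" "u \<noteq> - 1" using u3 by linarith+
  note L = lucseq_nth[OF this u(1), of J, folded t_def]
  have nth: "real_of_int ((w # ws) ! i) * (u - t) = u ^ (J + 1 - i) - t ^ (J + 1 - i)" if "i < J + 2" for i
    using L that unfolding ws by blast
  have len: "length ws = J + 1" using L unfolding ws by simp
  have w0: "real_of_int w * (u - t) = u ^ (J + 1) - t ^ (J + 1)" using nth[of 0] by simp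
  have "u ^ 1 \<le> u ^ (J + 1)" by (rule power_increasing) (use u3 in auto)
  then have u1: "u ^ (J + 1) \<ge> 3" using u3 by (simp only: power_one_right)
  have t1: "t ^ (J + 1) \<le> 1" using t by (intro power_le_one) auto
  have wl: "u ^ (J + 1) / 2 \<le> real_of_int w * (u - t)" using w0 u1 t1 by linarith
  then have "real_of_int w * (u - t) > 0" using u1 by linarith
  then have w: "real_of_int w > 0" using ut by (simp add: zero_less_mult_iff)
  have ratio: "\<bar>real_of_int (ws ! i) - t ^ (i + 1) * w\<bar> \<le> 2 * t ^ (J + 1) * w" if "i < J" for i
  proof -
    have ni: "real_of_int (ws ! i) * (u - t) = u ^ (J - i) - t ^ (J - i)" using nth[of "Suc i"] that by simp
    have s1: "t ^ (i + 1) * u ^ (J + 1) = u ^ (J - i)"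
    proof -
      have "u ^ (J + 1) = u ^ (i + 1) * u ^ (J - i)" using that by (simp flip: power_add)
      then have "t ^ (i + 1) * u ^ (J + 1) = (u ^ (i + 1) * t ^ (i + 1)) * u ^ (J - i)" by (simp only: mult_ac)
      then show ?thesis unfolding tn by simp
    qed
    have "(a - b * c) * e = a * e - b * (c * e)" for a b c e :: real by (simp add: algebra_simps)
    then have "(real_of_int (ws ! i) - t ^ (i + 1) * w) * (u - t) = real_of_int (ws ! i) * (u - t) - t ^ (i + 1) * (w * (u - t))" .
    also have "\<dots> = t ^ (i + 1) * t ^ (J + 1) - t ^ (J - i)" unfolding ni w0 unfolding right_diff_distrib s1 by simp
    finally have e: "(real_of_int (ws ! i) - t ^ (i + 1) * w) * (u - t) = t ^ (i + 1) * t ^ (J + 1) - t ^ (J - i)" .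
    have b: "0 \<le> t ^ (i + 1) * t ^ (J + 1)" "t ^ (i + 1) * t ^ (J + 1) \<le> 1" "0 \<le> t ^ (J - i)" "t ^ (J - i) \<le> 1"
      using t by (auto intro!: power_le_one mult_le_one simp del: power_Suc)
    then have "\<bar>(real_of_int (ws ! i) - t ^ (i + 1) * w) * (u - t)\<bar> \<le> 1"
      unfolding e by linarith
    also have "1 = 2 * t ^ (J + 1) * (u ^ (J + 1) / 2)" using tn[of "J + 1"] by (simp add: mult_ac)
    also have "\<dots> \<le> 2 * t ^ (J + 1) * (real_of_int w * (u - t))"
      by (intro mult_left_mono wl) (use t in auto)
    finally have "\<bar>real_of_int (ws ! i) - t ^ (i + 1) * w\<bar> * (u - t) \<le> 2 * t ^ (J + 1) * w * (u - t)"
      using ut by (simp only: abs_mult mult.assoc abs_of_pos)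
    then show ?thesis using ut by (simp only: mult_le_cancel_right_pos)
  qed
  have wJ: "ws ! J = 0" using nth[of "Suc J"] ut by simp
  define S where "S = (\<Sum>j<J. t ^ (j + 1) / real (j + 1))"
  define T where "T = (\<Sum>j<J. real_of_int (ws ! j) / real (j + 1))"
  have T: "real_of_int (harm_sum M 1 ws) = of_int M * T"
  proof -
    have "real_of_int (harm_sum M 1 ws) = of_int M * (\<Sum>i<length ws. of_int (ws ! i) / real_of_int (1 + int i))"
    proof (rule harm_sum_eq)
      fix i assume "i < length ws"
      then show "ws ! i = 0 \<or> 1 + int i dvd M"
        using wJ M(1)[rule_format, of "Suc i"] len by (cases "i = J") auto
    qed simp
    then show ?thesis unfolding len T_def by (simp add: wJ)
  qed
  have "\<bar>T - S * w\<bar> \<le> (\<Sum>j<J. 2 * t ^ (J + 1) * w)"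
    unfolding T_def S_def sum_distrib_right sum_subtractf[symmetric]
  proof (rule order.trans[OF sum_abs sum_mono])
    fix j assume j: "j \<in> {..<J}"
    have "\<bar>real_of_int (ws ! j) / real (j + 1) - t ^ (j + 1) / real (j + 1) * w\<bar> =
        \<bar>real_of_int (ws ! j) - t ^ (j + 1) * w\<bar> / real (j + 1)"
      by (simp add: diff_divide_distrib[symmetric])
    also have "\<dots> \<le> \<bar>real_of_int (ws ! j) - t ^ (j + 1) * w\<bar> / 1" by (intro divide_left_mono) auto
    finally show "\<bar>real_of_int (ws ! j) / real (j + 1) - t ^ (j + 1) / real (j + 1) * w\<bar> \<le> 2 * t ^ (J + 1) * w"
      using ratio[of j] j by simp
  qed
  then have TS: "\<bar>T - S * w\<bar> \<le> real J * (2 * t ^ (J + 1)) * w" by simp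
  have l: "S \<le> - ln (1 - t)" "- ln (1 - t) \<le> S + 3 * t ^ (J + 1)"
    unfolding S_def using neg_ln_approx[of t J] t by auto
  define l where "l = - ln (1 - t)"
  have "\<bar>T / w - S\<bar> \<le> real J * (2 * t ^ (J + 1))"
  proof -
    have "\<bar>T / w - S\<bar> * w = \<bar>T - S * w\<bar>" using w by (simp add: abs_mult_pos left_diff_distrib)
    then have "\<bar>T / w - S\<bar> * w \<le> real J * (2 * t ^ (J + 1)) * w" using TS by simp
    then show ?thesis using w by (simp only: mult_le_cancel_right_pos)
  qed
  then have "\<bar>T / w - l\<bar> \<le> real (2 * J + 3) * t ^ (J + 1)"
    using l unfolding l_def[symmetric] by (simp add: algebra_simps abs_le_iff)
  then have "of_int Z * \<bar>T / w - l\<bar> \<le> of_int Z * (real (2 * J + 3) * t ^ (J + 1))"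
    by (intro mult_left_mono) (use Z in auto)
  also have "\<dots> \<le> 1"
  proof -
    have "real_of_int ((2 * int J + 3) * Z) \<le> of_int (v ^ (J + 1))" using Z(1) by (simp only: of_int_le_iff)
    also have "\<dots> = of_int v ^ (J + 1)" by simp
    also have "\<dots> \<le> u ^ (J + 1)" by (rule power_mono) (use u in auto)
    finally have "real_of_int ((2 * int J + 3) * Z) * t ^ (J + 1) \<le> u ^ (J + 1) * t ^ (J + 1)"
      by (intro mult_right_mono) (use t in auto)
    then show ?thesis unfolding tn by (simp add: algebra_simps)
  qed
  finally have A: "\<bar>of_int Z * (T / w) - of_int Z * l\<bar> \<le> 1"
    unfolding right_diff_distrib[symmetric] abs_mult using Z(2) by simp
  have M0: "real_of_int M > 0" using M(2) by simp
  have "real_of_int (L * (M * w)) \<le> real_of_int (Z * harm_sum M 1 ws)" using cert(1) by (simp only: of_int_le_iff)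
  then have "(real_of_int L * real_of_int w) * of_int M \<le> (real_of_int Z * T) * of_int M" by (simp add: T mult_ac)
  then have c1: "real_of_int L * real_of_int w \<le> of_int Z * T" using M0 by (simp only: mult_le_cancel_right_pos)
  have "real_of_int (Z * harm_sum M 1 ws) \<le> real_of_int ((L + 1) * (M * w))" using cert(2)
    by (simp only: of_int_le_iff) (simp add: algebra_simps)
  then have "(real_of_int Z * T) * of_int M \<le> ((real_of_int L + 1) * real_of_int w) * of_int M" by (simp add: T mult_ac)
  then have c2: "real_of_int Z * T \<le> (real_of_int L + 1) * real_of_int w" using M0 by (simp only: mult_le_cancel_right_pos)
  have "of_int L \<le> of_int Z * (T / w)" "of_int Z * (T / w) \<le> of_int L + 1"
    using c1 c2 w by (simp_all add: pos_le_divide_eq pos_divide_le_eq)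
  then have "\<bar>of_int Z * l - of_int L\<bar> \<le> 2" using A by linarith
  then show ?thesis by (simp only: l_def t_def)
qed

text \<open>31, 49 and 161 have 5-smooth neighbours: 32/30, 50/48 and 162/160 involve only the
  primes 2, 3 and 5. The scale 2^832 serves the first reduction, where the product of n and Q has
  about 800 bits.\<close>

definition "LN31 = (1848312505899366139158459292487218124007454261862789827959668620020493327737550026058857036208165498036385222658311026638974890764452758136574929526558427140243029458181590044955756447028930912918414263283838014974802786475461307564980912627340854418 :: int)"

lemma LN31: "log_cert 31 84 (2 ^ 832) LN31" by code_simp

definition "LN49 = (1169097178826098023844292080275694559626948446233853041723628206634690047463417659857773722617268773049429898374881679588772805836129784624557680879051456718079453119388633726697356954659265871558495229584580118035774862342428233840516389145281016551 :: int)"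

lemma LN49: "log_cert 49 74 (2 ^ 832) LN49" by code_simp

definition "LN161 = (355767356664012027374150590793501221760438319042009149910729698245928136061663640192831584328146109459373893806101525427425460454287051270594377414219961077269294048307888253047706242391863625860977451299991712672910182498058880135971279154342557888 :: int)"

lemma LN161: "log_cert 161 57 (2 ^ 832) LN161" by code_simp

definition "LS = (276219999916678277198976175451473076190471725243945816497270839885460993113651538250881284253588504283207157330833569549790739047124013535007511352464626434340781539927125806934886196531955702752195858482222388868548730951725088862068375789463227 :: int)"

text \<open>103682 = phi^24 + phi^(-24) is a Lucas number. Fifty terms suffice because 103681^51
  exceeds 103 * 2^832.\<close>

definition phi24_check :: "int \<Rightarrow> int \<Rightarrow> int \<Rightarrow> bool" where
  "phi24_check Z M L \<longleftrightarrow> (case lucseq 103682 50 of w # ws \<Rightarrow>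
     let r = Z * harm_sum M 1 ws - L * (M * w) in 0 \<le> r \<and> r < M * w | [] \<Rightarrow> False)"

lemma LS: "phi24_check (2 ^ 832) 3099044504245996706400 LS" by code_simp

lemma lcm_check: "list_all (\<lambda>j. int j dvd 3099044504245996706400) [1..<51]" by code_simp

lemma size_check: "(2 * int 50 + 3) * 2 ^ 832 \<le> 103681 ^ (50 + 1)" by code_simp

lemma phi_12: "phi ^ 12 = 144 * phi + 89" and phi_24: "phi ^ 24 = 46368 * phi + 28657"
proof -
  have sq: "(a * phi + b) ^ 2 = (a\<^sup>2 + 2 * a * b) * phi + (a\<^sup>2 + b\<^sup>2)" for a b
  proof -
    have "(a * phi + b) ^ 2 = a\<^sup>2 * (phi * phi) + 2 * a * b * phi + b\<^sup>2" by (simp add: power2_eq_square algebra_simps)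
    then show ?thesis unfolding phi_sq by (simp add: algebra_simps)
  qed
  have "phi ^ 3 = phi * (phi * phi)" by (simp add: power3_eq_cube)
  also have "\<dots> = phi * phi + phi" unfolding phi_sq by (simp add: algebra_simps phi_sq)
  finally have "phi ^ 3 = 2 * phi + 1" using phi_sq by simp
  then have 6: "phi ^ 6 = 8 * phi + 5" using sq[of 2 1] power_mult[of phi 3 2] by simp
  then show 12: "phi ^ 12 = 144 * phi + 89" using sq[of 8 5] power_mult[of phi 6 2] by simp
  then show "phi ^ 24 = 46368 * phi + 28657" using sq[of 144 89] power_mult[of phi 12 2] by simp
qed

lemma phi_inverse_12: "1 / phi ^ 12 = 233 - 144 * phi" and phi_inverse_24: "1 / phi ^ 24 = 75025 - 46368 * phi"
proof -
  have "phi ^ 12 * (233 - 144 * phi) = 1" "phi ^ 24 * (75025 - 46368 * phi) = 1"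
  proof -
    have "(144 * phi + 89) * (233 - 144 * phi) = 20737 + 20736 * phi - 20736 * (phi * phi)"
      "(46368 * phi + 28657) * (75025 - 46368 * phi) = 2149991425 + 2149991424 * phi - 2149991424 * (phi * phi)"
      by (simp_all add: algebra_simps)
    then show "phi ^ 12 * (233 - 144 * phi) = 1" "phi ^ 24 * (75025 - 46368 * phi) = 1"
      unfolding phi_12 phi_24 phi_sq by simp_all
  qed
  moreover have "phi ^ 12 > 0" "phi ^ 24 > 0" using phi_bounds by simp_all
  ultimately show "1 / phi ^ 12 = 233 - 144 * phi" "1 / phi ^ 24 = 75025 - 46368 * phi"
    by (simp_all add: divide_eq_eq mult.commute)
qed

text \<open>phi^12 - phi^(-12) = 144 sqrt 5, so 1 - phi^(-24) = 144 sqrt 5 / phi^12. As F_12 = 144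
  is 2^4 * 3^2, ln phi is reduced to small primes and a rapidly convergent series.\<close>

lemma ln_phi_series: "24 * ln phi = 2 * (- ln (1 - 1 / phi ^ 24)) + 8 * ln 2 + 4 * ln 3 + ln 5"
proof -
  have p: "phi > 0" "phi ^ 12 > 0" using phi_bounds by simp_all
  have "a * (1 - 1 / (a * a)) = a - 1 / a" if "a > 0" for a :: real using that by (simp add: right_diff_distrib)
  from this[OF p(2)] have "phi ^ 12 * (1 - 1 / phi ^ 24) = phi ^ 12 - 1 / phi ^ 12"
    by (simp flip: power_add)
  also have "\<dots> = 144 * sqrt 5" unfolding phi_inverse_12 unfolding phi_12 unfolding phi_def by (simp add: field_simps)
  finally have e: "1 - 1 / phi ^ 24 = 144 * sqrt 5 / phi ^ 12" using p by (simp add: field_simps)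
  have "ln (144 * sqrt 5 / phi ^ 12) = ln (144 * sqrt 5) - 12 * ln phi"
    using p by (simp add: ln_div ln_realpow)
  also have "ln (144 * sqrt 5) = ln 144 + ln 5 / 2" by (simp add: ln_mult_pos ln_sqrt)
  also have "ln (144 :: real) = ln (2 ^ 4 * 3 ^ 2)" by simp
  also have "\<dots> = 4 * ln 2 + 2 * ln 3" by (subst ln_mult_pos) (simp_all only: ln_realpow zero_less_power zero_less_numeral)
  finally show ?thesis unfolding e by simp
qed

text \<open>The exponents of 2, 3, 5 in 16/15, 25/24, 81/80 form a unimodular matrix; the
  coefficients are those of its inverse.\<close>

lemma ln_via_atanh:
  "ln 2 = 7 * ln (32 / 30) + 5 * ln (50 / 48) + 3 * ln (162 / 160 :: real)"
  "ln 3 = 11 * ln (32 / 30) + 8 * ln (50 / 48) + 5 * ln (162 / 160 :: real)"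
  "ln 5 = 16 * ln (32 / 30) + 12 * ln (50 / 48) + 7 * ln (162 / 160 :: real)"
proof -
  have "ln (32 / 30 :: real) = ln (2 ^ 4 / (3 * 5))" "ln (50 / 48 :: real) = ln (5 ^ 2 / (2 ^ 3 * 3))"
    "ln (162 / 160 :: real) = ln (3 ^ 4 / (2 ^ 4 * 5))" by simp_all
  then have "ln (32 / 30 :: real) = 4 * ln 2 - (ln 3 + ln 5)" "ln (50 / 48 :: real) = 2 * ln 5 - (3 * ln 2 + ln 3)"
    "ln (162 / 160 :: real) = 4 * ln 3 - (4 * ln 2 + ln 5)"
    by (simp_all only: ln_divide_pos ln_mult_pos ln_realpow zero_less_power zero_less_numeral mult_pos_pos of_nat_numeral)
  then show "ln 2 = 7 * ln (32 / 30) + 5 * ln (50 / 48) + 3 * ln (162 / 160 :: real)"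
    "ln 3 = 11 * ln (32 / 30) + 8 * ln (50 / 48) + 5 * ln (162 / 160 :: real)"
    "ln 5 = 16 * ln (32 / 30) + 12 * ln (50 / 48) + 7 * ln (162 / 160 :: real)" by linarith+
qed

definition log_enclosure :: "int \<Rightarrow> int \<Rightarrow> int \<Rightarrow> int \<Rightarrow> int \<Rightarrow> bool" where
  "log_enclosure W e bphi b3 b5 \<longleftrightarrow> W > 0 \<and> e \<ge> 0 \<and>
     \<bar>of_int W * (24 * ln phi) - of_int bphi\<bar> \<le> real_of_int e \<and>
     \<bar>of_int W * ln 3 - of_int b3\<bar> \<le> real_of_int e \<and> \<bar>of_int W * ln 5 - of_int b5\<bar> \<le> real_of_int e"

text \<open>The errors of 2 add up to at most 2 (116 + 84 + 51 + 2) = 506, below 600.\<close>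

lemma log_enclosure_fine:
  "log_enclosure (2 ^ 832) 600 (116 * LN31 + 84 * LN49 + 51 * LN161 + 2 * LS) (11 * LN31 + 8 * LN49 + 5 * LN161)
     (16 * LN31 + 12 * LN49 + 7 * LN161)"
proof -
  define Z :: int where "Z = 2 ^ 832"
  have Z: "Z > 0" by (simp add: Z_def)
  define z where "z = real_of_int Z"
  have l: "\<bar>z * ln (32 / 30) - of_int LN31\<bar> \<le> 2" "\<bar>z * ln (50 / 48) - of_int LN49\<bar> \<le> 2"
    "\<bar>z * ln (162 / 160) - of_int LN161\<bar> \<le> 2"
    using log_cert[OF LN31] log_cert[OF LN49] log_cert[OF LN161] Z unfolding z_def Z_def by simp_all
  obtain w ws where ws: "lucseq 103682 50 = w # ws"
    and c: "0 \<le> Z * harm_sum 3099044504245996706400 1 ws - LS * (3099044504245996706400 * w)" "Z * harm_sum 3099044504245996706400 1 ws - LS * (3099044504245996706400 * w) < 3099044504245996706400 * w"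
    using LS unfolding phi24_check_def Z_def by (auto split: list.splits simp: Let_def)
  have g: "phi ^ 24 > 1" using phi_bounds by (intro one_less_power) auto
  have "phi ^ 24 + 1 / phi ^ 24 = 103682" using phi_inverse_24 phi_24 by linarith
  moreover have "1 / phi ^ 24 \<le> 1" using g by (subst divide_le_eq_1_pos) auto
  ultimately have u: "real_of_int 103682 = phi ^ 24 + 1 / phi ^ 24" "phi ^ 24 \<ge> real_of_int 103681" by simp_all
  have m: "\<forall>j\<in>{1..50}. int j dvd 3099044504245996706400"
    using lcm_check by (simp only: list_all_iff set_upt) auto
  have "\<bar>of_int Z * (- ln (1 - 1 / phi ^ 24)) - of_int LS\<bar> \<le> 2"
    by (rule log_phi24_cert[OF u _ ws m _ c size_check[folded Z_def] Z]) simp_all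
  then have s: "\<bar>z * (- ln (1 - 1 / phi ^ 24)) - of_int LS\<bar> \<le> 2" unfolding z_def .
  define k1 k2 k3 ks where "k1 = z * ln (32 / 30)" and "k2 = z * ln (50 / 48)" and "k3 = z * ln (162 / 160)"
    and "ks = z * (- ln (1 - 1 / phi ^ 24))"
  have "z * ln 3 = 11 * k1 + 8 * k2 + 5 * k3" "z * ln 5 = 16 * k1 + 12 * k2 + 7 * k3"
    "z * (24 * ln phi) = 116 * k1 + 84 * k2 + 51 * k3 + 2 * ks"
    unfolding ln_phi_series unfolding ln_via_atanh k1_def k2_def k3_def ks_def by (simp_all only: distrib_left mult.left_commute)
  moreover have "\<bar>116 * k1 + 84 * k2 + 51 * k3 + 2 * ks - (116 * of_int LN31 + 84 * of_int LN49 + 51 * of_int LN161 + 2 * of_int LS)\<bar> \<le> 600"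
    "\<bar>11 * k1 + 8 * k2 + 5 * k3 - (11 * of_int LN31 + 8 * of_int LN49 + 5 * of_int LN161)\<bar> \<le> 600"
    "\<bar>16 * k1 + 12 * k2 + 7 * k3 - (16 * of_int LN31 + 12 * of_int LN49 + 7 * of_int LN161)\<bar> \<le> 600"
    using l s unfolding k1_def[symmetric] k2_def[symmetric] k3_def[symmetric] ks_def[symmetric] by linarith+
  ultimately show ?thesis using Z unfolding log_enclosure_def Z_def[symmetric] z_def[symmetric] by simp
qed

lemma log_enclosure_ishr:
  assumes "log_enclosure (2 ^ (i + j)) e bphi b3 b5" "e \<le> 2 ^ j"
  shows "log_enclosure (2 ^ i) 2 (ishr j bphi) (ishr j b3) (ishr j b5)"
proof -
  have *: "\<bar>2 ^ i * x - of_int (ishr j b)\<bar> \<le> 2" if "\<bar>2 ^ (i + j) * x - of_int b\<bar> \<le> real_of_int e" for x b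
  proof -
    have "real_of_int e \<le> of_int (2 ^ j)" using assms(2) by (simp only: of_int_le_iff)
    also have "real_of_int (2 ^ j) = 2 ^ j" by simp
    finally have "\<bar>2 ^ (i + j) * x - of_int b\<bar> \<le> 2 ^ j" using that by linarith
    moreover have "2 ^ (i + j) * x - of_int b = 2 ^ j * (2 ^ i * x - of_int b / 2 ^ j)"
      by (simp add: power_add right_diff_distrib)
    ultimately have "2 ^ j * \<bar>2 ^ i * x - of_int b / 2 ^ j\<bar> \<le> 2 ^ j * (1 :: real)" by (simp only: abs_mult) simp
    then have "\<bar>2 ^ i * x - of_int b / 2 ^ j\<bar> \<le> 1" by simp
    moreover have "of_int (ishr j b) = real_of_int \<lfloor>real_of_int b / 2 ^ j\<rfloor>"
      unfolding ishr_def using floor_divide_of_int_eq[of b "2 ^ j", where 'a = real] by simp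
    moreover have "real_of_int b / 2 ^ j - 1 < real_of_int \<lfloor>real_of_int b / 2 ^ j\<rfloor>" "real_of_int \<lfloor>real_of_int b / 2 ^ j\<rfloor> \<le> real_of_int b / 2 ^ j"
      by linarith+
    ultimately show ?thesis by linarith
  qed
  show ?thesis using assms(1) unfolding log_enclosure_def by (auto intro!: *)
qed

definition "B_phi = (32790317722714024221253746879709018112994271630337143857871310879853662546859464830803352204536429265073022457753895882932790444361457 :: int)"
definition "B_3 = (3119195134339866680305507271592875563679328626529120966708147044457557081347638047946397435083308656018910706359632545117409797646268 :: int)"
definition "B_5 = (4569538277760102293709286044899997280581180439515316761866085142187935420491734239933099926346098443275618868236501641955445808756586 :: int)"

text \<open>440 bits suffice for the later reductions, where the product of n and Q has at most
  about 350 bits.\<close>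

lemma log_enclosure_coarse: "log_enclosure (2 ^ 440) 2 B_phi B_3 B_5"
proof -
  have "ishr 392 (116 * LN31 + 84 * LN49 + 51 * LN161 + 2 * LS) = B_phi \<and>
    ishr 392 (11 * LN31 + 8 * LN49 + 5 * LN161) = B_3 \<and>
    ishr 392 (16 * LN31 + 12 * LN49 + 7 * LN161) = B_5" by code_simp
  moreover have e: "(440 :: nat) + 392 = 832" by simp
  ultimately show ?thesis using log_enclosure_ishr[of 440 392, unfolded e, OF log_enclosure_fine] by simp
qed

lemma idiv_eq: "idiv x d = \<lfloor>real_of_int x / real_of_int d\<rfloor>" and ishr_eq: "ishr g x = \<lfloor>real_of_int x / 2 ^ g\<rfloor>"
  using floor_divide_of_int_eq[of x d, where 'a = real] floor_divide_of_int_eq[of x "2 ^ g", where 'a = real]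
  by (simp_all add: idiv_def ishr_def)

section \<open>Linear forms as residues modulo powers of two\<close>

definition kappa :: "nat \<Rightarrow> int \<Rightarrow> real" where "kappa s Q = 2 ^ s * of_int Q / ln 3"

text \<open>\<open>P / Q\<close> is a convergent of \<open>ln \<phi> / ln 3\<close> and \<open>C\<close> approximates \<open>kappa s Q * ln (sqrt 5)\<close>. Multiplication by
  \<open>kappa s Q\<close> turns \<open>ln 3\<close> into an element of \<open>2 ^ s \<int>\<close> and \<open>ln \<phi>\<close> almost into one, hence the residues modulo \<open>2 ^ s\<close> below.\<close>

definition stage_check :: "int \<Rightarrow> int \<Rightarrow> int \<Rightarrow> int \<Rightarrow> int \<Rightarrow> nat \<Rightarrow> int \<Rightarrow> int \<Rightarrow> int \<Rightarrow> int \<Rightarrow> int \<Rightarrow> bool" where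
  "stage_check W e bphi b3 b5 s Q P N tau C \<longleftrightarrow> Q > 0 \<and> P \<ge> 0 \<and> N \<ge> 0 \<and> C \<ge> 0 \<and>
     100 * (N * 2 ^ s * (\<bar>Q * bphi - 24 * P * b3\<bar> + e * (Q + 24 * P))) \<le> 2616 * (W * tau) \<and>
     50 * (\<bar>2 ^ s * Q * b5 - 2 * C * b3\<bar> + e * (2 ^ s * Q + 2 * C)) \<le> 109 * W"

lemma enclosure_combination:
  fixes u v x y W e :: real
  assumes "\<bar>W * x - a\<bar> \<le> e" "\<bar>W * y - b\<bar> \<le> e" "u \<ge> 0" "v \<ge> 0"
  shows "\<bar>W * (u * x - v * y)\<bar> \<le> \<bar>u * a - v * b\<bar> + e * (u + v)"
proof -
  have "W * (u * x - v * y) = (u * a - v * b) + u * (W * x - a) - v * (W * y - b)" by (simp add: algebra_simps)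
  moreover have "\<bar>u * (W * x - a)\<bar> \<le> u * e" "\<bar>v * (W * y - b)\<bar> \<le> v * e"
    using assms by (simp_all add: abs_mult mult_left_mono)
  moreover have "e * (u + v) = u * e + v * e" by (simp add: algebra_simps)
  ultimately show ?thesis by linarith
qed

text \<open>2616 = 24 * 109 combines the factor 24 of the enclosure of ln phi with ln 3 \<ge>
  109/100.\<close>

lemma stage_check_sound:
  assumes l: "log_enclosure W e bphi b3 b5" and c: "stage_check W e bphi b3 b5 s Q P N tau C"
  shows "of_int N * \<bar>kappa s Q * ln phi - 2 ^ s * of_int P\<bar> \<le> of_int tau" "\<bar>kappa s Q * ln (sqrt 5) - of_int C\<bar> \<le> 1"
proof -
  have W: "W > 0" and b: "\<bar>of_int W * (24 * ln phi) - of_int bphi\<bar> \<le> real_of_int e"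
    "\<bar>of_int W * ln 3 - of_int b3\<bar> \<le> real_of_int e" "\<bar>of_int W * ln 5 - of_int b5\<bar> \<le> real_of_int e"
    using l by (auto simp: log_enclosure_def)
  have p: "Q > 0" "P \<ge> 0" "N \<ge> 0" "C \<ge> 0"
    and c1: "100 * (N * 2 ^ s * (\<bar>Q * bphi - 24 * P * b3\<bar> + e * (Q + 24 * P))) \<le> 2616 * (W * tau)"
    and c2: "50 * (\<bar>2 ^ s * Q * b5 - 2 * C * b3\<bar> + e * (2 ^ s * Q + 2 * C)) \<le> 109 * W"
    using c by (auto simp: stage_check_def)
  have l3: "ln (3 :: real) > 0" using ln3_bounds by linarith
  have W': "real_of_int W > 0" using W by simp
  define R where "R = \<bar>Q * bphi - 24 * P * b3\<bar> + e * (Q + 24 * P)"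
  have "\<bar>of_int W * (of_int Q * (24 * ln phi) - of_int (24 * P) * ln 3)\<bar> \<le>
      \<bar>of_int Q * of_int bphi - of_int (24 * P) * of_int b3\<bar> + of_int e * (of_int Q + of_int (24 * P))"
    by (rule enclosure_combination[OF b(1,2)]) (use p in auto)
  also have "\<dots> = of_int R" by (simp add: R_def)
  also have "of_int W * (of_int Q * (24 * ln phi) - of_int (24 * P) * ln 3) = 24 * of_int W * (of_int Q * ln phi - of_int P * ln 3)"
    by (simp add: algebra_simps)
  finally have r: "24 * of_int W * \<bar>of_int Q * ln phi - of_int P * ln 3\<bar> \<le> of_int R" using W' by (simp add: abs_mult)
  have k: "kappa s Q * ln phi - 2 ^ s * of_int P = 2 ^ s * (of_int Q * ln phi - of_int P * ln 3) / ln 3"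
    using l3 by (simp add: kappa_def field_simps)
  have "24 * of_int W * (of_int N * \<bar>kappa s Q * ln phi - 2 ^ s * of_int P\<bar>) * ln 3 =
      of_int N * 2 ^ s * (24 * of_int W * \<bar>of_int Q * ln phi - of_int P * ln 3\<bar>)"
    unfolding k using l3 by (simp add: abs_mult)
  also have "\<dots> \<le> of_int N * 2 ^ s * of_int R" by (rule mult_left_mono[OF r]) (use p in auto)
  also have "\<dots> \<le> 2616 / 100 * (of_int W * of_int tau)"
  proof -
    have "real_of_int (100 * (N * 2 ^ s * R)) \<le> of_int (2616 * (W * tau))" using c1 unfolding R_def by (simp only: of_int_le_iff)
    then show ?thesis by (simp add: mult_ac)
  qed
  finally have "of_int W * (of_int N * \<bar>kappa s Q * ln phi - 2 ^ s * of_int P\<bar> * ln 3) \<le> of_int W * (109 / 100 * of_int tau)" by (simp add: mult_ac)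
  then have 1: "of_int N * \<bar>kappa s Q * ln phi - 2 ^ s * of_int P\<bar> * ln 3 \<le> 109 / 100 * of_int tau"
    using W' by (simp only: mult_le_cancel_left_pos)
  have "of_int N * \<bar>kappa s Q * ln phi - 2 ^ s * of_int P\<bar> * (109 / 100) \<le> of_int N * \<bar>kappa s Q * ln phi - 2 ^ s * of_int P\<bar> * ln 3"
    by (rule mult_left_mono) (use ln3_bounds p in auto)
  then show "of_int N * \<bar>kappa s Q * ln phi - 2 ^ s * of_int P\<bar> \<le> of_int tau" using 1 by linarith
  have "\<bar>real_of_int W * (real_of_int (2 ^ s * Q) * ln 5 - real_of_int (2 * C) * ln 3)\<bar> \<le>
      \<bar>of_int (2 ^ s * Q) * of_int b5 - of_int (2 * C) * of_int b3\<bar> + of_int e * (of_int (2 ^ s * Q) + of_int (2 * C))"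
    by (rule enclosure_combination[OF b(3,2)]) (use p in auto)
  also have "\<dots> = of_int (\<bar>2 ^ s * Q * b5 - 2 * C * b3\<bar> + e * (2 ^ s * Q + 2 * C))" by simp
  also have "\<dots> \<le> 109 / 50 * of_int W"
  proof -
    have "real_of_int (50 * (\<bar>2 ^ s * Q * b5 - 2 * C * b3\<bar> + e * (2 ^ s * Q + 2 * C))) \<le> of_int (109 * W)"
      using c2 by (simp only: of_int_le_iff)
    then show ?thesis by simp
  qed
  finally have "of_int W * \<bar>real_of_int (2 ^ s * Q) * ln 5 - real_of_int (2 * C) * ln 3\<bar> \<le> of_int W * (109 / 50)" using W' by (simp add: abs_mult)
  then have "\<bar>real_of_int (2 ^ s * Q) * ln 5 - real_of_int (2 * C) * ln 3\<bar> \<le> 109 / 50"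
    using W' by (simp only: mult_le_cancel_left_pos)
  moreover have "kappa s Q * ln (sqrt 5) - of_int C = (real_of_int (2 ^ s * Q) * ln 5 - real_of_int (2 * C) * ln 3) / (2 * ln 3)"
    using l3 by (simp add: kappa_def ln_sqrt field_simps)
  ultimately have "\<bar>kappa s Q * ln (sqrt 5) - of_int C\<bar> * (2 * ln 3) \<le> 109 / 50" using l3 by simp
  also have "\<dots> \<le> 1 * (2 * ln 3)" using ln3_bounds by simp
  finally show "\<bar>kappa s Q * ln (sqrt 5) - of_int C\<bar> \<le> 1"
    by (rule mult_right_le_imp_le) (use l3 in simp)
qed

text \<open>Multiplied by kappa, y ln 3 becomes a multiple of 2^s exactly, and x ln phi one up to
  \<open>tau\<close> since \<open>x\<close> is at most \<open>N\<close>.\<close>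

lemma lattice_close:
  assumes d: "of_int N * \<bar>kappa s Q * ln phi - 2 ^ s * of_int P\<bar> \<le> real_of_int tau"
    and x: "int x \<le> N" and Q: "Q > 0" and eps: "\<bar>real x * ln phi - real y * ln 3 - w\<bar> \<le> eps"
  shows "\<bar>kappa s Q * w - 2 ^ s * of_int (int x * P - int y * Q)\<bar> \<le> of_int tau + kappa s Q * eps"
proof -
  have l3: "ln (3 :: real) > 0" using ln3_bounds by linarith
  have k: "kappa s Q > 0" "kappa s Q * ln 3 = 2 ^ s * of_int Q" using l3 Q by (simp_all add: kappa_def)
  have "kappa s Q * w - 2 ^ s * of_int (int x * P - int y * Q) =
      real x * (kappa s Q * ln phi - 2 ^ s * of_int P) - real y * (kappa s Q * ln 3 - 2 ^ s * of_int Q)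
      - kappa s Q * (real x * ln phi - real y * ln 3 - w)"
    by (simp add: algebra_simps)
  also have "\<dots> = real x * (kappa s Q * ln phi - 2 ^ s * of_int P) - kappa s Q * (real x * ln phi - real y * ln 3 - w)"
    unfolding k by simp
  finally have e: "kappa s Q * w - 2 ^ s * of_int (int x * P - int y * Q) =
      real x * (kappa s Q * ln phi - 2 ^ s * of_int P) - kappa s Q * (real x * ln phi - real y * ln 3 - w)" .
  have "real x \<le> of_int N" using x by linarith
  then have "\<bar>real x * (kappa s Q * ln phi - 2 ^ s * of_int P)\<bar> \<le> of_int N * \<bar>kappa s Q * ln phi - 2 ^ s * of_int P\<bar>"
    by (simp only: abs_mult) (intro mult_mono, auto)
  moreover have "\<bar>kappa s Q * (real x * ln phi - real y * ln 3 - w)\<bar> \<le> kappa s Q * eps"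
    using k eps by (simp add: abs_mult mult_left_mono)
  ultimately show ?thesis unfolding e using d by linarith
qed

text \<open>Without a constant term the integer x P - y Q is nonzero, because P and Q are coprime by
  the Bezout relation and 0 < x < Q. So the form is at least 2^s up to the errors.\<close>

lemma homogeneous_gap:
  assumes d: "of_int N * \<bar>kappa s Q * ln phi - 2 ^ s * of_int P\<bar> \<le> real_of_int tau"
    and x: "int x \<le> N" "N < Q" "0 < x" and PQ: "\<bar>P * a - Q * b\<bar> = 1"
    and eps: "\<bar>real x * ln phi - real y * ln 3\<bar> \<le> eps"
  shows "2 ^ s \<le> of_int tau + kappa s Q * eps"
proof -
  have ne: "int x * P - int y * Q \<noteq> 0"
  proof
    assume *: "int x * P - int y * Q = 0"
    have "int x * (P * a - Q * b) = (int x * P) * a - Q * (int x * b)" by (simp add: algebra_simps)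
    also have "int x * P = int y * Q" using * by simp
    also have "int y * Q * a - Q * (int x * b) = Q * (int y * a - int x * b)" by (simp add: algebra_simps)
    finally have "Q dvd int x * (P * a - Q * b)" by simp
    moreover have "P * a - Q * b = 1 \<or> P * a - Q * b = - 1" using PQ by linarith
    ultimately have "Q dvd int x" by auto
    then show False using x zdvd_imp_le[of Q "int x"] by auto
  qed
  have "Q > 0" using x by linarith
  from lattice_close[OF d x(1) this, of y 0 eps] eps
  have "2 ^ s * \<bar>real_of_int (int x * P - int y * Q)\<bar> \<le> of_int tau + kappa s Q * eps" by (simp add: abs_mult)
  moreover have "\<bar>real_of_int (int x * P - int y * Q)\<bar> \<ge> 1" using ne by linarith
  then have "2 ^ s * \<bar>real_of_int (int x * P - int y * Q)\<bar> \<ge> 2 ^ s * (1 :: real)" by (intro mult_left_mono) auto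
  ultimately show ?thesis by linarith
qed

text \<open>With \<open>hi = 2 ^ s - lo\<close> this says that \<open>v\<close> has distance at
  least \<open>lo\<close> from the multiples of 2^s.\<close>

definition gap :: "nat \<Rightarrow> int \<Rightarrow> int \<Rightarrow> int \<Rightarrow> bool" where
  "gap s lo hi v \<longleftrightarrow> (let r = ilow s v in lo \<le> r \<and> r \<le> hi)"

lemma gapD:
  assumes "gap s lo hi v" "lo + hi = 2 ^ s" "\<bar>real_of_int v - 2 ^ s * of_int z\<bar> \<le> r"
  shows "of_int lo \<le> r"
proof -
  define m where "m = v mod 2 ^ s"
  have m: "lo \<le> m" "m \<le> 2 ^ s - lo" using assms(1,2) by (auto simp: gap_def Let_def ilow_def m_def)
  have "v - 2 ^ s * z = m + 2 ^ s * (v div 2 ^ s - z)" by (simp add: m_def right_diff_distrib)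
  moreover define t where "t = v div 2 ^ s - z"
  ultimately have vz: "v - 2 ^ s * z = m + 2 ^ s * t" by simp
  have "lo \<le> \<bar>m + 2 ^ s * t\<bar>"
  proof (cases "t \<ge> 0")
    case True
    then have "2 ^ s * t \<ge> 0" by simp
    then show ?thesis using m by linarith
  next
    case False
    then have "2 ^ s * t \<le> 2 ^ s * (- 1)" by (intro mult_left_mono) auto
    then show ?thesis using m by linarith
  qed
  then have "real_of_int lo \<le> of_int \<bar>v - 2 ^ s * z\<bar>" unfolding vz by (simp only: of_int_le_iff)
  also have "\<dots> = \<bar>real_of_int v - 2 ^ s * of_int z\<bar>" by simp
  finally show ?thesis using assms(3) by linarith
qed

section \<open>Tables for ln (1 - phi^(-d)) and ln (1 - 3^(-k))\<close>

text \<open>Descending powers of \<open>1 / \<phi>\<close> by \<open>\<phi> ^ (- i - 2) = \<phi> ^ (- i) - \<phi> ^ (- i - 1)\<close>; rounding errors grow like \<open>\<phi> ^ i\<close>, which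
  the \<open>g\<close> guard bits absorb.\<close>

fun fib_down :: "nat \<Rightarrow> nat \<Rightarrow> int \<Rightarrow> int \<Rightarrow> int list" where
  "fib_down 0 g a b = []"
| "fib_down (Suc N) g a b = ishr g a # fib_down N g b (a - b)"

fun third_down :: "nat \<Rightarrow> int \<Rightarrow> int list" where
  "third_down 0 a = []"
| "third_down (Suc N) a = a # third_down N (idiv a 3)"

text \<open>\<open>c\<close> counts down to the next multiple of d and is reset to \<open>e\<close>
  = d - 1. Picking every d-th entry, one table of powers of r serves the series of - ln (1 - r^d)
  for all d.\<close>

fun log_series_from :: "nat \<Rightarrow> nat \<Rightarrow> int \<Rightarrow> int list \<Rightarrow> int" where
  "log_series_from c e j [] = 0"
| "log_series_from 0 e j (y # ys) = idiv y j + log_series_from e e (j + 1) ys"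
| "log_series_from (Suc c) e j (y # ys) = log_series_from c e j ys"

definition log_series :: "int list \<Rightarrow> nat \<Rightarrow> int" where
  "log_series H d = log_series_from d (d - 1) 1 H"

text \<open>A final entry of at most 1 certifies that the table reaches far enough for the tail of
  the series to be negligible.\<close>

fun last_small :: "int list \<Rightarrow> bool" where
  "last_small [] = False"
| "last_small [x] = (x \<le> 1)"
| "last_small (x # y # xs) = last_small (y # xs)"

lemma last_smallD: "last_small xs \<Longrightarrow> xs \<noteq> [] \<and> last xs \<le> 1"
  by (induction xs rule: last_small.induct) auto

lemma length_fib_down [simp]: "length (fib_down N g a b) = N"
  by (induction N g a b rule: fib_down.induct) auto

lemma length_third_down [simp]: "length (third_down N a) = N"
  by (induction N a rule: third_down.induct) auto

lemma fib_down_nth: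
  assumes "\<bar>x - of_int a\<bar> \<le> rho" "\<bar>x / phi - of_int b\<bar> \<le> rho * phi" "i < N"
  shows "\<bar>x / 2 ^ g * (1 / phi) ^ i - of_int (fib_down N g a b ! i)\<bar> \<le> rho * phi ^ i / 2 ^ g + 1"
  using assms
proof (induction N g a b arbitrary: x rho i rule: fib_down.induct)
  case (2 N g a b)
  show ?case
  proof (cases i)
    case 0
    have "\<bar>x / 2 ^ g - of_int a / 2 ^ g\<bar> \<le> rho / 2 ^ g"
      using 2(2) by (simp add: divide_right_mono flip: diff_divide_distrib)
    moreover have "\<bar>of_int a / 2 ^ g - real_of_int (ishr g a)\<bar> \<le> 1" unfolding ishr_eq by linarith
    ultimately show ?thesis using 0 by simp
  next
    case (Suc i')
    have p: "phi > 0" "phi * phi = phi + 1" using phi_bounds phi_sq by auto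
    have one: "(phi - 1) * phi = 1" using p(2) by (simp add: left_diff_distrib)
    have inv: "y / phi = y * (phi - 1)" for y :: real using p(1) one by (simp add: divide_eq_eq mult.assoc)
    have "x / phi / phi = x * ((phi - 1) * phi) - x * (phi - 1)" unfolding inv by (simp add: algebra_simps)
    then have "x / phi / phi = x - x / phi" unfolding one inv[symmetric] by simp
    \<comment> \<open>The error bounds satisfy the Fibonacci recursion of the table itself.\<close>
    moreover have "rho * phi * phi = rho * phi + rho" by (simp only: mult.assoc p(2) distrib_left mult_1_right)
    ultimately have "\<bar>x / phi / phi - of_int (a - b)\<bar> \<le> rho * phi * phi" using 2(2,3) by simp
    from "2.IH"[OF 2(3) this, of i'] 2(4) Suc show ?thesis by (simp add: mult_ac)
  qed
qed simp

lemma third_down_nth: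
  fixes x :: real
  assumes "\<bar>x - of_int a\<bar> \<le> 2" "i < N"
  shows "\<bar>x * (1 / 3) ^ i - of_int (third_down N a ! i)\<bar> \<le> 2"
  using assms
proof (induction N a arbitrary: x i rule: third_down.induct)
  case (2 N a)
  show ?case
  proof (cases i)
    case 0
    then show ?thesis using 2 by simp
  next
    case (Suc i')
    have "\<bar>of_int a / 3 - real_of_int (idiv a 3)\<bar> \<le> 1" unfolding idiv_eq by simp linarith
    moreover have "\<bar>x / 3 - of_int a / 3\<bar> \<le> 2 / 3" using 2(2) by linarith
    ultimately have "\<bar>x / 3 - of_int (idiv a 3)\<bar> \<le> 2" by linarith
    from "2.IH"[OF this, of i'] 2(3) Suc show ?thesis by simp
  qed
qed simp

lemma log_series_from_eq:
  "length xs \<le> F \<Longrightarrow> log_series_from c e j xs =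
    (\<Sum>i<F. if c + (e + 1) * i < length xs then idiv (xs ! (c + (e + 1) * i)) (j + int i) else 0)"
proof (induction c e j xs arbitrary: F rule: log_series_from.induct)
  case (2 e j y ys)
  then obtain F' where F: "F = Suc F'" "length ys \<le> F'" by (cases F) auto
  have idx: "0 + (e + 1) * Suc i = Suc (e + (e + 1) * i)" for i by simp
  have "(if 0 + (e + 1) * Suc i < length (y # ys) then idiv ((y # ys) ! (0 + (e + 1) * Suc i)) (j + int (Suc i)) else 0) =
      (if e + (e + 1) * i < length ys then idiv (ys ! (e + (e + 1) * i)) (j + 1 + int i) else 0)" for i
    unfolding idx by (simp only: length_Cons Suc_less_eq nth_Cons_Suc) (simp add: add_ac)
  then show ?case unfolding F(1) sum.lessThan_Suc_shift by (simp only: log_series_from.simps "2.IH"[OF F(2)]) simp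
next
  case (3 c e j y ys)
  have "length ys \<le> F" using 3 by simp
  from "3.IH"[OF this] show ?case
    by (simp only: log_series_from.simps add_Suc length_Cons Suc_less_eq nth_Cons_Suc)
qed simp

lemma log_series_eq:
  assumes "d \<ge> 1"
  shows "log_series H d = (\<Sum>i<length H. if d * (i + 1) < length H then idiv (H ! (d * (i + 1))) (1 + int i) else 0)"
proof -
  have "d + (d - 1 + 1) * i = d * (i + 1)" for i using assms by simp
  then show ?thesis using log_series_from_eq[OF le_refl, of d "d - 1" 1 H] by (simp only: log_series_def)
qed

text \<open>Each of the \<open>(length H - 1) div d\<close> terms contributes at most 2 from the
  table and 1 from the division. The tail contributes 3 * 2, since its first power lies beyond the
  table.\<close>

lemma log_series_approx:
  fixes r x :: real
  assumes H: "\<And>i. i < length H \<Longrightarrow> \<bar>x * r ^ i - of_int (H ! i)\<bar> \<le> 2" and ne: "H \<noteq> []" "last H \<le> 1"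
    and r: "0 < r" "r \<le> 2 / 3" and x: "x \<ge> 0" and d: "d \<ge> 1"
  shows "\<bar>x * (- ln (1 - r ^ d)) - of_int (log_series H d)\<bar> \<le> real (3 * ((length H - 1) div d) + 6)"
proof -
  define J where "J = (length H - 1) div d"
  define t where "t = r ^ d"
  have "r ^ d \<le> r ^ 1" by (rule power_decreasing) (use r d in auto)
  then have t: "0 \<le> t" "t \<le> 2 / 3" using r by (auto simp: t_def)
  have idx: "d * (i + 1) < length H \<longleftrightarrow> i < J" for i
  proof -
    have "d * (i + 1) < length H \<longleftrightarrow> d * (i + 1) \<le> length H - 1" using ne(1) by (cases "length H") auto
    also have "\<dots> \<longleftrightarrow> i + 1 \<le> J" unfolding J_def using d by (simp add: less_eq_div_iff_mult_less_eq mult.commute)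
    finally show ?thesis by auto
  qed
  have "J \<le> length H - 1" by (simp add: J_def)
  then have JH: "J \<le> length H" by simp
  have "log_series H d = (\<Sum>i<length H. if i < J then idiv (H ! (d * (i + 1))) (1 + int i) else 0)"
    unfolding log_series_eq[OF d] idx ..
  also have "\<dots> = (\<Sum>i<J. idiv (H ! (d * (i + 1))) (1 + int i))"
    using JH by (intro sum.mono_neutral_cong_right) auto
  finally have s: "real_of_int (log_series H d) = (\<Sum>i<J. real_of_int (idiv (H ! (d * (i + 1))) (1 + int i)))" by simp
  have "\<bar>x * (\<Sum>i<J. t ^ (i + 1) / real (i + 1)) - (\<Sum>i<J. real_of_int (idiv (H ! (d * (i + 1))) (1 + int i)))\<bar> \<le> (\<Sum>i<J. 3)"
    unfolding sum_distrib_left sum_subtractf[symmetric]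
  proof (rule order.trans[OF sum_abs sum_mono])
    fix i assume "i \<in> {..<J}"
    then have "d * (i + 1) < length H" using idx by auto
    then have "\<bar>x * r ^ (d * (i + 1)) - of_int (H ! (d * (i + 1)))\<bar> \<le> 2" by (rule H)
    then have h: "\<bar>x * t ^ (i + 1) - of_int (H ! (d * (i + 1)))\<bar> \<le> 2" by (simp only: t_def power_mult)
    have "\<bar>x * t ^ (i + 1) - of_int (H ! (d * (i + 1)))\<bar> / real (i + 1) \<le> 2 / 1"
      by (intro frac_le) (use h in auto)
    then have "\<bar>x * (t ^ (i + 1) / real (i + 1)) - of_int (H ! (d * (i + 1))) / real (i + 1)\<bar> \<le> 2"
      by (simp add: diff_divide_distrib[symmetric] abs_divide)
    moreover have "\<bar>of_int (H ! (d * (i + 1))) / real (i + 1) - real_of_int (idiv (H ! (d * (i + 1))) (1 + int i))\<bar> \<le> 1"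
      unfolding idiv_eq by (simp add: add_ac) linarith
    ultimately show "\<bar>x * (t ^ (i + 1) / real (i + 1)) - real_of_int (idiv (H ! (d * (i + 1))) (1 + int i))\<bar> \<le> 3"
      by linarith
  qed
  then have 1: "\<bar>x * (\<Sum>i<J. t ^ (i + 1) / real (i + 1)) - of_int (log_series H d)\<bar> \<le> 3 * real J"
    unfolding s by simp
  have "x * t ^ (J + 1) \<le> 2"
  proof -
    have "length H - 1 < length H" using ne(1) by simp
    moreover have "real_of_int (H ! (length H - 1)) \<le> 1" using ne by (simp add: last_conv_nth)
    ultimately have l: "x * r ^ (length H - 1) \<le> 3" using H[of "length H - 1"] by linarith
    have "\<not> d * (J + 1) < length H" using idx[of J] by simp
    then have "r ^ (d * (J + 1)) \<le> r ^ Suc (length H - 1)" using ne(1) r by (intro power_decreasing) (cases H, auto)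
    then have "x * t ^ (J + 1) \<le> x * r ^ Suc (length H - 1)" unfolding t_def power_mult[symmetric] using x by (rule mult_left_mono)
    also have "\<dots> = r * (x * r ^ (length H - 1))" by simp
    also have "\<dots> \<le> 2 / 3 * 3" by (rule mult_mono) (use r l x in auto)
    finally show ?thesis by simp
  qed
  moreover have "x * (\<Sum>i<J. t ^ (i + 1) / real (i + 1)) \<le> x * (- ln (1 - t))"
    by (rule mult_left_mono[OF neg_ln_approx(1)[OF t] x])
  moreover have "x * (- ln (1 - t)) \<le> x * ((\<Sum>i<J. t ^ (i + 1) / real (i + 1)) + 3 * t ^ (J + 1))"
    by (rule mult_left_mono[OF neg_ln_approx(2)[OF t] x])
  ultimately have "\<bar>x * (- ln (1 - t)) - x * (\<Sum>i<J. t ^ (i + 1) / real (i + 1))\<bar> \<le> 6"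
    by (simp only: distrib_left abs_le_iff) linarith
  then show ?thesis using 1 unfolding t_def[symmetric] J_def[symmetric] by simp
qed

text \<open>\<open>U0\<close> and \<open>U1\<close> approximate 2^g kappa and its quotient by phi.
  The second is checked over the integers through (U1 - U0 / phi) (U1 + U0 phi) = U1^2 + U1 U0 -
  U0^2.\<close>

definition kappa_check :: "int \<Rightarrow> int \<Rightarrow> int \<Rightarrow> nat \<Rightarrow> nat \<Rightarrow> int \<Rightarrow> int \<Rightarrow> int \<Rightarrow> bool" where
  "kappa_check W e b3 s g Q U0 U1 \<longleftrightarrow> Q > 0 \<and> U0 \<ge> 0 \<and> U1 \<ge> 0 \<and>
     100 * (\<bar>2 ^ (s + g) * Q * W - U0 * b3\<bar> + e * U0) \<le> 109 * W \<and>
     \<bar>U1 * U1 + U1 * U0 - U0 * U0\<bar> \<le> U1 + U0"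

lemma kappa_check:
  assumes l: "log_enclosure W e bphi b3 b5" and c: "kappa_check W e b3 s g Q U0 U1"
  shows "\<bar>2 ^ g * kappa s Q - of_int U0\<bar> \<le> 1" "\<bar>2 ^ g * kappa s Q / phi - of_int U1\<bar> \<le> phi"
proof -
  have W: "real_of_int W > 0" and b: "\<bar>of_int W * ln 3 - of_int b3\<bar> \<le> real_of_int e"
    using l by (auto simp: log_enclosure_def)
  have p: "Q > 0" "U0 \<ge> 0" "U1 \<ge> 0" and c1: "100 * (\<bar>2 ^ (s + g) * Q * W - U0 * b3\<bar> + e * U0) \<le> 109 * W"
    and c2: "\<bar>U1 * U1 + U1 * U0 - U0 * U0\<bar> \<le> U1 + U0"
    using c by (auto simp: kappa_check_def)
  have l3: "ln (3 :: real) > 0" using ln3_bounds by linarith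
  define A where "A = real_of_int (2 ^ (s + g) * Q)"
  have "\<bar>of_int W * (A - of_int U0 * ln 3)\<bar> \<le> \<bar>of_int W * A - of_int U0 * of_int b3\<bar> + of_int e * of_int U0"
  proof -
    have "of_int W * (A - of_int U0 * ln 3) = (of_int W * A - of_int U0 * of_int b3) - of_int U0 * (of_int W * ln 3 - of_int b3)"
      by (simp add: algebra_simps)
    moreover have "\<bar>of_int U0 * (of_int W * ln 3 - of_int b3)\<bar> \<le> of_int U0 * real_of_int e"
      using b p by (simp add: abs_mult mult_left_mono)
    ultimately show ?thesis by (simp add: mult.commute)
  qed
  also have "\<dots> = of_int (\<bar>2 ^ (s + g) * Q * W - U0 * b3\<bar> + e * U0)" by (simp add: A_def mult_ac)
  also have "\<dots> \<le> 109 / 100 * of_int W"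
  proof -
    have "real_of_int (100 * (\<bar>2 ^ (s + g) * Q * W - U0 * b3\<bar> + e * U0)) \<le> of_int (109 * W)"
      using c1 by (simp only: of_int_le_iff)
    then show ?thesis by simp
  qed
  finally have "of_int W * \<bar>A - of_int U0 * ln 3\<bar> \<le> of_int W * (109 / 100)" using W by (simp add: abs_mult)
  then have "\<bar>A - of_int U0 * ln 3\<bar> \<le> 109 / 100" using W by (simp only: mult_le_cancel_left_pos)
  moreover have "2 ^ g * kappa s Q - of_int U0 = (A - of_int U0 * ln 3) / ln 3"
    using l3 by (simp add: kappa_def A_def power_add field_simps)
  ultimately have "\<bar>2 ^ g * kappa s Q - of_int U0\<bar> * ln 3 \<le> 1 * ln 3" using l3 ln3_bounds by simp
  then show 1: "\<bar>2 ^ g * kappa s Q - of_int U0\<bar> \<le> 1" by (rule mult_right_le_imp_le) (use l3 in simp)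
  define u v where "u = real_of_int U0" and "v = real_of_int U1"
  have uv: "u \<ge> 0" "v \<ge> 0" using p by (simp_all add: u_def v_def)
  have ph: "phi > 1" "phi * phi = phi + 1" "phi \<noteq> 0" using phi_bounds phi_sq by auto
  have "\<bar>v - u / phi\<bar> \<le> 1"
  proof (cases "v + u * phi = 0")
    case True
    then have "u * phi = 0" "v = 0" using uv ph mult_nonneg_nonneg[of u phi] by linarith+
    then show ?thesis using ph by simp
  next
    case False
    then have pos: "v + u * phi > 0" using uv ph mult_nonneg_nonneg[of u phi] by linarith
    have "(v - u / phi) * (v + u * phi) = v * v + v * u * (phi - 1 / phi) - u * u" using ph(3) by (simp add: field_simps)
    also have "phi - 1 / phi = 1" using ph by (simp add: field_simps)
    finally have "\<bar>v - u / phi\<bar> * (v + u * phi) = \<bar>v * v + v * u - u * u\<bar>" using pos by (simp add: abs_mult[symmetric] abs_mult_pos)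
    also have "\<dots> = of_int \<bar>U1 * U1 + U1 * U0 - U0 * U0\<bar>" by (simp add: u_def v_def)
    also have "\<dots> \<le> of_int (U1 + U0)" using c2 by (simp only: of_int_le_iff)
    also have "\<dots> = v + u * 1" by (simp add: u_def v_def)
    also have "\<dots> \<le> 1 * (v + u * phi)" using mult_left_mono[of 1 phi u] uv ph by simp
    finally show ?thesis by (rule mult_right_le_imp_le[OF _ pos])
  qed
  moreover have "\<bar>2 ^ g * kappa s Q / phi - u / phi\<bar> \<le> 1 / phi"
    using 1 ph by (simp add: u_def divide_right_mono flip: diff_divide_distrib)
  moreover have "1 / phi = phi - 1" using ph by (simp add: field_simps)
  ultimately show "\<bar>2 ^ g * kappa s Q / phi - of_int U1\<bar> \<le> phi" unfolding v_def by linarith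
qed

text \<open>Since phi^10 < 2^7, seven guard bits per ten table entries absorb the error growth
  phi^i.\<close>

lemma phi_power_le: "i \<le> 10 * c \<Longrightarrow> phi ^ i \<le> 2 ^ (7 * c)"
proof -
  assume "i \<le> 10 * c"
  then have "phi ^ i \<le> phi ^ (10 * c)" using phi_bounds by (intro power_increasing) auto
  also have "\<dots> \<le> (16185 / 10000) ^ (10 * c)" using phi_bounds by (intro power_mono) auto
  also have "\<dots> \<le> (2 ^ 7) ^ c" unfolding power_mult by (rule power_mono) (simp_all add: power_divide)
  finally show ?thesis by (simp add: power_mult)
qed

lemma phi_table:
  assumes l: "log_enclosure W e bphi b3 b5" and c: "kappa_check W e b3 s (7 * c) Q U0 U1"
    and N: "N \<le> 10 * c" "N \<ge> 1" and H: "H = fib_down N (7 * c) U0 U1" "last H \<le> 1" and d: "d \<ge> 1"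
  shows "\<bar>kappa s Q * (- ln (1 - (1 / phi) ^ d)) - of_int (log_series H d)\<bar> \<le> real (3 * ((N - 1) div d) + 6)"
proof -
  note k = kappa_check[OF l c]
  have ph: "phi > 1" "phi < 16185 / 10000" "phi > 1618 / 1000" using phi_bounds by auto
  have len: "length H = N" by (simp add: H)
  have "\<bar>kappa s Q * (1 / phi) ^ i - of_int (H ! i)\<bar> \<le> 2" if "i < length H" for i
  proof -
    have i: "i < N" using that len by simp
    have e: "2 ^ (7 * c) * kappa s Q / 2 ^ (7 * c) = kappa s Q" by simp
    have "\<bar>2 ^ (7 * c) * kappa s Q / 2 ^ (7 * c) * (1 / phi) ^ i - of_int (fib_down N (7 * c) U0 U1 ! i)\<bar> \<le> 1 * phi ^ i / 2 ^ (7 * c) + 1"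
      by (rule fib_down_nth[OF k(1) _ i]) (use k(2) in simp)
    moreover have "1 * phi ^ i / 2 ^ (7 * c) \<le> 1" using phi_power_le[of i c] i N by simp
    ultimately show ?thesis unfolding H e by linarith
  qed
  moreover have "kappa s Q \<ge> 0" using c ln3_bounds by (auto simp: kappa_def kappa_check_def)
  moreover have "H \<noteq> []" using len N by auto
  ultimately have "\<bar>kappa s Q * (- ln (1 - (1 / phi) ^ d)) - of_int (log_series H d)\<bar> \<le> real (3 * ((length H - 1) div d) + 6)"
    using H(2) d ph by (intro log_series_approx) (auto simp: field_simps)
  then show ?thesis unfolding len .
qed

lemma third_table:
  assumes l: "log_enclosure W e bphi b3 b5" and c: "kappa_check W e b3 s g Q U0 U1"
    and N: "N \<ge> 1" and H: "H = third_down N (ishr g U0)" "last H \<le> 1" and d: "d \<ge> 1"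
  shows "\<bar>kappa s Q * (- ln (1 - (1 / 3) ^ d)) - of_int (log_series H d)\<bar> \<le> real (3 * ((N - 1) div d) + 6)"
proof -
  have "\<bar>2 ^ g * kappa s Q - of_int U0\<bar> / 2 ^ g \<le> 1 / 1" by (rule frac_le) (use kappa_check(1)[OF l c] in auto)
  also have "\<bar>2 ^ g * kappa s Q - of_int U0\<bar> / 2 ^ g = \<bar>(2 ^ g * kappa s Q - of_int U0) / 2 ^ g\<bar>" by simp
  finally have "\<bar>kappa s Q - of_int U0 / 2 ^ g\<bar> \<le> 1" by (simp add: diff_divide_distrib)
  moreover have "\<bar>of_int U0 / 2 ^ g - real_of_int (ishr g U0)\<bar> \<le> 1" unfolding ishr_eq by linarith
  ultimately have k: "\<bar>kappa s Q - of_int (ishr g U0)\<bar> \<le> 2" by linarith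
  have len: "length H = N" by (simp add: H)
  have "\<bar>kappa s Q * (1 / 3) ^ i - of_int (H ! i)\<bar> \<le> 2" if "i < length H" for i
    using third_down_nth[OF k, of i N] that len by (simp add: H)
  moreover have "kappa s Q \<ge> 0" using c ln3_bounds by (auto simp: kappa_def kappa_check_def)
  moreover have "H \<noteq> []" using len N by auto
  ultimately have "\<bar>kappa s Q * (- ln (1 - (1 / 3) ^ d)) - of_int (log_series H d)\<bar> \<le> real (3 * ((length H - 1) div d) + 6)"
    using H(2) d by (intro log_series_approx) auto
  then show ?thesis unfolding len .
qed

text \<open>The exceptions \<open>d = 4\<close>, \<open>d = 8\<close> and \<open>(d, k) = (12, 2)\<close> are unavoidable: there the constant term of the
  linear form lies in the lattice spanned by \<open>ln \<phi>\<close> and \<open>ln 3\<close>, as in \<open>1 - \<phi> ^ (- 4) = sqrt 5 / \<phi>\<^sup>2\<close>.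
  They are treated by coprimality of \<open>P\<close> and \<open>Q\<close> instead.\<close>

fun series_table :: "nat \<Rightarrow> int \<Rightarrow> int list \<Rightarrow> nat list \<Rightarrow> (nat \<times> int) list" where
  "series_table s C H [] = []"
| "series_table s C H (d # ds) = (d, ilow s (C + log_series H d)) # series_table s C H ds"

fun phi_gaps :: "nat \<Rightarrow> int \<Rightarrow> int \<Rightarrow> (nat \<times> int) list \<Rightarrow> bool" where
  "phi_gaps s lo hi [] = True"
| "phi_gaps s lo hi ((d, f) # fs) = ((if gap s lo hi f then True else d = 4 \<or> d = 8) \<and> phi_gaps s lo hi fs)"

fun third_gaps :: "nat \<Rightarrow> int \<Rightarrow> int \<Rightarrow> int \<Rightarrow> (nat \<times> int) list \<Rightarrow> bool" where
  "third_gaps s lo hi C [] = True"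
| "third_gaps s lo hi C ((k, g) # gs) = (gap s lo hi (C - g) \<and> third_gaps s lo hi C gs)"

fun row_gaps :: "nat \<Rightarrow> int \<Rightarrow> int \<Rightarrow> nat \<Rightarrow> int \<Rightarrow> (nat \<times> int) list \<Rightarrow> bool" where
  "row_gaps s lo hi d f [] = True"
| "row_gaps s lo hi d f ((k, g) # gs) =
    ((if gap s lo hi (f - g) then True else d = 12 \<and> k = 2) \<and> row_gaps s lo hi d f gs)"

text \<open>Adding 2^s to the residue \<open>f\<close> keeps \<open>f - g\<close> positive, so that
  \<open>ilow\<close> reads off binary digits.\<close>

fun pair_gaps :: "nat \<Rightarrow> int \<Rightarrow> int \<Rightarrow> (nat \<times> int) list \<Rightarrow> (nat \<times> int) list \<Rightarrow> bool" where
  "pair_gaps s lo hi gs [] = True"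
| "pair_gaps s lo hi gs ((d, f) # fs) = (row_gaps s lo hi d (f + 2 ^ s) gs \<and> pair_gaps s lo hi gs fs)"

definition phi_check where
  "phi_check s lo hi C H ds \<longleftrightarrow> last_small H \<and> phi_gaps s lo hi (series_table s C H ds)"

definition third_check where
  "third_check s lo hi C H ks \<longleftrightarrow> last_small H \<and> third_gaps s lo hi C (series_table s 0 H ks)"

definition table_gaps where
  "table_gaps s C lo2 hi2 lo3 hi3 lo4 hi4 fs gs \<longleftrightarrow>
     phi_gaps s lo2 hi2 fs \<and> third_gaps s lo3 hi3 C gs \<and> pair_gaps s lo4 hi4 gs fs"

definition full_check where
  "full_check s C lo2 hi2 lo3 hi3 lo4 hi4 H ds T ks \<longleftrightarrow> last_small H \<and> last_small T \<and>
     table_gaps s C lo2 hi2 lo3 hi3 lo4 hi4 (series_table s C H ds) (series_table s 0 T ks)"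

lemma series_tableD: "d \<in> set ds \<Longrightarrow> (d, ilow s (C + log_series H d)) \<in> set (series_table s C H ds)"
  by (induction ds) auto

lemma phi_gapsD: "phi_gaps s lo hi fs \<Longrightarrow> (d, f) \<in> set fs \<Longrightarrow> gap s lo hi f \<or> d = 4 \<or> d = 8"
  by (induction s lo hi fs rule: phi_gaps.induct) (auto split: if_splits)

lemma third_gapsD: "third_gaps s lo hi C gs \<Longrightarrow> (k, g) \<in> set gs \<Longrightarrow> gap s lo hi (C - g)"
  by (induction s lo hi C gs rule: third_gaps.induct) auto

lemma row_gapsD: "row_gaps s lo hi d f gs \<Longrightarrow> (k, g) \<in> set gs \<Longrightarrow> gap s lo hi (f - g) \<or> d = 12 \<and> k = 2"
  by (induction s lo hi d f gs rule: row_gaps.induct) (auto split: if_splits)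

lemma pair_gapsD:
  "pair_gaps s lo hi gs fs \<Longrightarrow> (d, f) \<in> set fs \<Longrightarrow> (k, g) \<in> set gs \<Longrightarrow> gap s lo hi (f + 2 ^ s - g) \<or> d = 12 \<and> k = 2"
  by (induction s lo hi gs fs rule: pair_gaps.induct) (auto dest: row_gapsD)

lemma gap_mod: "v mod 2 ^ s = w mod 2 ^ s \<Longrightarrow> gap s lo hi v = gap s lo hi w"
  by (simp add: gap_def ilow_def)

lemma series_gaps:
  shows "phi_gaps s lo hi (series_table s C H ds) \<Longrightarrow> d \<in> set ds \<Longrightarrow> gap s lo hi (C + log_series H d) \<or> d = 4 \<or> d = 8"
    and "third_gaps s lo hi C (series_table s 0 T ks) \<Longrightarrow> k \<in> set ks \<Longrightarrow> gap s lo hi (C - log_series T k)"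
    and "pair_gaps s lo hi (series_table s 0 T ks) (series_table s C H ds) \<Longrightarrow> d \<in> set ds \<Longrightarrow> k \<in> set ks \<Longrightarrow>
      gap s lo hi (C + log_series H d - log_series T k) \<or> d = 12 \<and> k = 2"
proof -
  show "gap s lo hi (C + log_series H d) \<or> d = 4 \<or> d = 8"
    if "phi_gaps s lo hi (series_table s C H ds)" "d \<in> set ds"
    using phi_gapsD[OF that(1) series_tableD[OF that(2)]]
    by (subst gap_mod[of _ _ "ilow s (C + log_series H d)"]) (simp_all add: ilow_def)
  show "gap s lo hi (C - log_series T k)" if "third_gaps s lo hi C (series_table s 0 T ks)" "k \<in> set ks"
    using third_gapsD[OF that(1) series_tableD[OF that(2)]]
    by (subst gap_mod[of _ _ "C - ilow s (0 + log_series T k)"]) (simp_all add: ilow_def mod_diff_right_eq)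
  show "gap s lo hi (C + log_series H d - log_series T k) \<or> d = 12 \<and> k = 2"
    if "pair_gaps s lo hi (series_table s 0 T ks) (series_table s C H ds)" "d \<in> set ds" "k \<in> set ks"
  proof -
    define a b where "a = C + log_series H d" and "b = 0 + log_series T k"
    have "(a mod 2 ^ s + 2 ^ s - b mod 2 ^ s) mod 2 ^ s = ((a mod 2 ^ s - b mod 2 ^ s) + 2 ^ s) mod 2 ^ s"
      by (simp only: diff_add_eq)
    also have "\<dots> = (a - b) mod 2 ^ s" by (simp only: mod_add_self2 mod_diff_eq)
    finally have e: "(a - b) mod 2 ^ s = (a mod 2 ^ s + 2 ^ s - b mod 2 ^ s) mod 2 ^ s" ..
    have "gap s lo hi (a mod 2 ^ s + 2 ^ s - b mod 2 ^ s) \<or> d = 12 \<and> k = 2"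
      using pair_gapsD[OF that(1) series_tableD[OF that(2)] series_tableD[OF that(3)]]
      unfolding ilow_def a_def b_def .
    then show ?thesis unfolding gap_mod[OF e, symmetric] by (simp add: a_def b_def)
  qed
qed


section \<open>Certificates for the four reductions\<close>

text \<open>\<open>Q1\<close> exceeds the bound for n only 14-fold, as a single gap is needed.
  Tables of gaps have smaller minima, so the later stages take this factor about 450 and then above
  20000, with more bits \<open>s\<close>.\<close>

definition "P1 = (14153067714568034050636795067533366560427880251235073116802616304328214260013504682059817240743991340420622956086510497910 :: int)"
definition "Q1 = (32311621003183860905906254215423759950147606606441260376971822426101469211215357013611294775708123864474959073865774563449 :: int)"
definition "C1 = (378685353449100659623008449948068656751578520336668701695176789785659792697959107642726780249095922303289280242158998582744 :: int)"

lemma stage_check_1: "stage_check (2 ^ 832) 600 (116 * LN31 + 84 * LN49 + 51 * LN161 + 2 * LS)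
    (11 * LN31 + 8 * LN49 + 5 * LN161) (16 * LN31 + 12 * LN49 + 7 * LN161) 4 Q1 P1 2300000000000000000000000000000000000000000000000000000000000000000000000000000000000000000000000000000000000000000000009 1 C1" by code_simp

text \<open>Residue 8 modulo 16: Q1 ln (sqrt 5) / ln 3 is close to half an odd integer, the largest
  gap possible.\<close>

lemma gap_1: "gap 4 8 8 C1" by code_simp

definition "P2 = (449513145145143366599682776053997376519248992308690345 :: int)"
definition "Q2 = (1026243827472731919375543100305502293733656995844839201 :: int)"
definition "C2 = (788225082286548770019025761776139624402443507227608135185399 :: int)"

definition "U2 = (12592012278371541493219704014535470716041843561033632941331561994106950895987284650491103364645677640756295525321062587074 :: int)"
definition "V2 = (7782291574789615070841769358191929924249866759169410148778097873366779449724327567159083318747219650246523247549564185837 :: int)"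

lemma stage_check_2: "stage_check (2 ^ 440) 2 B_phi B_3 B_5 20 Q2 P2 2300000000000000000000000000000000000000000000000009 686 C2" by code_simp

lemma kappa_check_2: "kappa_check (2 ^ 440) 2 B_3 20 (7 * 29) Q2 U2 V2" by code_simp

lemma coprime_2: "\<bar>P2 * 216206180652450223926044114976301382521354004077972265 - Q2 * 94702172781140836177368928257848415665351647747222226\<bar> = 1" by code_simp

lemma gap_2: "gap 20 472055 576521 C2" by code_simp

text \<open>The smaller of \<open>X\<close> and \<open>Y\<close> will be at most 7/10 * 184, which
  gives d < 269 here and k < 119 in the table for 3.\<close>

lemma phi_check_2: "phi_check 20 2087 1046489 C2 (fib_down 287 (7 * 29) U2 V2) [1..<269]"
  by code_simp

lemma third_check_2: "third_check 20 5760 1042816 C2 (third_down 127 (ishr (7 * 29) U2)) [1..<119]"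
  by code_simp

definition "P3 = (29928923103827801643879 :: int)"
definition "Q3 = (68328085462977841091431 :: int)"
definition "C3 = (3358759583311619816663246671140 :: int)"

definition "U3 = (169310632246476441576573482778923477846118333134141142401237773 :: int)"
definition "V3 = (104639725385056405003512792904304195311771868808718970728723359 :: int)"

lemma stage_check_3: "stage_check (2 ^ 440) 2 B_phi B_3 B_5 26 Q3 P3 2300000000000000009 476 C3" by code_simp

lemma kappa_check_3: "kappa_check (2 ^ 440) 2 B_3 26 (7 * 15) Q3 U3 V3" by code_simp

lemma coprime_3: "\<bar>P3 * 59094253249152487024622 - Q3 * 25884339497999034880069\<bar> = 1" by code_simp

lemma gap_3: "gap 26 24408796 42700068 C3" by code_simp

text \<open>The ranges are those of 7/10 * 85, the bound for both \<open>X\<close> and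
  \<open>Y\<close>, because the pairs involve d and k at once.\<close>

lemma full_check_3: "full_check 26 C3 442633 66666231 1198377 65910487 6174 67102690
    (fib_down 147 (7 * 15) U3 V3) [1..<125] (third_down 65 (ishr (7 * 15) U3)) [1..<56]"
  by code_simp

definition "P4 = (1498319 :: int)"
definition "Q4 = (3420680 :: int)"
definition "C4 = (168148158309918 :: int)"

definition "U4 = (117629884516994077234622936854 :: int)"
definition "V4 = (72699266724227347719888378005 :: int)"

lemma stage_check_4: "stage_check (2 ^ 440) 2 B_phi B_3 B_5 26 Q4 P4 147 268 C4" by code_simp

lemma kappa_check_4: "kappa_check (2 ^ 440) 2 B_3 26 (7 * 7) Q4 U4 V4" by code_simp

lemma coprime_4: "\<bar>P4 * 2404879 - Q4 * 1053380\<bar> = 1" by code_simp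

lemma gap_4: "gap 26 12655074 54453790 C4" by code_simp

lemma full_check_4: "full_check 26 C4 1474896 65633968 3183533 63925331 22338 67086526
    (fib_down 69 (7 * 7) U4 V4) [1..<44] (third_down 31 (ishr (7 * 7) U4)) [1..<20]"
  by code_simp

section \<open>Baker-Davenport reduction\<close>

lemma kappa_le: "Q > 0 \<Longrightarrow> kappa s Q \<le> 2 ^ s * of_int Q * (100 / 109)"
proof -
  assume "Q > 0"
  then have "2 ^ s * of_int Q / ln 3 \<le> 2 ^ s * of_int Q / (109 / 100 :: real)"
    using ln3_bounds by (intro divide_left_mono) auto
  then show ?thesis by (simp add: kappa_def)
qed

text \<open>Solves a gap inequality for \<open>x\<close>: \<open>lo - c\<close> is what the errors
  leave of the gap, 2^j bounds its ratio to the scale, and 7/10 stands for ln 2.\<close>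

lemma decay:
  assumes l: "of_int lo \<le> of_int c + kappa s Q * (of_int b * exp (- x))" and Q: "Q > 0" and b: "b > 0"
    and j: "100 * b * 2 ^ s * Q \<le> 109 * (lo - c) * 2 ^ j" and lc: "c < lo"
  shows "x \<le> 7 / 10 * real j"
proof -
  have "kappa s Q * (of_int b * exp (- x)) \<le> 2 ^ s * of_int Q * (100 / 109) * (of_int b * exp (- x))"
    by (rule mult_right_mono[OF kappa_le[OF Q]]) (use b in auto)
  then have "109 * real_of_int (lo - c) \<le> of_int (100 * b * 2 ^ s * Q) * exp (- x)" using l by (simp add: algebra_simps)
  also have "\<dots> \<le> of_int (109 * (lo - c) * 2 ^ j) * exp (- x)" using j by (intro mult_right_mono) (simp_all only: of_int_le_iff, simp)
  also have "\<dots> = 109 * real_of_int (lo - c) * (2 ^ j * exp (- x))" by simp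
  finally have "109 * real_of_int (lo - c) * 1 \<le> 109 * real_of_int (lo - c) * (2 ^ j * exp (- x))" by simp
  then have "1 \<le> 2 ^ j * exp (- x)" by (rule mult_left_le_imp_le) (use lc in simp)
  then have "exp x \<le> 2 ^ j" by (simp add: exp_minus field_simps)
  then have "x \<le> ln (2 ^ j)" by (subst ln_ge_iff) auto
  also have "\<dots> = real j * ln 2" by (simp add: ln_realpow)
  also have "\<dots> \<le> real j * (7 / 10)" by (rule mult_left_mono[OF ln2_le]) simp
  also have "\<dots> = 7 / 10 * real j" by simp
  finally show ?thesis .
qed

lemma three_power_exp: "1 / 3 ^ m = exp (- (real m * ln 3))"
  by (simp add: exp_minus exp_of_nat_mult inverse_eq_divide)

lemma close_gap:
  assumes "\<bar>kappa s Q * w - 2 ^ s * of_int z\<bar> \<le> of_int tau + kappa s Q * eps" "\<bar>kappa s Q * w - of_int v\<bar> \<le> of_int e"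
    "gap s lo hi v" "lo + hi = 2 ^ s"
  shows "of_int lo \<le> of_int (tau + e) + kappa s Q * eps"
proof (rule gapD[OF assms(3,4)])
  show "\<bar>of_int v - 2 ^ s * of_int z\<bar> \<le> of_int (tau + e) + kappa s Q * eps" using assms(1,2) by simp
qed

text \<open>For even j, phi^(-j) = psi^j, so 1 - phi^(-2 j) = sqrt 5 F_j / phi^j; j = 2, 4, 6 give
  F_j = 1, 3, 8, which are products of 2 and 3 only.\<close>

lemma one_minus_phi_powers:
  "1 - 1 / phi = 1 / phi ^ 2" "1 - (1 / phi) ^ 2 = 1 / phi" "1 - (1 / phi) ^ 4 = sqrt 5 / phi ^ 2"
  "1 - (1 / phi) ^ 8 = 3 * sqrt 5 / phi ^ 4" "1 - (1 / phi) ^ 12 = 8 * sqrt 5 / phi ^ 6"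
proof -
  have p: "phi > 0" using phi_bounds by simp
  define q where "q = phi - 1"
  have q: "1 / phi = q" "phi = q + 1" "q * q = 1 - q" "sqrt 5 = 2 * q + 1"
    using p phi_sq by (auto simp: q_def field_simps phi_def)
  have q4: "q ^ 4 = 2 - 3 * q"
  proof -
    have "q ^ 4 = (q * q) * (q * q)" by (simp add: power4_eq_xxxx)
    also have "\<dots> = 1 - 2 * q + q * q" unfolding q(3) by (simp add: algebra_simps q(3))
    finally show ?thesis using q(3) by simp
  qed
  have q8: "q ^ 8 = 13 - 21 * q"
  proof -
    have "q ^ 8 = q ^ 4 * q ^ 4" by (simp flip: power_add)
    also have "\<dots> = 4 - 12 * q + 9 * (q * q)" unfolding q4 by (simp add: algebra_simps)
    finally show ?thesis using q(3) by simp
  qed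
  have q6: "q ^ 6 = 5 - 8 * q"
  proof -
    have "q ^ 6 = q ^ 4 * (q * q)" by (simp flip: power_add power2_eq_square)
    also have "\<dots> = (2 - 3 * q) * (1 - q)" unfolding q4 q(3) ..
    also have "\<dots> = 2 - 5 * q + 3 * (q * q)" by (simp add: algebra_simps)
    finally show ?thesis using q(3) by simp
  qed
  have q12: "q ^ 12 = 89 - 144 * q"
  proof -
    have "q ^ 12 = q ^ 6 * q ^ 6" by (simp flip: power_add)
    also have "\<dots> = 25 - 80 * q + 64 * (q * q)" unfolding q6 by (simp add: algebra_simps)
    finally show ?thesis using q(3) by simp
  qed
  have d: "a / phi ^ n = a * q ^ n" for a n using q(1) by (metis power_one_over times_divide_eq_right mult.right_neutral)
  show "1 - 1 / phi = 1 / phi ^ 2" using q(3) unfolding d by (simp add: q(1) power2_eq_square)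
  show "1 - (1 / phi) ^ 2 = 1 / phi" using q(3) by (simp add: q(1) power2_eq_square)
  show "1 - (1 / phi) ^ 4 = sqrt 5 / phi ^ 2" unfolding d q(1) q4 q(4) unfolding power2_eq_square q(3) using q(3) by (simp add: algebra_simps)
  show "1 - (1 / phi) ^ 8 = 3 * sqrt 5 / phi ^ 4" unfolding d q(1) q8 q4 q(4) using q(3) by (simp add: algebra_simps)
  show "1 - (1 / phi) ^ 12 = 8 * sqrt 5 / phi ^ 6" unfolding d q(1) q12 q6 q(4) using q(3) by (simp add: algebra_simps)
qed

context collision
begin

lemma n_le: "real n \<le> 23 / 10 * real m + 9"
proof -
  have "sqrt 5 \<le> phi ^ 2" using sqrt5_bounds phi_bounds unfolding power2_eq_square phi_sq by linarith
  then have "ln (sqrt 5) \<le> ln (phi ^ 2)" by (subst ln_le_cancel_iff) (use phi_bounds in auto)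
  then have s5: "ln (sqrt 5) \<le> 1" using ln_phi_bounds phi_bounds by (simp add: ln_realpow)
  have "\<bar>Lam\<bar> \<le> 3" using Lam_0 E_bounds D_bounds by linarith
  then have "real n * ln phi \<le> real m * ln 3 + 4" using s5 by (simp add: Lam_def)
  moreover have "real n * (48 / 100) \<le> real n * ln phi" by (rule mult_left_mono) (use ln_phi_bounds in auto)
  moreover have "real m * ln 3 \<le> real m * (11 / 10)" by (rule mult_left_mono) (use ln3_bounds in auto)
  ultimately have "real n * (48 / 100) \<le> real m * (11 / 10) + 4" by linarith
  then show ?thesis by simp
qed

lemma X_ge: "48 / 100 * real d \<le> X" and Y_ge: "109 / 100 * real k \<le> Y"
  using mult_left_mono[OF ln_phi_bounds(1), of "real d"] mult_left_mono[OF ln3_bounds(1), of "real k"]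
  by (simp_all add: X_def Y_def)

context
  fixes s :: nat and Q P N tau C :: int
  assumes close: "of_int N * \<bar>kappa s Q * ln phi - 2 ^ s * of_int P\<bar> \<le> real_of_int tau"
    and C: "\<bar>kappa s Q * ln (sqrt 5) - of_int C\<bar> \<le> 1" and Q: "Q > 0" and nN: "int n \<le> N"
begin

text \<open>600 = 100 * 6 comes from the error 6 exp (- min X Y), just as 300, 600 and 100 in the
  next three bounds come from 3 E, 6 D and 1 / 3^m.\<close>

lemma min_XY_bound:
  assumes "gap s lo hi C" "lo + hi = 2 ^ s" "tau + 1 < lo" "600 * 2 ^ s * Q \<le> 109 * (lo - (tau + 1)) * 2 ^ j"
  shows "min X Y \<le> 7 / 10 * real j"
proof -
  have "\<bar>real n * ln phi - real m * ln 3 - ln (sqrt 5)\<bar> \<le> 3 * E + 3 * D" using Lam_0 by (simp add: Lam_def)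
  from close_gap[OF lattice_close[OF close nN Q this] _ assms(1,2), of 1] C
  have "of_int lo \<le> of_int (tau + 1) + kappa s Q * (3 * E + 3 * D)" by simp
  also have "kappa s Q * (3 * E + 3 * D) \<le> kappa s Q * (of_int 6 * exp (- min X Y))"
  proof (rule mult_left_mono)
    have "E \<le> exp (- min X Y)" "D \<le> exp (- min X Y)" by (auto simp: DE)
    then show "3 * E + 3 * D \<le> of_int 6 * exp (- min X Y)" by simp
    show "0 \<le> kappa s Q" using Q ln3_bounds by (simp add: kappa_def)
  qed
  finally show ?thesis by (rule decay[OF _ Q]) (use assms in auto)
qed

lemma Y_bound:
  assumes "\<bar>kappa s Q * (- ln (1 - D)) - of_int v\<bar> \<le> of_int e" "gap s lo hi (C + v)" "lo + hi = 2 ^ s" "tau + (1 + e) < lo"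
    "300 * 2 ^ s * Q \<le> 109 * (lo - (tau + (1 + e))) * 2 ^ j"
  shows "Y \<le> 7 / 10 * real j"
proof -
  have "\<bar>real n * ln phi - real m * ln 3 - (ln (sqrt 5) + - ln (1 - D))\<bar> \<le> 3 * E" using Lam_d by (simp add: Lam_def)
  note l = lattice_close[OF close nN Q this]
  have "\<bar>kappa s Q * (ln (sqrt 5) + - ln (1 - D)) - of_int (C + v)\<bar> \<le> of_int (1 + e)"
    using C assms(1) unfolding distrib_left by simp
  from close_gap[OF l this assms(2,3)]
  have "of_int lo \<le> of_int (tau + (1 + e)) + kappa s Q * (of_int 3 * exp (- Y))" by (simp add: DE)
  then show ?thesis by (rule decay[OF _ Q]) (use assms in auto)
qed

lemma X_bound:
  assumes "\<bar>kappa s Q * (- ln (1 - E)) - of_int v\<bar> \<le> of_int e" "gap s lo hi (C - v)" "lo + hi = 2 ^ s" "tau + (1 + e) < lo"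
    "600 * 2 ^ s * Q \<le> 109 * (lo - (tau + (1 + e))) * 2 ^ j"
  shows "X \<le> 7 / 10 * real j"
proof -
  have "\<bar>real n * ln phi - real m * ln 3 - (ln (sqrt 5) - - ln (1 - E))\<bar> \<le> 6 * D" using Lam_k by (simp add: Lam_def)
  note l = lattice_close[OF close nN Q this]
  have "\<bar>kappa s Q * (ln (sqrt 5) - - ln (1 - E)) - of_int (C - v)\<bar> \<le> of_int (1 + e)"
    using C assms(1) unfolding right_diff_distrib by simp
  from close_gap[OF l this assms(2,3)]
  have "of_int lo \<le> of_int (tau + (1 + e)) + kappa s Q * (of_int 6 * exp (- X))" by (simp add: DE)
  then show ?thesis by (rule decay[OF _ Q]) (use assms in auto)
qed

lemma m_bound:
  assumes "\<bar>kappa s Q * (- ln (1 - D)) - of_int v\<bar> \<le> of_int e" "\<bar>kappa s Q * (- ln (1 - E)) - of_int v'\<bar> \<le> of_int e'"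
    "gap s lo hi (C + v - v')" "lo + hi = 2 ^ s" "tau + (1 + e + e') < lo"
    "100 * 2 ^ s * Q \<le> 109 * (lo - (tau + (1 + e + e'))) * 2 ^ j"
  shows "real m * ln 3 \<le> 7 / 10 * real j"
proof -
  have "\<bar>real n * ln phi - real m * ln 3 - (ln (sqrt 5) + - ln (1 - D) - - ln (1 - E))\<bar> \<le> 1 / 3 ^ m"
    using Lam_full by (simp add: Lam_def algebra_simps)
  note l = lattice_close[OF close nN Q this]
  have "\<bar>kappa s Q * (ln (sqrt 5) + - ln (1 - D) - - ln (1 - E)) - of_int (C + v - v')\<bar> \<le> of_int (1 + e + e')"
    using C assms(1,2) unfolding right_diff_distrib distrib_left by simp
  from close_gap[OF l this assms(3,4)]
  have "of_int lo \<le> of_int (tau + (1 + e + e')) + kappa s Q * (of_int 1 * exp (- (real m * ln 3)))"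
    by (simp add: three_power_exp)
  then show ?thesis by (rule decay[OF _ Q]) (use assms in auto)
qed

context
  fixes a b :: int
  assumes PQ: "\<bar>P * a - Q * b\<bar> = 1" and NQ: "N < Q"
begin

text \<open>Here 1 - D is sqrt 5 or 3 sqrt 5 over a power of phi. This cancels ln (sqrt 5) and
  leaves a homogeneous form in n - d / 2 and in m or m - 1.\<close>

lemma Y_bound_special:
  assumes "d = 4 \<or> d = 8" "tau < 2 ^ s" "300 * 2 ^ s * Q \<le> 109 * (2 ^ s - tau) * 2 ^ j"
  shows "Y \<le> 7 / 10 * real j"
proof -
  define x y where "x = n - d div 2" and "y = m - (if d = 4 then 0 else 1)"
  have xn: "int x \<le> N" "0 < x" "real n = real x + real (d div 2)" using nN dn d by (auto simp: x_def)
  have y: "real m = real y + (if d = 4 then 0 else 1)" using k km by (auto simp: y_def)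
  have p: "phi > 0" using phi_bounds by simp
  have l: "ln (1 - (1 / phi) ^ 4) = ln (sqrt 5) - 2 * ln phi" "ln (1 - (1 / phi) ^ 8) = ln (3 * sqrt 5) - 4 * ln phi"
    using p unfolding one_minus_phi_powers by (simp_all add: ln_div ln_realpow)
  have "ln (3 * sqrt 5) = ln 3 + ln (sqrt 5)" by (rule ln_mult_pos) auto
  then have "Lam + ln (1 - D) = real x * ln phi - real y * ln 3"
    using assms(1) l by (auto simp: Lam_def D_def xn(3) y algebra_simps)
  then have "\<bar>real x * ln phi - real y * ln 3\<bar> \<le> 3 * E" using Lam_d by simp
  from homogeneous_gap[OF close xn(1) NQ xn(2) PQ this]
  have "of_int (2 ^ s) \<le> of_int tau + kappa s Q * (of_int 3 * exp (- Y))" by (simp add: DE)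
  then show ?thesis by (rule decay[OF _ Q]) (use assms in auto)
qed

text \<open>1 - D = 8 sqrt 5 / phi^6 and 1 - E = 8 / 9: the factors 8 cancel, leaving (n - 6) ln phi
  - (m - 2) ln 3.\<close>

lemma m_bound_special:
  assumes "d = 12" "k = 2" "tau < 2 ^ s" "100 * 2 ^ s * Q \<le> 109 * (2 ^ s - tau) * 2 ^ j"
  shows "real m * ln 3 \<le> 7 / 10 * real j"
proof -
  define x y where "x = n - 6" and "y = m - 2"
  have xn: "int x \<le> N" "0 < x" "real n = real x + 6" using nN dn assms by (auto simp: x_def)
  have y: "real m = real y + 2" using assms km by (auto simp: y_def)
  have p: "phi > 0" using phi_bounds by simp
  have "D = (1 / phi) ^ 12" by (subst D_def) (simp only: assms(1))
  then have "ln (1 - D) = ln (8 * sqrt 5) - 6 * ln phi"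
    using p one_minus_phi_powers(5) by (simp only: ln_div ln_realpow) (simp add: ln_div ln_realpow)
  moreover have "ln (8 * sqrt 5) = ln 8 + ln (sqrt 5)" by (rule ln_mult_pos) auto
  moreover have "E = (1 / 3) ^ 2" by (subst E_def) (simp only: assms(2))
  then have "ln (1 - E) = ln (8 / 3 ^ 2)" by (simp add: power2_eq_square)
  moreover have "ln (8 / 3 ^ 2 :: real) = ln 8 - 2 * ln 3" by (simp only: ln_divide_pos ln_realpow zero_less_power zero_less_numeral of_nat_numeral)
  ultimately have "Lam + ln (1 - D) - ln (1 - E) = real x * ln phi - real y * ln 3"
    using xn(3) y by (simp add: Lam_def algebra_simps)
  then have "\<bar>real x * ln phi - real y * ln 3\<bar> \<le> 1 / 3 ^ m" using Lam_full by simp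
  from homogeneous_gap[OF close xn(1) NQ xn(2) PQ this]
  have "of_int (2 ^ s) \<le> of_int tau + kappa s Q * (of_int 1 * exp (- (real m * ln 3)))" by (simp add: three_power_exp)
  then show ?thesis by (rule decay[OF _ Q]) (use assms in auto)
qed

end

end

end

context collision
begin

context
  fixes W e bphi b3 b5 :: int and s :: nat and Q P N tau C :: int
    and c M L dm km i j :: nat and U V a b lo1 hi1 lo2 hi2 lo3 hi3 :: int and H T :: "int list"
  assumes enc: "log_enclosure W e bphi b3 b5" and sc: "stage_check W e bphi b3 b5 s Q P N tau C"
    and kc: "kappa_check W e b3 s (7 * c) Q U V" and PQ: "\<bar>P * a - Q * b\<bar> = 1" and N: "int n \<le> N" "N < Q"
    and H: "H = fib_down M (7 * c) U V" "1 \<le> M" "M \<le> 10 * c" and T: "T = third_down L (ishr (7 * c) U)" "1 \<le> L"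
    and g: "gap s lo1 hi1 C" "phi_check s lo2 hi2 C H [1..<dm]" "third_check s lo3 hi3 C T [1..<km]"
    and hi: "lo1 + hi1 = 2 ^ s" "lo2 + hi2 = 2 ^ s" "lo3 + hi3 = 2 ^ s"
    and lo: "tau + 1 < lo1" "tau + (1 + (3 * int M + 3)) < lo2" "tau + (1 + (3 * int L + 3)) < lo3" "tau < 2 ^ s"
    and i: "600 * 2 ^ s * Q \<le> 109 * (lo1 - (tau + 1)) * 2 ^ i" "70 * i < 48 * dm" "70 * i < 109 * km" "i \<le> j"
    and j: "300 * 2 ^ s * Q \<le> 109 * (2 ^ s - tau) * 2 ^ j"
      "300 * 2 ^ s * Q \<le> 109 * (lo2 - (tau + (1 + (3 * int M + 3)))) * 2 ^ j"
      "600 * 2 ^ s * Q \<le> 109 * (lo3 - (tau + (1 + (3 * int L + 3)))) * 2 ^ j"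
begin

lemma stage_facts:
  "of_int N * \<bar>kappa s Q * ln phi - 2 ^ s * of_int P\<bar> \<le> real_of_int tau" "\<bar>kappa s Q * ln (sqrt 5) - of_int C\<bar> \<le> 1" "Q > 0"
  using stage_check_sound[OF enc sc] sc by (simp_all add: stage_check_def)

lemma D_table: "\<bar>kappa s Q * (- ln (1 - D)) - of_int (log_series H d)\<bar> \<le> of_int (3 * int M + 3)"
proof -
  have "last H \<le> 1" using g(2) last_smallD by (auto simp: phi_check_def)
  from phi_table[OF enc kc H(3,2,1) this d]
  have "\<bar>kappa s Q * (- ln (1 - D)) - of_int (log_series H d)\<bar> \<le> real (3 * ((M - 1) div d) + 6)" by (simp only: D_def)
  also have "(M - 1) div d \<le> M - 1" by simp
  then have "real (3 * ((M - 1) div d) + 6) \<le> of_int (3 * int M + 3)" using H(2) by linarith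
  finally show ?thesis .
qed

lemma E_table: "\<bar>kappa s Q * (- ln (1 - E)) - of_int (log_series T k)\<bar> \<le> of_int (3 * int L + 3)"
proof -
  have "last T \<le> 1" using g(3) last_smallD by (auto simp: third_check_def)
  from third_table[OF enc kc T(2,1) this k]
  have "\<bar>kappa s Q * (- ln (1 - E)) - of_int (log_series T k)\<bar> \<le> real (3 * ((L - 1) div k) + 6)" by (simp only: E_def)
  also have "(L - 1) div k \<le> L - 1" by simp
  then have "real (3 * ((L - 1) div k) + 6) \<le> of_int (3 * int L + 3)" using T(2) by linarith
  finally show ?thesis .
qed

text \<open>The gap of ln (sqrt 5) bounds the smaller of \<open>X\<close>, \<open>Y\<close> with
  \<open>i\<close> bits. Its index then lies in a table, its factor is moved into the constant term,
  and the new gap bounds the other one with \<open>j\<close> bits.\<close>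

lemma XY_small: "X \<le> 7 / 10 * real j" "Y \<le> 7 / 10 * real j"
proof -
  have Y: "Y \<le> 7 / 10 * real j" if X: "X \<le> 7 / 10 * real i"
  proof -
    have "48 * real d \<le> 70 * real i" using X X_ge by linarith
    then have "d \<in> set [1..<dm]" using i(2) d by simp
    then have "gap s lo2 hi2 (C + log_series H d) \<or> d = 4 \<or> d = 8"
      using g(2) series_gaps(1)[of s lo2 hi2 C H "[1..<dm]" d] unfolding phi_check_def by blast
    then show ?thesis
      using Y_bound[OF stage_facts N(1) D_table _ hi(2) lo(2) j(2)]
        Y_bound_special[OF stage_facts N(1) PQ N(2) _ lo(4) j(1)] by blast
  qed
  have X: "X \<le> 7 / 10 * real j" if Y: "Y \<le> 7 / 10 * real i"
  proof -
    have "109 * real k \<le> 70 * real i" using Y Y_ge by linarith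
    then have "k \<in> set [1..<km]" using i(3) k by simp
    then have "gap s lo3 hi3 (C - log_series T k)"
      using g(3) series_gaps(2)[of s lo3 hi3 C T "[1..<km]" k] unfolding third_check_def by blast
    then show ?thesis using X_bound[OF stage_facts N(1) E_table _ hi(3) lo(3) j(3)] by blast
  qed
  have "min X Y \<le> 7 / 10 * real i" by (rule min_XY_bound[OF stage_facts N(1) g(1) hi(1) lo(1) i(1)])
  moreover have "7 / 10 * real i \<le> 7 / 10 * real j" using i(4) by simp
  ultimately show "X \<le> 7 / 10 * real j" "Y \<le> 7 / 10 * real j" using X Y by (auto simp: min_def split: if_splits)
qed

lemma m_small:
  assumes "70 * j < 48 * dm" "70 * j < 109 * km"
    and "pair_gaps s lo4 hi4 (series_table s 0 T [1..<km]) (series_table s C H [1..<dm])" "lo4 + hi4 = 2 ^ s"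
    and "tau + (1 + (3 * int M + 3) + (3 * int L + 3)) < lo4"
    and "100 * 2 ^ s * Q \<le> 109 * (lo4 - (tau + (1 + (3 * int M + 3) + (3 * int L + 3)))) * 2 ^ l"
    and "100 * 2 ^ s * Q \<le> 109 * (2 ^ s - tau) * 2 ^ l"
  shows "real m * (109 / 100) \<le> 7 / 10 * real l"
proof -
  have "48 * real d \<le> 70 * real j" "109 * real k \<le> 70 * real j" using XY_small X_ge Y_ge by linarith+
  then have "d \<in> set [1..<dm]" "k \<in> set [1..<km]" using assms(1,2) d k by simp_all
  then have "gap s lo4 hi4 (C + log_series H d - log_series T k) \<or> d = 12 \<and> k = 2"
    using series_gaps(3)[OF assms(3)] by blast
  then have "real m * ln 3 \<le> 7 / 10 * real l"
    using m_bound[OF stage_facts N(1) D_table E_table _ assms(4-6)]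
      m_bound_special[OF stage_facts N(1) PQ N(2) _ _ lo(4) assms(7)] by blast
  moreover have "real m * (109 / 100) \<le> real m * ln 3" by (rule mult_left_mono) (use ln3_bounds in auto)
  ultimately show ?thesis by linarith
qed

end

lemma n_le_int:
  assumes "real m < 10 ^ i" "10 * N \<ge> 23 * 10 ^ i + 90"
  shows "int n \<le> N"
proof -
  have "10 * real n \<le> 23 * real m + 90" using n_le by linarith
  also have "\<dots> \<le> real_of_int (23 * 10 ^ i + 90)" using assms(1) by simp
  also have "\<dots> \<le> real_of_int (10 * N)" using assms(2) by (simp only: of_int_le_iff)
  finally show ?thesis by simp
qed

text \<open>410 bits come from 600 * 2^4 * Q1 against 109 * 6 * 2^410, and 7/10 * 410 = 287.\<close>

lemma reduction_1: "min X Y \<le> 300"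
proof -
  have st: "of_int 2300000000000000000000000000000000000000000000000000000000000000000000000000000000000000000000000000000000000000000000009 * \<bar>kappa 4 Q1 * ln phi - 2 ^ 4 * of_int P1\<bar> \<le> real_of_int 1" "\<bar>kappa 4 Q1 * ln (sqrt 5) - of_int C1\<bar> \<le> 1"
    by (rule stage_check_sound[OF log_enclosure_fine stage_check_1])+
  have Q: "Q1 > 0" by (simp add: Q1_def)
  have n: "int n \<le> 2300000000000000000000000000000000000000000000000000000000000000000000000000000000000000000000000000000000000000000000009" by (rule n_le_int[OF m_bound_1]) simp
  have "min X Y \<le> 7 / 10 * real 410"
    by (rule min_XY_bound[OF st Q n gap_1]) (simp_all add: Q1_def)
  then show ?thesis by simp
qed

lemma reduction_2: "X \<le> 140" "Y \<le> 140"
proof -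
  have n: "int n \<le> 2300000000000000000000000000000000000000000000000009" by (rule n_le_int[OF m_bound_2[OF reduction_1]]) simp
  have "X \<le> 7 / 10 * real 192" "Y \<le> 7 / 10 * real 192"
    by (rule XY_small[OF log_enclosure_coarse stage_check_2 kappa_check_2 coprime_2 n _ refl _ _ refl _ gap_2 phi_check_2 third_check_2,
          where i = 184]; simp add: Q2_def)+
  then show "X \<le> 140" "Y \<le> 140" by simp_all
qed

lemma reduction_3: "m < 60"
proof -
  have n: "int n \<le> 2300000000000000009" by (rule n_le_int[OF m_bound_3[OF reduction_2]]) simp
  have f: "phi_check 26 442633 66666231 C3 (fib_down 147 (7 * 15) U3 V3) [1..<125]"
    "third_check 26 1198377 65910487 C3 (third_down 65 (ishr (7 * 15) U3)) [1..<56]"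
    "pair_gaps 26 6174 67102690 (series_table 26 0 (third_down 65 (ishr (7 * 15) U3)) [1..<56])
      (series_table 26 C3 (fib_down 147 (7 * 15) U3 V3) [1..<125])"
    using full_check_3 by (simp_all only: full_check_def table_gaps_def phi_check_def third_check_def)
  have "real m * (109 / 100) \<le> 7 / 10 * real 90"
    by (rule m_small[OF log_enclosure_coarse stage_check_3 kappa_check_3 coprime_3 n _ refl _ _ refl _ gap_3 f(1,2),
          where i = 80 and j = 85, OF _ _ _ _ _ _ _ _ _ _ _ _ _ _ _ _ _ _ _ _ f(3)])
      (simp_all add: Q3_def)
  then show ?thesis by simp
qed

text \<open>147 = 23/10 * 60 + 9 bounds n, so a convergent with seven-digit denominator
  suffices.\<close>

lemma reduction_4: "m \<le> 21"
proof -
  have n: "int n \<le> 147" using n_le reduction_3 by linarith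
  have f: "phi_check 26 1474896 65633968 C4 (fib_down 69 (7 * 7) U4 V4) [1..<44]"
    "third_check 26 3183533 63925331 C4 (third_down 31 (ishr (7 * 7) U4)) [1..<20]"
    "pair_gaps 26 22338 67086526 (series_table 26 0 (third_down 31 (ishr (7 * 7) U4)) [1..<20])
      (series_table 26 C4 (fib_down 69 (7 * 7) U4 V4) [1..<44])"
    using full_check_4 by (simp_all only: full_check_def table_gaps_def phi_check_def third_check_def)
  have "real m * (109 / 100) \<le> 7 / 10 * real 34"
    by (rule m_small[OF log_enclosure_coarse stage_check_4 kappa_check_4 coprime_4 n _ refl _ _ refl _ gap_4 f(1,2),
          where i = 27 and j = 29, OF _ _ _ _ _ _ _ _ _ _ _ _ _ _ _ _ _ _ _ _ f(3)])
      (simp_all add: Q4_def)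
  then show ?thesis by simp
qed

end

section \<open>The remaining finite search\<close>

text \<open>A row is (i, F_i, F_(i-2)). Since F_(n-2) \<le> F_n - F_l < F_n for 2 \<le> l < n, a
  given difference leaves only few candidates for n.\<close>

fun fib_rows :: "nat \<Rightarrow> nat \<Rightarrow> int \<Rightarrow> int \<Rightarrow> (nat \<times> int \<times> int) list" where
  "fib_rows 0 i a b = []"
| "fib_rows (Suc N) i a b = (i, a + b, a) # fib_rows N (Suc i) b (a + b)"

fun power_rows :: "nat \<Rightarrow> nat \<Rightarrow> int \<Rightarrow> (nat \<times> int) list" where
  "power_rows 0 i p = []"
| "power_rows (Suc N) i p = (i, p) # power_rows N (Suc i) (3 * p)"

fun candidates :: "int \<Rightarrow> (nat \<times> int \<times> int) list \<Rightarrow> (nat \<times> int) list" where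
  "candidates v [] = []"
| "candidates v ((i, f, g) # tab) = (if v < f then if g \<le> v then [(i, f - v)] else [] else []) @ candidates v tab"

fun fib_indices :: "int \<Rightarrow> (nat \<times> int \<times> int) list \<Rightarrow> nat list" where
  "fib_indices w [] = []"
| "fib_indices w ((i, f, g) # tab) = (if f = w then [i] else []) @ fib_indices w tab"

fun collect :: "(nat \<times> int \<times> int) list \<Rightarrow> nat \<Rightarrow> nat \<Rightarrow> (nat \<times> int) list \<Rightarrow> (nat \<times> nat \<times> nat \<times> nat) list" where
  "collect tab m l [] = []"
| "collect tab m l ((i, w) # cs) = map (\<lambda>j. (i, j, m, l)) (fib_indices w tab) @ collect tab m l cs"

fun search_from :: "(nat \<times> int \<times> int) list \<Rightarrow> nat \<Rightarrow> int \<Rightarrow> (nat \<times> int) list \<Rightarrow> (nat \<times> nat \<times> nat \<times> nat) list" where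
  "search_from tab l q [] = []"
| "search_from tab l q ((m, p) # ps) = collect tab m l (candidates (p - q) tab) @ search_from tab l q ps"

fun search :: "(nat \<times> int \<times> int) list \<Rightarrow> (nat \<times> int) list \<Rightarrow> (nat \<times> nat \<times> nat \<times> nat) list" where
  "search tab [] = []"
| "search tab ((l, q) # ps) = search_from tab l q ps @ search tab ps"

text \<open>Quadruples (n, l, m, i) with F_n - F_l = 3^m - 3^i, l < n and i < m.\<close>

definition solutions :: "(nat \<times> nat \<times> nat \<times> nat) list" where
  "solutions = [(4, 2, 1, 0), (5, 4, 1, 0), (7, 5, 2, 0), (8, 7, 2, 0), (9, 6, 3, 0), (6, 3, 2, 1), (8, 4, 3, 2), (10, 2, 4, 3)]"

text \<open>m \<le> 21 gives 22 powers, and n \<le> 23/10 * 21 + 9 < 58 gives 56 rows from n = 2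
  on.\<close>

lemma search_solutions: "search (fib_rows 56 2 0 1) (power_rows 22 0 1) = solutions"
  by code_simp

lemma fib_rows_mem:
  assumes "j \<le> i" "i < j + N"
  shows "(i + 2, int (fib (i + 2)), int (fib i)) \<in> set (fib_rows N (j + 2) (int (fib j)) (int (fib (j + 1))))"
  using assms
proof (induction N arbitrary: j)
  case (Suc N)
  show ?case
  proof (cases "i = j")
    case True
    then show ?thesis by simp
  next
    case False
    then have "(i + 2, int (fib (i + 2)), int (fib i)) \<in> set (fib_rows N (Suc j + 2) (int (fib (Suc j))) (int (fib (Suc j + 1))))"
      using Suc.prems by (intro Suc.IH) auto
    then show ?thesis by (simp add: add.commute)
  qed
qed simp

lemma candidates_mem: "(i, f, g) \<in> set tab \<Longrightarrow> v < f \<Longrightarrow> g \<le> v \<Longrightarrow> (i, f - v) \<in> set (candidates v tab)"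
  by (induction v tab rule: candidates.induct) auto

lemma fib_indices_mem: "(i, f, g) \<in> set tab \<Longrightarrow> i \<in> set (fib_indices f tab)"
  by (induction f tab rule: fib_indices.induct) auto

lemma collect_mem: "(i, w) \<in> set cs \<Longrightarrow> j \<in> set (fib_indices w tab) \<Longrightarrow> (i, j, m, l) \<in> set (collect tab m l cs)"
  by (induction tab m l cs rule: collect.induct) auto

lemma search_from_mem:
  "(m, p) \<in> set ps \<Longrightarrow> x \<in> set (collect tab m l (candidates (p - q) tab)) \<Longrightarrow> x \<in> set (search_from tab l q ps)"
  by (induction tab l q ps rule: search_from.induct) auto

lemma search_mem:
  "l < m \<Longrightarrow> j \<le> l \<Longrightarrow> m < j + N \<Longrightarrow> x \<in> set (collect tab m l (candidates (3 ^ m - 3 ^ l) tab)) \<Longrightarrow>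
   x \<in> set (search tab (power_rows N j (3 ^ j)))"
proof (induction N arbitrary: j)
  case (Suc N)
  have mem: "j \<le> i \<Longrightarrow> i < j + N \<Longrightarrow> (i, 3 ^ i) \<in> set (power_rows N j (3 ^ j))" for i j N
  proof (induction N arbitrary: j)
    case (Suc N)
    then show ?case using Suc.IH[of "Suc j"] by (cases "i = j") auto
  qed simp
  show ?case
  proof (cases "l = j")
    case True
    then have "(m, 3 ^ m) \<in> set (power_rows N (Suc j) (3 ^ Suc j))" using mem[of "Suc j" m N] Suc.prems by simp
    from search_from_mem[OF this Suc.prems(4)] True show ?thesis by simp
  next
    case False
    then have "x \<in> set (search tab (power_rows N (Suc j) (3 ^ Suc j)))" using Suc.IH[of "Suc j"] Suc.prems by simp
    then show ?thesis by simp
  qed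
qed simp

lemma (in collision) solution:
  assumes "n - d \<ge> 2"
  shows "(n, n - d, m, m - k) \<in> set solutions"
proof -
  define n' v tab where "n' = n - d" and "v = (3 ^ m - 3 ^ (m - k) :: int)" and "tab = fib_rows 56 2 0 1"
  have n': "n' < n" "2 \<le> n'" using d assms by (simp_all add: n'_def)
  have "10 * real n \<le> 23 * real m + 90" using n_le by linarith
  then have n: "n < 58" using reduction_4 by linarith
  have row: "(i, int (fib i), int (fib (i - 2))) \<in> set tab" if "2 \<le> i" "i < 58" for i
  proof -
    obtain j where j: "i = j + 2" using \<open>2 \<le> i\<close> le_Suc_ex[of 2 i] by auto
    have "fib_rows 56 (0 + 2) (int (fib 0)) (int (fib (0 + 1))) = tab" by (simp add: tab_def numeral_2_eq_2)
    then show ?thesis using fib_rows_mem[of 0 j 56] that unfolding j by simp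
  qed
  have v: "v = int (fib n) - int (fib n')" using eq by (simp add: v_def n'_def)
  have "fib n' > 0" using n' by (simp add: fib_neq_0_nat)
  then have v1: "v < int (fib n)" by (simp add: v)
  have "fib n' \<le> fib (n - 1)" using n' by (intro fib_mono) simp
  moreover have "fib n = fib (n - 1) + fib (n - 2)"
    using n' fib.simps(3)[of "n - 2"] by (simp add: Suc_diff_Suc numeral_2_eq_2)
  ultimately have v2: "int (fib (n - 2)) \<le> v" by (simp add: v)
  have "(n, int (fib n) - v) \<in> set (candidates v tab)" by (rule candidates_mem[OF row v1 v2]) (use n n' in auto)
  moreover have "n' \<in> set (fib_indices (int (fib n) - v) tab)"
    using fib_indices_mem[OF row[of n']] n n' by (simp add: v)
  ultimately have "(n, n', m, m - k) \<in> set (collect tab m (m - k) (candidates v tab))" by (rule collect_mem)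
  then have "(n, n', m, m - k) \<in> set (search tab (power_rows 22 0 (3 ^ 0)))"
    by (intro search_mem) (use k km reduction_4 in \<open>auto simp: v_def\<close>)
  then show ?thesis using search_solutions by (simp add: tab_def n'_def)
qed

section \<open>From the finite list to the representations\<close>

lemma fib_less_iff: "2 \<le> i \<Longrightarrow> 2 \<le> j \<Longrightarrow> fib i < fib j \<longleftrightarrow> i < j"
proof -
  have "fib i < fib j" if "2 \<le> i" "i < j" for i j
  proof -
    have "fib (i - 1) > 0" using that by (simp add: fib_neq_0_nat)
    moreover have "fib (i + 1) = fib i + fib (i - 1)" using that by (cases i) auto
    ultimately have "fib i < fib (i + 1)" by simp
    also have "\<dots> \<le> fib j" using that by (intro fib_mono) simp
    finally show ?thesis .
  qed
  then show "2 \<le> i \<Longrightarrow> 2 \<le> j \<Longrightarrow> fib i < fib j \<longleftrightarrow> i < j" by (metis not_less_iff_gr_or_eq)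
qed

lemma reps_collision:
  assumes "(n, m) \<in> reps c" "(l, i) \<in> reps c" "i < m"
  shows "(n, l, m, i) \<in> set solutions"
proof -
  have r: "n \<ge> 2" "l \<ge> 2" and e: "int (fib n) - int (fib l) = 3 ^ m - 3 ^ i" using assms by (auto simp: reps_def)
  have "(3 :: int) ^ i < 3 ^ m" using assms(3) by (intro power_strict_increasing) auto
  then have "fib l < fib n" using e by linarith
  then have "l < n" using r by (simp add: fib_less_iff)
  then have "collision n (n - l) m (m - i)"
    using assms(3) r e by unfold_locales auto
  from collision.solution[OF this] show ?thesis using \<open>l < n\<close> assms(3) r by simp
qed

lemma reps_distinct:
  assumes "p \<in> reps c" "q \<in> reps c" "p \<noteq> q"
  shows "(fst p, fst q, snd p, snd q) \<in> set solutions \<or> (fst q, fst p, snd q, snd p) \<in> set solutions"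
proof -
  obtain n m l i where pq: "p = (n, m)" "q = (l, i)" by (cases p, cases q)
  have "m \<noteq> i"
  proof
    assume "m = i"
    then have "n \<ge> 2" "l \<ge> 2" "fib n = fib l" using assms by (auto simp: reps_def pq)
    then have "n = l" using fib_less_iff[of n l] fib_less_iff[of l n] by simp
    then show False using assms(3) \<open>m = i\<close> by (simp add: pq)
  qed
  then show ?thesis using reps_collision[of n m c l i] reps_collision[of l i c n m] assms pq by (auto simp: nat_neq_iff)
qed

lemma fib_values: "fib 2 = 1" "fib 3 = 2" "fib 4 = 3" "fib 5 = 5" "fib 6 = 8" "fib 7 = 13" "fib 8 = 21" "fib 9 = 34" "fib 10 = 55"
  by (simp_all add: numeral_eq_Suc)

lemma solution_reps: "(n, l, m, i) \<in> set solutions \<Longrightarrow> (l, i) \<in> reps (int (fib n) - 3 ^ m)"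
  by (auto simp: solutions_def reps_def fib_values)

text \<open>Paired with \<open>(n, m)\<close>, any further representation yields a quadruple of the
  list with the same \<open>c\<close>; uniqueness of that quadruple makes it
  \<open>(l, i)\<close>.\<close>

lemma reps_eqI:
  assumes s: "(n, l, m, i) \<in> set solutions" and c: "int (fib n) - 3 ^ m = c"
    and u: "\<And>n' l' m' i'. (n', l', m', i') \<in> set solutions \<Longrightarrow> int (fib n') - 3 ^ m' = c \<Longrightarrow> n' = n \<and> l' = l \<and> m' = m \<and> i' = i"
  shows "reps c = {(n, m), (l, i)}"
proof
  have li: "(l, i) \<in> reps c" using solution_reps[OF s] c by simp
  have nm: "(n, m) \<in> reps c" using s c by (auto simp: solutions_def reps_def fib_values)
  show "{(n, m), (l, i)} \<subseteq> reps c" using li nm by simp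
  show "reps c \<subseteq> {(n, m), (l, i)}"
  proof (rule subsetI, rule ccontr)
    fix z assume z: "z \<in> reps c" "z \<notin> {(n, m), (l, i)}"
    obtain x y where "z = (x, y)" by (cases z)
    then have xy: "(x, y) \<in> reps c" "(x, y) \<notin> {(n, m), (l, i)}" using z by simp_all
    then have "(x, n, y, m) \<in> set solutions \<or> (n, x, m, y) \<in> set solutions" using reps_distinct[OF xy(1) nm] by auto
    moreover have "int (fib x) - 3 ^ y = c" "int (fib n) - 3 ^ m = c" using xy(1) c by (auto simp: reps_def)
    ultimately show False using u xy(2) by blast
  qed
qed

theorem theorem1:
  shows "(\<forall>c::int. (\<exists>p q. p \<in> reps c \<and> q \<in> reps c \<and> p \<noteq> q)
            \<longleftrightarrow> c \<in> {-26, -6, -1, 0, 2, 4, 7, 12})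
    \<and> reps (-26) = {(10, 4), (2, 3)}
    \<and> reps (-6) = {(8, 3), (4, 2)}
    \<and> reps (-1) = {(6, 2), (3, 1)}
    \<and> reps 0 = {(4, 1), (2, 0)}
    \<and> reps 2 = {(5, 1), (4, 0)}
    \<and> reps 4 = {(7, 2), (5, 0)}
    \<and> reps 7 = {(9, 3), (6, 0)}
    \<and> reps 12 = {(8, 2), (7, 0)}"
proof -
  have r: "reps (-26) = {(10, 4), (2, 3)}" "reps (-6) = {(8, 3), (4, 2)}" "reps (-1) = {(6, 2), (3, 1)}"
    "reps 0 = {(4, 1), (2, 0)}" "reps 2 = {(5, 1), (4, 0)}" "reps 4 = {(7, 2), (5, 0)}"
    "reps 7 = {(9, 3), (6, 0)}" "reps 12 = {(8, 2), (7, 0)}"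
    by (rule reps_eqI; auto simp: solutions_def fib_values)+
  have "c \<in> {-26, -6, -1, 0, 2, 4, 7, 12} \<longleftrightarrow> (\<exists>p q. p \<in> reps c \<and> q \<in> reps c \<and> p \<noteq> q)" for c
  proof
    assume c: "c \<in> {-26, -6, -1, 0, 2, 4, 7, 12}"
    have two: "\<exists>a b. reps c = {a, b} \<and> a \<noteq> b" if "reps c = {a, b}" "a \<noteq> b" for c a b
      using that by blast
    have "\<exists>a b. reps c = {a, b} \<and> a \<noteq> b"
      using c by (elim insertE emptyE) (simp only:, rule two, rule r, simp)+
    then show "\<exists>p q. p \<in> reps c \<and> q \<in> reps c \<and> p \<noteq> q" by blast
  next
    assume "\<exists>p q. p \<in> reps c \<and> q \<in> reps c \<and> p \<noteq> q"
    then obtain p q where p: "p \<in> reps c" "q \<in> reps c" "p \<noteq> q" by blast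
    have "int (fib (fst p)) - 3 ^ snd p = c" "int (fib (fst q)) - 3 ^ snd q = c" using p by (auto simp: reps_def)
    then show "c \<in> {-26, -6, -1, 0, 2, 4, 7, 12}" using reps_distinct[OF p] by (auto simp: solutions_def fib_values)
  qed
  then have "\<forall>c. (\<exists>p q. p \<in> reps c \<and> q \<in> reps c \<and> p \<noteq> q) \<longleftrightarrow> c \<in> {-26, -6, -1, 0, 2, 4, 7, 12}" by simp
  then show ?thesis using r by (intro conjI)
qed

end
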